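(* Let $d>0$, $\Pi_d=\{x\in\mathbb{R}^n: -d/2<x_n<d/2\}$ and $c=d^2/8$. Let $f:\mathbb{R}\to\mathbb{R}$ be differentiable, nonnegative, nondecreasing, with $f'$ bounded on compact subsets of $\mathbb{R}$. Let $\lambda,h\in L^\infty(\Pi_d)$ with $\lambda\ge0$, $h\ge0$, $\Lambda=\|\lambda\|_\infty$. Let $0<\theta<1$ and $$L=\max_{|x|\le c\|h\|_\infty}f(x),\qquad M=\sup_{|x|\le c\|h\|_\infty+\frac1\theta\Lambda cL}f'(x).$$ If $c\Lambda M\le1-\theta$, then the problem $-\Delta u=\lambda(x)f(u)+h(x)$ in $\Pi_d$, $u=0$ on $\partial\Pi_d$, has a weak solution $u\in L^\infty(\Pi_d)$ in the sense of the definition below, and $\|u\|_\infty\le c\|h\|_\infty+\frac1\theta c\Lambda L$.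
   Context: Weak solution on an unbounded domain $\Omega$: $u$ is a weak solution of $-\Delta u=\lambda f(u)+h$ in $\Omega$, $u=0$ on $\partial\Omega$, if there exist bounded open sets $\Omega_1\subset\Omega_2\subset\cdots\subset\Omega$ with $\Omega=\bigcup_j\Omega_j$ and functions $u_j\in W^{1,2}_0(\Omega_j)$ such that $u_j\to u$ in $W^{1,2}(U)$ for every open $U$ with $\overline U\subseteq\Omega$ (bounded), and $\int_\Omega\nabla u\cdot\nabla\varphi\,dV=\int_\Omega(\lambda f(u)+h)\varphi\,dV$ for all $\varphi\in C_c^\infty(\Omega)$. *)

theory Defs
  imports "HOL-Analysis.Analysis"
begin

definition pderiv_at :: "'n::finite \<Rightarrow> (real^'n \<Rightarrow> real) \<Rightarrow> real^'n \<Rightarrow> real" where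
  "pderiv_at i g x = deriv (\<lambda>t. g (x + t *\<^sub>R axis i 1)) 0"

fun iter_pderiv :: "'n::finite list \<Rightarrow> (real^'n \<Rightarrow> real) \<Rightarrow> real^'n \<Rightarrow> real" where
  "iter_pderiv [] g = g"
| "iter_pderiv (i # is) g = pderiv_at i (iter_pderiv is g)"

definition smooth_fun :: "(real^'n::finite \<Rightarrow> real) \<Rightarrow> bool" where
  "smooth_fun g \<longleftrightarrow>
     (\<forall>is. continuous_on UNIV (iter_pderiv is g) \<and>
        (\<forall>i x. (\<lambda>t. iter_pderiv is g (x + t *\<^sub>R axis i 1)) differentiable (at 0)))"

definition tsupport :: "(real^'n::finite \<Rightarrow> real) \<Rightarrow> (real^'n) set" where
  "tsupport g = closure {x. g x \<noteq> 0}"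

definition test_fun :: "(real^'n::finite) set \<Rightarrow> (real^'n \<Rightarrow> real) \<Rightarrow> bool" where
  "test_fun U \<phi> \<longleftrightarrow> smooth_fun \<phi> \<and> compact (tsupport \<phi>) \<and> tsupport \<phi> \<subseteq> U"

definition grad :: "(real^'n::finite \<Rightarrow> real) \<Rightarrow> real^'n \<Rightarrow> real^'n" where
  "grad \<phi> x = (\<chi> i. pderiv_at i \<phi> x)"

definition memL2 :: "(real^'n::finite) set \<Rightarrow> (real^'n \<Rightarrow> real) \<Rightarrow> bool" where
  "memL2 U g \<longleftrightarrow> g \<in> borel_measurable (lebesgue_on U) \<and> integrable (lebesgue_on U) (\<lambda>x. (g x)\<^sup>2)"

definition memLinf :: "(real^'n::finite) set \<Rightarrow> (real^'n \<Rightarrow> real) \<Rightarrow> bool" where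
  "memLinf S g \<longleftrightarrow> g \<in> borel_measurable (lebesgue_on S) \<and>
     (\<exists>C. AE x in lebesgue_on S. \<bar>g x\<bar> \<le> C)"

definition linf_norm :: "(real^'n::finite) set \<Rightarrow> (real^'n \<Rightarrow> real) \<Rightarrow> real" where
  "linf_norm S g = Inf {C. 0 \<le> C \<and> (AE x in lebesgue_on S. \<bar>g x\<bar> \<le> C)}"

definition sobolev12 :: "(real^'n::finite) set \<Rightarrow> (real^'n \<Rightarrow> real) \<Rightarrow> (real^'n \<Rightarrow> real^'n) \<Rightarrow> bool" where
  "sobolev12 U u G \<longleftrightarrow> memL2 U u \<and> (\<forall>i. memL2 U (\<lambda>x. G x $ i)) \<and>
     (\<forall>\<phi> i. test_fun U \<phi> \<longrightarrow>
        integral\<^sup>L (lebesgue_on U) (\<lambda>x. u x * pderiv_at i \<phi> x)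
          = - integral\<^sup>L (lebesgue_on U) (\<lambda>x. G x $ i * \<phi> x))"

definition w12_dist2 :: "(real^'n::finite) set \<Rightarrow> (real^'n \<Rightarrow> real) \<Rightarrow> (real^'n \<Rightarrow> real^'n)
    \<Rightarrow> (real^'n \<Rightarrow> real) \<Rightarrow> (real^'n \<Rightarrow> real^'n) \<Rightarrow> real" where
  "w12_dist2 U u G v H =
     integral\<^sup>L (lebesgue_on U) (\<lambda>x. (u x - v x)\<^sup>2)
     + (\<Sum>i\<in>UNIV. integral\<^sup>L (lebesgue_on U) (\<lambda>x. (G x $ i - H x $ i)\<^sup>2))"

definition sobolev12_0 :: "(real^'n::finite) set \<Rightarrow> (real^'n \<Rightarrow> real) \<Rightarrow> (real^'n \<Rightarrow> real^'n) \<Rightarrow> bool" where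
  "sobolev12_0 \<Omega> u G \<longleftrightarrow> sobolev12 \<Omega> u G \<and>
     (\<exists>\<phi>s. (\<forall>k. test_fun \<Omega> (\<phi>s k)) \<and>
        (\<lambda>k. w12_dist2 \<Omega> (\<phi>s k) (grad (\<phi>s k)) u G) \<longlonglongrightarrow> 0)"

definition weak_solution ::
  "(real^'n::finite) set \<Rightarrow> (real^'n \<Rightarrow> real) \<Rightarrow> (real \<Rightarrow> real) \<Rightarrow> (real^'n \<Rightarrow> real)
     \<Rightarrow> (real^'n \<Rightarrow> real) \<Rightarrow> bool" where
  "weak_solution \<Omega> lam f h u \<longleftrightarrow>
    (\<exists>\<Omega>s us Gs G.
       (\<forall>j. open (\<Omega>s j) \<and> bounded (\<Omega>s j) \<and> \<Omega>s j \<subseteq> \<Omega>s (Suc j) \<and> \<Omega>s j \<subseteq> \<Omega>) \<and>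
       (\<Union>j. \<Omega>s j) = \<Omega> \<and>
       (\<forall>j. sobolev12_0 (\<Omega>s j) (us j) (Gs j)) \<and>
       (\<forall>U. open U \<and> bounded U \<and> closure U \<subseteq> \<Omega> \<longrightarrow>
            sobolev12 U u G \<and>
            (\<forall>\<^sub>F j in sequentially. sobolev12 U (us j) (Gs j)) \<and>
            (\<lambda>j. w12_dist2 U (us j) (Gs j) u G) \<longlonglongrightarrow> 0) \<and>
       (\<forall>\<phi>. test_fun \<Omega> \<phi> \<longrightarrow>
            integral\<^sup>L (lebesgue_on \<Omega>) (\<lambda>x. G x \<bullet> grad \<phi> x)
              = integral\<^sup>L (lebesgue_on \<Omega>) (\<lambda>x. (lam x * f (u x) + h x) * \<phi> x)))"

text \<open>The strip \<Pi>_d = {x. -d/2 < x_k < d/2} (k the distinguished last coordinate).\<close>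
definition strip :: "'n::finite \<Rightarrow> real \<Rightarrow> (real^'n) set" where
  "strip k d = {x. - d / 2 < x $ k \<and> x $ k < d / 2}"

end

theory Submission
  imports Defs
begin

text \<open>
  The definition of a weak solution controls the approximants only on sets \<open>U\<close> with
  \<open>closure U \<subseteq> strip k d\<close>, so any solution in the strip that is bounded by the
  required constant will do: mollified truncations of it are admissible approximants.

  Extend the right-hand side to the whole space \<open>d\<close>-antiperiodically in direction \<open>k\<close>.
  If \<open>u\<close> is bounded and antiperiodic with \<open>-\<Delta>u = g\<close> and \<open>\<bar>g\<bar> \<le> \<gamma>\<close>, then
  \<open>\<bar>u\<bar> \<le> d\<^sup>2/8 * \<gamma>\<close>: the sum of \<open>u\<close> and its reflection in the hyperplane \<open>x\<^sub>k = a\<close> vanishes for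
  \<open>\<bar>x\<^sub>k - a\<bar> = d/2\<close>, and the maximum principle compares it with \<open>\<gamma> * (d\<^sup>2/4 - (x\<^sub>k - a)\<^sup>2)\<close>.

  To solve \<open>-\<Delta>u = g\<close>, let \<open>\<rho>\<close> be a radial probability density and \<open>\<nabla>\<kappa>(z) = - \<rho>(z) z\<close>. For every bounded \<open>g'\<close>
  the function \<open>u(x) = \<integral>\<^sub>0\<^sup>R r \<integral> \<kappa>(z) g'(x - rz) dz dr\<close> satisfies \<open>-\<Delta>u = g' - A g'\<close>, where
  \<open>(A g')(x) = \<integral> \<rho>(z) g'(x - Rz) dz\<close>. For large \<open>R\<close> the operator \<open>A\<close> is a contraction on
  antiperiodic functions, so \<open>g' - A g' = g\<close> has a solution. By the bound, \<open>g \<mapsto> u\<close>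
  is well defined with norm at most \<open>d\<^sup>2/8\<close> on bounded functions, and the smallness assumption makes
  \<open>u \<mapsto> (-\<Delta>)\<^sup>-\<^sup>1(lam * f(u) + h)\<close> a contraction on a ball.
\<close>

section \<open>Convolution with compactly supported functions\<close>

text \<open>The formula for -\<Delta>u comes from differentiating in the scale. For smooth
  \<open>g'\<close>, the r-derivative of \<integral> \<rho>(z) g'(x - rz) dz is \<integral>
  \<nabla>\<kappa>(z) . (\<nabla>g')(x - rz) dz, because \<nabla>\<kappa>(z) = - \<rho>(z) z.
  Integration by parts in z turns it into r \<Delta> \<integral> \<kappa>(z) g'(x - rz) dz, and
  integrating over r from 0 to R gives A g' - g' = \<Delta>u. Cutting the scales off at R avoids the
  Newtonian potential, whose form depends on the dimension and which diverges for general bounded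
  data; the price is the error A g'. The data are only bounded and measurable, so in the proofs
  every derivative falls on a kernel or a test function. Antiperiodicity is used twice: in the
  maximum principle it stands in for zero boundary values, and in the linear problem it excludes the
  constants, which averaging against a probability density reproduces and which would prevent A from
  being a contraction.\<close>

lemma integral_lborel_translate:
  fixes f :: "'a::euclidean_space \<Rightarrow> real"
  assumes [measurable]: "f \<in> borel_measurable borel"
  shows "(LINT x|lborel. f (x + c)) = (LINT x|lborel. f x)"
proof -
  have "(LINT x|lborel. f x) = (LINT x|distr lborel borel ((+) c). f x)"
    by (simp only: lborel_distr_plus)
  also have "\<dots> = (LINT x|lborel. f (c + x))"
    by (rule integral_distr) auto
  finally show ?thesis by (simp add: add.commute)
qed

lemma integrable_lborel_translate:
  fixes f :: "'a::euclidean_space \<Rightarrow> real"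
  assumes "integrable lborel f"
  shows "integrable lborel (\<lambda>x. f (x + c))"
proof -
  have "integrable (distr lborel borel ((+) c)) f"
    using assms by (simp only: lborel_distr_plus)
  then have "integrable lborel (\<lambda>x. f (c + x))"
    using assms by (subst (asm) integrable_distr_eq) auto
  then show ?thesis by (simp add: add.commute)
qed

lemma integral_lborel_reflect:
  fixes f :: "'a::euclidean_space \<Rightarrow> real"
  assumes [measurable]: "f \<in> borel_measurable borel"
  shows "(LINT x|lborel. f (c - x)) = (LINT x|lborel. f x)"
proof -
  have *: "lborel = distr lborel borel (\<lambda>x::'a. c - x)"
    using lborel_affine[of "-1" c] by (simp add: density_1)
  have "(LINT x|lborel. f x) = (LINT x|distr lborel borel (\<lambda>x. c - x). f x)"
    by (subst * ) (rule refl)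
  also have "\<dots> = (LINT x|lborel. f (c - x))"
    by (rule integral_distr) auto
  finally show ?thesis by simp
qed

definition bsupp :: "(real^'n::finite \<Rightarrow> real) \<Rightarrow> bool" where
  "bsupp \<phi> \<longleftrightarrow> (\<exists>R. \<forall>x. norm x > R \<longrightarrow> \<phi> x = 0)"

text \<open>The class C^1, with the partial derivatives as explicit data. The radial kernels used
  later are powers of the positive part of 1 - |z|^2, hence differentiable only finitely
  often.\<close>

definition has_partials :: "(real^'n::finite \<Rightarrow> real) \<Rightarrow> ('n \<Rightarrow> real^'n \<Rightarrow> real) \<Rightarrow> bool" where
  "has_partials \<phi> D \<longleftrightarrow> continuous_on UNIV \<phi> \<and> (\<forall>i. continuous_on UNIV (D i)) \<and>
     (\<forall>i x. ((\<lambda>t. \<phi> (x + t *\<^sub>R axis i 1)) has_real_derivative D i x) (at 0))"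

lemma bsuppE:
  assumes "bsupp \<phi>"
  obtains R where "R > 0" "\<And>x. norm x > R \<Longrightarrow> \<phi> x = 0"
proof -
  obtain R where R: "\<And>x. norm x > R \<Longrightarrow> \<phi> x = 0"
    using assms unfolding bsupp_def by auto
  show ?thesis
    by (rule that[of "\<bar>R\<bar> + 1"]) (auto intro: R)
qed

lemma has_partials_continuous:
  assumes "has_partials \<phi> D"
  shows "continuous_on A \<phi>" "continuous_on A (D i)"
  using assms unfolding has_partials_def by (auto intro: continuous_on_subset)

lemma has_partials_measurable:
  assumes "has_partials \<phi> D"
  shows "\<phi> \<in> borel_measurable borel" "D i \<in> borel_measurable borel"
  using assms unfolding has_partials_def by (auto intro: borel_measurable_continuous_onI)

lemma has_partials_at:
  assumes "has_partials \<phi> D"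
  shows "((\<lambda>t. \<phi> (x + t *\<^sub>R axis i 1)) has_real_derivative D i (x + t *\<^sub>R axis i 1)) (at t)"
proof -
  have "((\<lambda>s. \<phi> ((x + t *\<^sub>R axis i 1) + s *\<^sub>R axis i 1)) has_real_derivative D i (x + t *\<^sub>R axis i 1)) (at 0)"
    using assms unfolding has_partials_def by blast
  then have "((\<lambda>s. \<phi> (x + (s + t) *\<^sub>R axis i 1)) has_real_derivative D i (x + t *\<^sub>R axis i 1)) (at 0)"
    by (simp add: algebra_simps)
  then show ?thesis
    using DERIV_shift[of "\<lambda>t. \<phi> (x + t *\<^sub>R axis i 1)" _ 0 t] by simp
qed

lemma bsupp_partial:
  assumes "has_partials \<phi> D" "bsupp \<phi>"
  shows "bsupp (D i)"
proof -
  obtain R where R: "R > 0" "\<And>x. norm x > R \<Longrightarrow> \<phi> x = 0"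
    using assms(2) by (rule bsuppE) blast
  have "D i x = 0" if x: "norm x > R" for x
  proof -
    have 1: "((\<lambda>t. \<phi> (x + t *\<^sub>R axis i 1)) has_real_derivative D i x) (at 0)"
      using assms(1) unfolding has_partials_def by blast
    have "((\<lambda>t. \<phi> (x + t *\<^sub>R axis i 1)) has_real_derivative 0) (at 0)"
    proof (rule has_field_derivative_transform_within_open)
      show "((\<lambda>t. 0) has_real_derivative 0) (at 0)" by simp
      show "open {t. norm (x + t *\<^sub>R axis i 1) > R}"
        by (intro open_Collect_less continuous_intros)
    qed (use x R in auto)
    with 1 show ?thesis by (rule DERIV_unique)
  qed
  then show ?thesis unfolding bsupp_def by blast
qed

lemma continuous_bsupp_bounded:
  assumes "continuous_on UNIV \<phi>" "bsupp \<phi>"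
  obtains B where "B > 0" "\<And>x. \<bar>\<phi> x\<bar> \<le> B"
proof -
  obtain R where R: "R > 0" "\<And>x. norm x > R \<Longrightarrow> \<phi> x = 0"
    using assms(2) by (rule bsuppE) blast
  have "compact (\<phi> ` cball 0 R)"
    by (intro compact_continuous_image continuous_on_subset[OF assms(1)]) auto
  then obtain B where B: "\<And>x. x \<in> cball 0 R \<Longrightarrow> \<bar>\<phi> x\<bar> \<le> B"
    using compact_imp_bounded[of "\<phi> ` cball 0 R"] unfolding bounded_iff by (metis imageI real_norm_def)
  show ?thesis
  proof (rule that[of "\<bar>B\<bar> + 1"])
    fix x show "\<bar>\<phi> x\<bar> \<le> \<bar>B\<bar> + 1"
      using B[of x] R(2)[of x] by (cases "norm x \<le> R") auto
  qed simp
qed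

lemma integrable_indicator_cball [simp]:
  "integrable lborel (indicator (cball (c::'a::euclidean_space) r) :: 'a \<Rightarrow> real)"
  by (rule integrable_real_indicator) (use emeasure_lborel_cball_finite[of c r] in auto)

lemma integrable_bsupp:
  fixes \<phi> :: "real^'n::finite \<Rightarrow> real"
  assumes "continuous_on UNIV \<phi>" "bsupp \<phi>"
  shows "integrable lborel \<phi>"
proof -
  obtain R where R: "R > 0" "\<And>x. norm x > R \<Longrightarrow> \<phi> x = 0"
    using assms(2) by (rule bsuppE) blast
  obtain B where B: "B > 0" "\<And>x. \<bar>\<phi> x\<bar> \<le> B"
    using assms by (rule continuous_bsupp_bounded) blast
  show ?thesis
  proof (rule Bochner_Integration.integrable_bound)
    show "integrable lborel (\<lambda>x. B * indicator (cball (0::real^'n) R) x)"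
      by simp
    show "AE x in lborel. norm (\<phi> x) \<le> norm (B * indicator (cball 0 R) x)"
      using B R by (auto simp: indicator_def)
    show "\<phi> \<in> borel_measurable lborel"
      using borel_measurable_continuous_onI[OF assms(1)] by simp
  qed
qed

lemma integrable_mult_bounded:
  fixes f g :: "'a \<Rightarrow> real"
  assumes "integrable M f" "g \<in> borel_measurable M" "\<And>x. \<bar>g x\<bar> \<le> B"
  shows "integrable M (\<lambda>x. f x * g x)" "integrable M (\<lambda>x. g x * f x)"
    and "\<bar>LINT x|M. f x * g x\<bar> \<le> B * (LINT x|M. \<bar>f x\<bar>)"
proof -
  have B: "B \<ge> 0" using assms(3)[of undefined] by (metis abs_ge_zero order.trans)
  have le: "\<bar>f x * g x\<bar> \<le> B * \<bar>f x\<bar>" for x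
    using mult_mono[OF assms(3)[of x] order.refl, of "\<bar>f x\<bar>"] B by (simp add: abs_mult mult.commute)
  show I: "integrable M (\<lambda>x. f x * g x)"
  proof (rule Bochner_Integration.integrable_bound)
    show "integrable M (\<lambda>x. B * \<bar>f x\<bar>)" using assms(1) by auto
    show "AE x in M. norm (f x * g x) \<le> norm (B * \<bar>f x\<bar>)"
      using le B by (auto simp: abs_mult)
  qed (use assms in auto)
  then show "integrable M (\<lambda>x. g x * f x)" by (simp add: mult.commute)
  have "\<bar>LINT x|M. f x * g x\<bar> \<le> (LINT x|M. \<bar>f x * g x\<bar>)"
    by (rule integral_abs_bound)
  also have "\<dots> \<le> (LINT x|M. B * \<bar>f x\<bar>)"
    by (intro integral_mono) (use I assms le in auto)
  finally show "\<bar>LINT x|M. f x * g x\<bar> \<le> B * (LINT x|M. \<bar>f x\<bar>)" by simp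
qed

definition conv :: "(real^'n::finite \<Rightarrow> real) \<Rightarrow> (real^'n \<Rightarrow> real) \<Rightarrow> real^'n \<Rightarrow> real" where
  "conv \<psi> w x = (LINT y|lborel. \<psi> (x - y) * w y)"

lemma bsupp_reflect:
  assumes "bsupp \<phi>"
  shows "bsupp (\<lambda>y. \<phi> (x - y))"
proof -
  obtain R where R: "R > 0" "\<And>x. norm x > R \<Longrightarrow> \<phi> x = 0"
    using assms by (rule bsuppE) blast
  have "\<phi> (x - y) = 0" if "norm y > R + norm x" for y
    using R(2)[of "x - y"] norm_triangle_ineq2[of y x] that by (simp add: norm_minus_commute)
  then show ?thesis unfolding bsupp_def by blast
qed

lemma integrable_reflect_bsupp:
  fixes \<psi> :: "real^'n::finite \<Rightarrow> real"
  assumes "continuous_on UNIV \<psi>" "bsupp \<psi>"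
  shows "integrable lborel (\<lambda>y. \<psi> (x - y))"
proof (rule integrable_bsupp)
  show "continuous_on UNIV (\<lambda>y. \<psi> (x - y))"
    by (rule continuous_on_compose2[OF assms(1)]) (auto intro!: continuous_intros)
  show "bsupp (\<lambda>y. \<psi> (x - y))" by (rule bsupp_reflect[OF assms(2)])
qed

lemma integrable_conv:
  assumes "continuous_on UNIV \<psi>" "bsupp \<psi>" "w \<in> borel_measurable borel" "\<And>x. \<bar>w x\<bar> \<le> B"
  shows "integrable lborel (\<lambda>y. \<psi> (x - y) * w y)"
  using integrable_mult_bounded(1)[OF integrable_reflect_bsupp[OF assms(1,2)], of w B] assms by simp

text \<open>Since \<open>w\<close> is merely bounded and measurable, all differentiability comes
  from \<open>\<psi>\<close>. Uniform continuity of \<open>D i\<close> on a ball bounds the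
  first-order remainder of \<open>\<psi>\<close> by \<epsilon>|t|, and for small t the remainder
  vanishes off one ball independent of t; integrated against \<open>w\<close> it is o(t).\<close>

lemma conv_has_partial:
  fixes \<psi> :: "real^'n::finite \<Rightarrow> real"
  assumes p: "has_partials \<psi> D" "bsupp \<psi>" and w: "w \<in> borel_measurable borel" "\<And>x. \<bar>w x\<bar> \<le> B"
  shows "((\<lambda>t. conv \<psi> w (x + t *\<^sub>R axis i 1)) has_real_derivative conv (D i) w x) (at 0)"
proof -
  define e where "e = (axis i 1 :: real^'n)"
  have [simp]: "norm e = 1" by (simp add: e_def norm_axis_1)
  have B: "B \<ge> 0" using w(2)[of undefined] by linarith
  obtain R where R: "R > 0" "\<And>x. norm x > R \<Longrightarrow> \<psi> x = 0"
    using p(2) by (rule bsuppE) blast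
  obtain R' where R': "R' > 0" "\<And>x. norm x > R' \<Longrightarrow> D i x = 0"
    using bsupp_partial[OF p, of i] by (rule bsuppE) blast
  define S where "S = max R R'"
  have S: "\<psi> z = 0" "D i z = 0" if "norm z > S" for z
    using R R' that by (auto simp: S_def)
  define V where "V = measure lborel (cball (0::real^'n) (S+1))"
  have V: "V \<ge> 0" by (simp add: V_def)
  have key: "\<exists>\<delta>>0. \<forall>t z. t \<noteq> 0 \<and> \<bar>t\<bar> < \<delta> \<longrightarrow>
      \<bar>\<psi> (z + t *\<^sub>R e) - \<psi> z - t * D i z\<bar> \<le> \<epsilon> * \<bar>t\<bar> * indicator (cball 0 (S+1)) z" if "\<epsilon> > 0" for \<epsilon>
  proof -
    \<comment> \<open>The remainder lives in radius \<open>S + 1\<close>, and increments of length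
      below 1 starting there stay within \<open>S + 2\<close>.\<close>
    have "uniformly_continuous_on (cball 0 (S+2)) (D i)"
      using has_partials_continuous[OF p(1)] by (intro compact_uniformly_continuous) auto
    then obtain \<delta> where \<delta>: "\<delta> > 0" "\<And>a b. a \<in> cball 0 (S+2) \<Longrightarrow> b \<in> cball 0 (S+2) \<Longrightarrow> dist a b < \<delta> \<Longrightarrow> dist (D i a) (D i b) < \<epsilon>"
      unfolding uniformly_continuous_on_def using \<open>\<epsilon> > 0\<close> by (metis dist_commute)
    have "\<bar>\<psi> (z + t *\<^sub>R e) - \<psi> z - t * D i z\<bar> \<le> \<epsilon> * \<bar>t\<bar> * indicator (cball 0 (S+1)) z"
      if t: "t \<noteq> 0" "\<bar>t\<bar> < min \<delta> 1" for t z
    proof (cases "norm z \<le> S + 1")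
      case False
      have "norm (z + t *\<^sub>R e) \<ge> norm z - \<bar>t\<bar>"
        using norm_triangle_ineq2[of z "- (t *\<^sub>R e)"] by simp
      then have "norm (z + t *\<^sub>R e) > S" using False t by linarith
      then show ?thesis using False S by (simp add: S)
    next
      case True
      have "norm ((\<psi> (z + t *\<^sub>R e) - t * D i z) - (\<psi> (z + 0 *\<^sub>R e) - 0 * D i z)) \<le> \<epsilon> * norm (t - 0)"
      proof (rule field_differentiable_bound[where S="{-\<bar>t\<bar>..\<bar>t\<bar>}" and f="\<lambda>s. \<psi> (z + s *\<^sub>R e) - s * D i z" and f'="\<lambda>s. D i (z + s *\<^sub>R e) - D i z"])
        fix s assume s: "s \<in> {-\<bar>t\<bar>..\<bar>t\<bar>}"
        show "((\<lambda>s. \<psi> (z + s *\<^sub>R e) - s * D i z) has_real_derivative D i (z + s *\<^sub>R e) - D i z) (at s within {- \<bar>t\<bar>..\<bar>t\<bar>})"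
          unfolding e_def
          by (rule has_field_derivative_at_within) (auto intro!: derivative_eq_intros has_partials_at[OF p(1)])
        have "norm (z + s *\<^sub>R e) \<le> norm z + \<bar>s\<bar>"
          using norm_triangle_ineq[of z "s *\<^sub>R e"] by simp
        then have "norm (z + s *\<^sub>R e) \<le> S + 2" using s t True by auto
        then have "dist (D i (z + s *\<^sub>R e)) (D i z) < \<epsilon>"
          by (intro \<delta>) (use s t True in \<open>auto simp: dist_norm mem_cball_0 simp del: mem_cball\<close>)
        then show "norm (D i (z + s *\<^sub>R e) - D i z) \<le> \<epsilon>" by (simp add: dist_norm)
      qed auto
      then show ?thesis using True by (simp add: algebra_simps)
    qed
    then show ?thesis using \<delta>(1) by (intro exI[of _ "min \<delta> 1"]) auto
  qed
  show ?thesis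
    unfolding DERIV_def
  proof (rule LIM_I)
    fix \<epsilon> :: real assume "\<epsilon> > 0"
    \<comment> \<open>The summand 1 keeps the denominator positive and the final estimate strict
      even if \<open>B * V\<close> is 0.\<close>
    define \<epsilon>' where "\<epsilon>' = \<epsilon> / (2 * (B * V + 1))"
    have \<epsilon>': "\<epsilon>' > 0" "\<epsilon>' * (B * V) < \<epsilon>"
    proof -
      have BV: "B * V \<ge> 0" using B V by simp
      then show "\<epsilon>' > 0" using \<open>\<epsilon> > 0\<close> by (simp add: \<epsilon>'_def)
      have "\<epsilon> * (B * V) < \<epsilon> * (2 * (B * V + 1))" using BV \<open>\<epsilon> > 0\<close> by (intro mult_strict_left_mono) auto
      then show "\<epsilon>' * (B * V) < \<epsilon>" using BV by (simp add: \<epsilon>'_def field_simps)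
    qed
    obtain \<delta> where \<delta>: "\<delta> > 0" and est: "\<And>t z. t \<noteq> 0 \<Longrightarrow> \<bar>t\<bar> < \<delta> \<Longrightarrow>
      \<bar>\<psi> (z + t *\<^sub>R e) - \<psi> z - t * D i z\<bar> \<le> \<epsilon>' * \<bar>t\<bar> * indicator (cball 0 (S+1)) z"
      using key[OF \<epsilon>'(1)] by blast
    have "norm ((conv \<psi> w (x + (0 + t) *\<^sub>R axis i 1) - conv \<psi> w (x + 0 *\<^sub>R axis i 1)) / t - conv (D i) w x) < \<epsilon>"
      if t: "t \<noteq> 0" "norm (t - 0) < \<delta>" for t
    proof -
      define F where "F y = \<psi> (x + t *\<^sub>R e - y) - \<psi> (x - y) - t * D i (x - y)" for y
      have I1: "integrable lborel (\<lambda>y. \<psi> (x + t *\<^sub>R e - y))" "integrable lborel (\<lambda>y. \<psi> (x - y))"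
        "integrable lborel (\<lambda>y. D i (x - y))"
        using p(2) has_partials_continuous[OF p(1)] bsupp_partial[OF p, of i] by (auto intro!: integrable_reflect_bsupp)
      have IF: "integrable lborel F"
        unfolding F_def using I1 by auto
      have I2: "integrable lborel (\<lambda>y. \<psi> (x + t *\<^sub>R e - y) * w y)" "integrable lborel (\<lambda>y. \<psi> (x - y) * w y)"
        "integrable lborel (\<lambda>y. D i (x - y) * w y)"
        using p(2) has_partials_continuous[OF p(1)] bsupp_partial[OF p, of i] w by (auto intro!: integrable_conv)
      have eq: "conv \<psi> w (x + t *\<^sub>R e) - conv \<psi> w x - t * conv (D i) w x = (LINT y|lborel. F y * w y)"
        using I2 by (simp add: conv_def F_def left_diff_distrib mult.assoc)
      have "(LINT y|lborel. \<bar>F y\<bar>) \<le> (LINT y|lborel. \<epsilon>' * \<bar>t\<bar> * indicator (cball 0 (S+1)) (x - y))"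
      proof (rule integral_mono)
        have "integrable lborel (\<lambda>y. \<epsilon>' * \<bar>t\<bar> * indicator (cball x (S+1)) y :: real)"
          by simp
        then show "integrable lborel (\<lambda>y. \<epsilon>' * \<bar>t\<bar> * indicator (cball 0 (S+1)) (x - y) :: real)"
          by (simp add: indicator_def dist_norm norm_minus_commute)
        show "\<bar>F y\<bar> \<le> \<epsilon>' * \<bar>t\<bar> * indicator (cball 0 (S + 1)) (x - y)" for y
          using est[of t "x - y"] t by (simp add: F_def indicator_def dist_norm algebra_simps)
      qed (use IF in auto)
      also have "\<dots> = \<epsilon>' * \<bar>t\<bar> * (LINT y|lborel. indicator (cball 0 (S+1)) (x - y))" by simp
      also have "(LINT y|lborel. indicator (cball 0 (S+1)) (x - y) :: real) = V"
        unfolding V_def by (subst integral_lborel_reflect) (auto intro!: borel_measurable_indicator)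
      finally have FV: "(LINT y|lborel. \<bar>F y\<bar>) \<le> \<epsilon>' * \<bar>t\<bar> * V" .
      have "\<bar>LINT y|lborel. F y * w y\<bar> \<le> B * (LINT y|lborel. \<bar>F y\<bar>)"
        using w by (intro integrable_mult_bounded(3)[OF IF]) auto
      also have "\<dots> \<le> B * (\<epsilon>' * \<bar>t\<bar> * V)" using FV B by (rule mult_left_mono)
      also have "\<dots> = \<bar>t\<bar> * (\<epsilon>' * (B * V))" by (simp add: algebra_simps)
      finally have "\<bar>LINT y|lborel. F y * w y\<bar> \<le> \<bar>t\<bar> * (\<epsilon>' * (B * V))" .
            also have "\<dots> < \<bar>t\<bar> * \<epsilon>" using \<epsilon>' t by simp
      finally have "\<bar>conv \<psi> w (x + t *\<^sub>R e) - conv \<psi> w x - t * conv (D i) w x\<bar> / \<bar>t\<bar> < \<epsilon>"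
        using t eq by (simp add: field_simps)
      moreover have "(conv \<psi> w (x + t *\<^sub>R e) - conv \<psi> w x) / t - conv (D i) w x
        = (conv \<psi> w (x + t *\<^sub>R e) - conv \<psi> w x - t * conv (D i) w x) / t"
        using t by (simp add: field_simps)
      ultimately show ?thesis by (simp add: e_def)
    qed
    then show "\<exists>s>0. \<forall>t. t \<noteq> 0 \<and> norm (t - 0) < s \<longrightarrow>
      norm ((conv \<psi> w (x + (0 + t) *\<^sub>R axis i 1) - conv \<psi> w (x + 0 *\<^sub>R axis i 1)) / t - conv (D i) w x) < \<epsilon>"
      using \<delta> by blast
  qed
qed

text \<open>Convolution with the constant 1 gives a constant function, the integral of
  \<open>\<psi>\<close>. Its partial derivative is 0 and, by \<open>conv_has_partial\<close>, also
  the integral of \<open>D i\<close>.\<close>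

lemma integral_partial_eq_0:
  fixes \<psi> :: "real^'n::finite \<Rightarrow> real"
  assumes "has_partials \<psi> D" "bsupp \<psi>"
  shows "(LINT x|lborel. D i x) = 0"
proof -
  have c: "conv \<phi> (\<lambda>_. 1) x = (LINT y|lborel. \<phi> y)" if "\<phi> \<in> borel_measurable borel" for \<phi> :: "real^'n \<Rightarrow> real" and x
    using integral_lborel_reflect[OF that, of x] by (simp add: conv_def)
  have "((\<lambda>t. conv \<psi> (\<lambda>_. 1) (0 + t *\<^sub>R axis i 1)) has_real_derivative conv (D i) (\<lambda>_. 1) 0) (at 0)"
    by (rule conv_has_partial[OF assms, where B=1]) auto
  then have "((\<lambda>t. (LINT y|lborel. \<psi> y)) has_real_derivative (LINT y|lborel. D i y)) (at 0)"
    using has_partials_measurable[OF assms(1)] by (simp add: c)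
  from DERIV_unique[OF this DERIV_const] show ?thesis .
qed

section \<open>Integration by parts, and total differentiability from continuous partials\<close>

lemma has_partials_mult:
  assumes "has_partials \<phi> D" "has_partials \<psi> E"
  shows "has_partials (\<lambda>x. \<phi> x * \<psi> x) (\<lambda>i x. D i x * \<psi> x + \<phi> x * E i x)"
proof -
  have "((\<lambda>t. \<phi> (x + t *\<^sub>R axis i 1) * \<psi> (x + t *\<^sub>R axis i 1)) has_real_derivative D i x * \<psi> x + \<phi> x * E i x) (at 0)" for i x
  proof -
    have "((\<lambda>t. \<phi> (x + t *\<^sub>R axis i 1)) has_real_derivative D i x) (at 0)"
      "((\<lambda>t. \<psi> (x + t *\<^sub>R axis i 1)) has_real_derivative E i x) (at 0)"
      using assms unfolding has_partials_def by blast+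
    from DERIV_mult[OF this] show ?thesis by (simp add: algebra_simps)
  qed
  then show ?thesis
    using assms unfolding has_partials_def by (auto intro!: continuous_on_mult continuous_on_add)
qed

lemma bsupp_mult: "bsupp \<phi> \<Longrightarrow> bsupp (\<lambda>x. \<phi> x * \<psi> x)" "bsupp \<psi> \<Longrightarrow> bsupp (\<lambda>x. \<phi> x * \<psi> x)"
  unfolding bsupp_def by fastforce+

lemma integration_by_parts:
  fixes \<phi> \<psi> :: "real^'n::finite \<Rightarrow> real"
  assumes p: "has_partials \<phi> D" "has_partials \<psi> E" and s: "bsupp \<phi>"
  shows "(LINT x|lborel. \<phi> x * E i x) = - (LINT x|lborel. D i x * \<psi> x)"
proof -
  have s': "bsupp (D i)" by (rule bsupp_partial[OF p(1) s])
  have "(LINT x|lborel. D i x * \<psi> x + \<phi> x * E i x) = 0"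
    using integral_partial_eq_0[OF has_partials_mult[OF p] bsupp_mult(1)[OF s], of i] .
  moreover have "integrable lborel (\<lambda>x. D i x * \<psi> x)" "integrable lborel (\<lambda>x. \<phi> x * E i x)"
    using has_partials_continuous[OF p(1)] has_partials_continuous[OF p(2)] s s'
    by (auto intro!: integrable_bsupp continuous_on_mult bsupp_mult(1))
  ultimately show ?thesis by simp
qed

text \<open>The coordinates of the increment are switched on one at a time: \<open>v I h\<close>
  keeps those in \<open>I\<close>. Each new coordinate costs at most \<epsilon> |h| by the mean
  value inequality and continuity of the partial at \<open>x\<close>, whence the factor
  \<open>card I\<close> in the induction.\<close>

lemma has_partials_imp_has_derivative:
  fixes \<phi> :: "real^'n::finite \<Rightarrow> real"
  assumes p: "has_partials \<phi> D"
  shows "(\<phi> has_derivative (\<lambda>h. \<Sum>i\<in>UNIV. h $ i * D i x)) (at x)"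
proof -
  define v where "v I h = (\<Sum>i\<in>I. (h $ i) *\<^sub>R axis i (1::real))" for I and h :: "real^'n"
  have v_nth: "v I h $ j = (if j \<in> I then h $ j else 0)" for I h j
    by (simp add: v_def axis_def if_distrib[of "\<lambda>x. _ * x"] cong: if_cong)
  have est: "\<exists>\<delta>>0. \<forall>h. norm h < \<delta> \<longrightarrow>
      \<bar>\<phi> (x + v I h) - \<phi> x - (\<Sum>i\<in>I. h $ i * D i x)\<bar> \<le> \<epsilon> * card I * norm h"
    if "\<epsilon> > 0" "finite I" for \<epsilon> :: real and I
    using that(2)
  proof induction
    case empty then show ?case by (intro exI[of _ 1]) (auto simp: v_def)
  next
    case (insert j I)
    obtain \<delta>1 where \<delta>1: "\<delta>1 > 0" "\<And>h. norm h < \<delta>1 \<Longrightarrow>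
      \<bar>\<phi> (x + v I h) - \<phi> x - (\<Sum>i\<in>I. h $ i * D i x)\<bar> \<le> \<epsilon> * card I * norm h"
      using insert.IH by blast
    have "isCont (D j) x" using p by (simp add: continuous_on_eq_continuous_at has_partials_def)
    then obtain \<delta>2 where \<delta>2: "\<delta>2 > 0" "\<And>y. dist y x < \<delta>2 \<Longrightarrow> dist (D j y) (D j x) < \<epsilon>"
      using \<open>\<epsilon> > 0\<close> unfolding continuous_at_eps_delta by blast
    have "\<bar>\<phi> (x + v (insert j I) h) - \<phi> x - (\<Sum>i\<in>insert j I. h $ i * D i x)\<bar> \<le> \<epsilon> * card (insert j I) * norm h"
      if h: "norm h < min \<delta>1 \<delta>2" for h
    proof -
      define z where "z = x + v I h"
      have "norm ((\<phi> (z + (h$j) *\<^sub>R axis j 1) - (h$j) * D j x) - (\<phi> (z + 0 *\<^sub>R axis j 1) - 0 * D j x)) \<le> \<epsilon> * norm (h$j - 0)"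
      proof (rule field_differentiable_bound[where S="{-\<bar>h$j\<bar>..\<bar>h$j\<bar>}" and f="\<lambda>s. \<phi> (z + s *\<^sub>R axis j 1) - s * D j x" and f'="\<lambda>s. D j (z + s *\<^sub>R axis j 1) - D j x"])
        fix s assume s: "s \<in> {-\<bar>h$j\<bar>..\<bar>h$j\<bar>}"
        show "((\<lambda>s. \<phi> (z + s *\<^sub>R axis j 1) - s * D j x) has_real_derivative D j (z + s *\<^sub>R axis j 1) - D j x) (at s within {-\<bar>h$j\<bar>..\<bar>h$j\<bar>})"
          by (rule has_field_derivative_at_within) (auto intro!: derivative_eq_intros has_partials_at[OF p(1)])
        \<comment> \<open>Since \<open>j\<close> lies outside \<open>I\<close>, every coordinate of
          the intermediate point is dominated by that of \<open>h\<close>, so the whole segment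
          stays within \<delta>2 of \<open>x\<close>.\<close>
        have "norm (v I h + s *\<^sub>R axis j 1) \<le> norm h"
          by (rule norm_le_componentwise_cart) (use insert s in \<open>auto simp: v_nth axis_def\<close>)
        then have "dist (D j (z + s *\<^sub>R axis j 1)) (D j x) < \<epsilon>"
          by (intro \<delta>2) (use h in \<open>auto simp: dist_norm z_def add.assoc\<close>)
        then show "norm (D j (z + s *\<^sub>R axis j 1) - D j x) \<le> \<epsilon>" by (simp add: dist_norm)
      qed auto
      then have "\<bar>\<phi> (z + (h$j) *\<^sub>R axis j 1) - \<phi> z - (h$j) * D j x\<bar> \<le> \<epsilon> * \<bar>h$j\<bar>" by (simp add: algebra_simps)
      also have "\<dots> \<le> \<epsilon> * norm h" using \<open>\<epsilon> > 0\<close> component_le_norm_cart[of h j] by simp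
      finally have "\<bar>\<phi> (z + (h$j) *\<^sub>R axis j 1) - \<phi> z - (h$j) * D j x\<bar> \<le> \<epsilon> * norm h" .
      moreover have "x + v (insert j I) h = z + (h$j) *\<^sub>R axis j 1"
        using insert by (simp add: v_def z_def algebra_simps)
      moreover have "\<bar>\<phi> z - \<phi> x - (\<Sum>i\<in>I. h $ i * D i x)\<bar> \<le> \<epsilon> * card I * norm h"
        unfolding z_def using h by (intro \<delta>1) auto
      ultimately show ?thesis using insert by (simp add: algebra_simps)
    qed
    then show ?case using \<delta>1 \<delta>2 by (intro exI[of _ "min \<delta>1 \<delta>2"]) auto
  qed
  have vU: "v UNIV h = h" for h by (simp add: vec_eq_iff v_nth)
  show ?thesis
    unfolding has_derivative_at_alt
  proof (intro conjI allI impI)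
    show "bounded_linear (\<lambda>h. \<Sum>i\<in>UNIV. h $ i * D i x)"
      by (intro bounded_linear_sum bounded_linear_mult_left[THEN bounded_linear_compose] bounded_linear_vec_nth)
    fix e :: real assume "e > 0"
    define n where "n = real CARD('n)"
    have n: "n > 0" by (simp add: n_def)
    obtain \<delta> where \<delta>: "\<delta> > 0" "\<And>h. norm h < \<delta> \<Longrightarrow>
      \<bar>\<phi> (x + v UNIV h) - \<phi> x - (\<Sum>i\<in>UNIV. h $ i * D i x)\<bar> \<le> e / n * card (UNIV::'n set) * norm h"
      using est[of "e / n" UNIV] \<open>e > 0\<close> n by auto
    show "\<exists>d>0. \<forall>y. norm (y - x) < d \<longrightarrow> norm (\<phi> y - \<phi> x - (\<Sum>i\<in>UNIV. (y - x) $ i * D i x)) \<le> e * norm (y - x)"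
    proof (intro exI conjI allI impI)
      fix y assume "norm (y - x) < \<delta>"
      from \<delta>(2)[OF this] show "norm (\<phi> y - \<phi> x - (\<Sum>i\<in>UNIV. (y - x) $ i * D i x)) \<le> e * norm (y - x)"
        using n by (simp add: vU n_def)
    qed (fact \<delta>(1))
  qed
qed

lemma has_partials_chain:
  fixes \<phi> :: "real^'n::finite \<Rightarrow> real"
  assumes p: "has_partials \<phi> D"
  shows "((\<lambda>r. \<phi> (y + r *\<^sub>R z)) has_real_derivative (\<Sum>i\<in>UNIV. z $ i * D i (y + r *\<^sub>R z))) (at r)"
proof -
  have "((\<lambda>r. y + r *\<^sub>R z) has_derivative (\<lambda>t. t *\<^sub>R z)) (at r)"
    by (auto intro!: derivative_eq_intros)
  from has_derivative_compose[OF this has_partials_imp_has_derivative[OF p]]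
  have "((\<lambda>r. \<phi> (y + r *\<^sub>R z)) has_derivative (\<lambda>t. \<Sum>i\<in>UNIV. (t *\<^sub>R z) $ i * D i (y + r *\<^sub>R z))) (at r)" .
  moreover have "(\<lambda>t. \<Sum>i\<in>UNIV. (t *\<^sub>R z) $ i * D i (y + r *\<^sub>R z)) = (*) (\<Sum>i\<in>UNIV. z $ i * D i (y + r *\<^sub>R z))"
    by (simp add: sum_distrib_left mult_ac fun_eq_iff)
  ultimately show ?thesis by (simp add: has_field_derivative_def)
qed

text \<open>The difference is pointwise at most \<open>K * norm w\<close> and vanishes off a ball
  and its translate, which accounts for the factor 2 in the constant. This estimate is the source of
  all continuity below: a shift of the argument of a rough function is moved onto the
  kernel.\<close>

lemma translation_L1_Lipschitz:
  fixes \<psi> :: "real^'n::finite \<Rightarrow> real"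
  assumes p: "has_partials \<psi> D" "bsupp \<psi>"
  obtains C where "C > 0" "\<And>w. (LINT z|lborel. \<bar>\<psi> (z + w) - \<psi> z\<bar>) \<le> C * norm w"
proof -
  obtain R where R: "R > 0" "\<And>x. norm x > R \<Longrightarrow> \<psi> x = 0"
    using p(2) by (rule bsuppE) blast
  have "\<forall>i. \<exists>N>0. \<forall>x. \<bar>D i x\<bar> \<le> N"
  proof
    fix i show "\<exists>N>0. \<forall>x. \<bar>D i x\<bar> \<le> N"
      by (rule continuous_bsupp_bounded[OF has_partials_continuous(2)[OF p(1)] bsupp_partial[OF p]]) blast
  qed
  from choice[OF this] obtain N where N: "\<And>i. N i > 0" "\<And>i x. \<bar>D i x\<bar> \<le> N i" by blast
  define K where "K = (\<Sum>i\<in>UNIV. N i)"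
  have K: "K \<ge> 0" unfolding K_def using N by (intro sum_nonneg) (auto intro: less_imp_le)
  define V where "V = measure lborel (cball (0::real^'n) R)"
  have V: "V \<ge> 0" by (simp add: V_def)
  have lip: "\<bar>\<psi> (z + w) - \<psi> z\<bar> \<le> K * norm w" for z w
  proof -
    have "norm (\<psi> (z + 1 *\<^sub>R w) - \<psi> (z + 0 *\<^sub>R w)) \<le> (K * norm w) * norm (1 - 0 :: real)"
    proof (rule field_differentiable_bound[where S=UNIV and f="\<lambda>r. \<psi> (z + r *\<^sub>R w)"])
      fix r :: real
      show "((\<lambda>r. \<psi> (z + r *\<^sub>R w)) has_real_derivative (\<Sum>i\<in>UNIV. w $ i * D i (z + r *\<^sub>R w))) (at r within UNIV)"
        using has_partials_chain[OF p(1)] by simp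
      have "norm (\<Sum>i\<in>UNIV. w $ i * D i (z + r *\<^sub>R w)) \<le> (\<Sum>i\<in>UNIV. norm w * N i)"
        by (rule sum_norm_le) (auto simp: abs_mult intro!: mult_mono N component_le_norm_cart)
      also have "\<dots> = K * norm w" by (simp add: K_def sum_distrib_right mult.commute[of "norm w"])
      finally show "norm (\<Sum>i\<in>UNIV. w $ i * D i (z + r *\<^sub>R w)) \<le> K * norm w" .
    qed auto
    then show ?thesis by simp
  qed
  have "(LINT z|lborel. \<bar>\<psi> (z + w) - \<psi> z\<bar>) \<le> (2 * K * V + 1) * norm w" for w
  proof -
    have I: "integrable lborel (indicator (cball (0::real^'n) R) :: _ \<Rightarrow> real)" by simp
    have I': "integrable lborel (\<lambda>z. indicator (cball (0::real^'n) R) (z + w) :: real)"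
      by (rule integrable_lborel_translate[OF I])
    have IP: "integrable lborel \<psi>" using has_partials_continuous[OF p(1)] p(2) by (intro integrable_bsupp) auto
    have IP': "integrable lborel (\<lambda>z. \<psi> (z + w))" by (rule integrable_lborel_translate[OF IP])
    have "(LINT z|lborel. \<bar>\<psi> (z + w) - \<psi> z\<bar>) \<le>
      (LINT z|lborel. K * norm w * (indicator (cball (0::real^'n) R) z + indicator (cball (0::real^'n) R) (z + w)))"
    proof (rule integral_mono)
      show "\<bar>\<psi> (z + w) - \<psi> z\<bar> \<le> K * norm w * (indicator (cball 0 R) z + indicator (cball 0 R) (z + w))" for z
      proof (cases "norm z \<le> R \<or> norm (z + w) \<le> R")
        case True
        then have "(1::real) \<le> indicator (cball 0 R) z + indicator (cball 0 R) (z + w)"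
          by (auto simp: indicator_def)
        then have "K * norm w * 1 \<le> K * norm w * (indicator (cball 0 R) z + indicator (cball 0 R) (z + w))"
          using K by (intro mult_left_mono) auto
        then show ?thesis using lip[of z w] by linarith
      next
        case False
        then show ?thesis using R by simp
      qed
    qed (use I I' IP IP' in auto)
    also have "\<dots> = K * norm w * (V + (LINT z|lborel. indicator (cball (0::real^'n) R) (z + w)))"
      using I I' by (simp add: V_def)
    also have "(LINT z|lborel. indicator (cball (0::real^'n) R) (z + w) :: real) = V"
      by (subst integral_lborel_translate) (auto simp: V_def intro!: borel_measurable_indicator)
    also have "K * norm w * (V + V) \<le> (2 * K * V + 1) * norm w"
      by (simp add: algebra_simps)
    finally show ?thesis .
  qed
  moreover have "2 * K * V + 1 > 0" using K V by (simp add: add_nonneg_pos)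
  ultimately show ?thesis using that by blast
qed

text \<open>Translating the integration variable by (y - x)/r transfers the change of base point
  from \<open>g\<close> to \<open>\<psi>\<close>. The factor 1/r matters twice: averages at large
  scale are nearly constant, and the estimate degenerates as r tends to 0.\<close>

lemma dilated_average_Lipschitz:
  fixes \<psi> g :: "real^'n::finite \<Rightarrow> real"
  assumes C: "\<And>w. (LINT z|lborel. \<bar>\<psi> (z + w) - \<psi> z\<bar>) \<le> C * norm w"
    and psi: "continuous_on UNIV \<psi>" "bsupp \<psi>"
    and g: "g \<in> borel_measurable borel" "\<And>x. \<bar>g x\<bar> \<le> B" and r: "r > 0"
  shows "\<bar>(LINT z|lborel. \<psi> z * g (x - r *\<^sub>R z)) - (LINT z|lborel. \<psi> z * g (y - r *\<^sub>R z))\<bar> \<le> B * C * norm (x - y) / r"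
proof -
  define w where "w = (y - x) /\<^sub>R r"
  have B: "B \<ge> 0" using g(2)[of undefined] by linarith
  have I: "integrable lborel \<psi>" by (rule integrable_bsupp[OF psi])
  have I': "integrable lborel (\<lambda>z. \<psi> (z + w))" by (rule integrable_lborel_translate[OF I])
  have [measurable]: "\<psi> \<in> borel_measurable borel" "g \<in> borel_measurable borel"
    using g psi by (auto intro: borel_measurable_continuous_onI)
  have gm: "(\<lambda>z. g (x - r *\<^sub>R z)) \<in> borel_measurable lborel" by measurable
  have "(LINT z|lborel. \<psi> z * g (y - r *\<^sub>R z)) = (LINT z|lborel. \<psi> (z + w) * g (y - r *\<^sub>R (z + w)))"
    by (rule integral_lborel_translate[symmetric]) measurable
  also have "(\<lambda>z. y - r *\<^sub>R (z + w)) = (\<lambda>z. x - r *\<^sub>R z)"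
    using r by (simp add: w_def algebra_simps)
  finally have "(LINT z|lborel. \<psi> z * g (y - r *\<^sub>R z)) = (LINT z|lborel. \<psi> (z + w) * g (x - r *\<^sub>R z))"
    by (simp add: fun_eq_iff)
  then have "\<bar>(LINT z|lborel. \<psi> z * g (x - r *\<^sub>R z)) - (LINT z|lborel. \<psi> z * g (y - r *\<^sub>R z))\<bar>
    = \<bar>(LINT z|lborel. (\<psi> (z + w) - \<psi> z) * g (x - r *\<^sub>R z))\<bar>"
    using integrable_mult_bounded(1)[OF I gm, of B] integrable_mult_bounded(1)[OF I' gm, of B] g
    by (simp add: left_diff_distrib abs_minus_commute)
  also have "\<dots> \<le> B * (LINT z|lborel. \<bar>\<psi> (z + w) - \<psi> z\<bar>)"
    by (rule integrable_mult_bounded(3)) (use I I' gm g in auto)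
  also have "\<dots> \<le> B * (C * norm w)"
    using B by (intro mult_left_mono C) auto
  also have "norm w = norm (x - y) / r"
    using r by (simp add: w_def norm_minus_commute divide_inverse mult.commute)
  finally show ?thesis by (simp add: mult.assoc)
qed

text \<open>Fubini, with a translation by \<open>s p\<close> in between: the adjoint of averaging
  over shifts is averaging over the opposite shifts. The parameter space stays abstract because it
  is later both the space of \<open>z\<close> alone and the space of pairs of a scale and a point
  \<open>z\<close>.\<close>

lemma (in sigma_finite_measure) integral_shift_average:
  fixes g \<phi> :: "'v::euclidean_space \<Rightarrow> real" and k :: "'a \<Rightarrow> real"
  assumes k: "integrable M k" and s [measurable]: "s \<in> measurable M borel"
    and g [measurable]: "g \<in> borel_measurable borel" and gB: "\<And>x. \<bar>g x\<bar> \<le> B" and \<phi>: "integrable lborel \<phi>"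
  shows "(LINT x|lborel. (LINT p|M. k p * g (x - s p)) * \<phi> x) = (LINT y|lborel. g y * (LINT p|M. k p * \<phi> (y + s p)))" (is ?eq)
    and "integrable lborel (\<lambda>y. g y * (LINT p|M. k p * \<phi> (y + s p)))" (is ?int)
proof -
  interpret P: pair_sigma_finite M "lborel :: 'v measure"
    by unfold_locales
  have B: "B \<ge> 0" using gB[of undefined] by linarith
  have [measurable]: "k \<in> borel_measurable M" "\<phi> \<in> borel_measurable borel"
    using k \<phi> by (auto dest: borel_measurable_integrable)
  have gm: "(\<lambda>x. g (x - c)) \<in> borel_measurable lborel" for c by measurable
  have int1: "integrable lborel (\<lambda>x. g (x - c) * \<phi> x)" for c
    by (rule integrable_mult_bounded(2)[OF \<phi> gm gB])
  have bd: "(LINT x|lborel. \<bar>g (x - c) * \<phi> x\<bar>) \<le> B * (LINT x|lborel. \<bar>\<phi> x\<bar>)" for c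
  proof -
    have "(LINT x|lborel. \<bar>g (x - c) * \<phi> x\<bar>) \<le> (LINT x|lborel. B * \<bar>\<phi> x\<bar>)"
      by (rule integral_mono) (use integrable_abs[OF int1] \<phi> gB in \<open>auto simp: abs_mult intro!: mult_right_mono\<close>)
    then show ?thesis by simp
  qed
  have I: "integrable (M \<Otimes>\<^sub>M lborel) (\<lambda>(p, x). k p * (g (x - s p) * \<phi> x))"
  proof (rule P.Fubini_integrable)
    show "(\<lambda>(p, x). k p * (g (x - s p) * \<phi> x)) \<in> borel_measurable (M \<Otimes>\<^sub>M lborel)" by measurable
    show "AE p in M. integrable lborel (\<lambda>x. case (p, x) of (p, x) \<Rightarrow> k p * (g (x - s p) * \<phi> x))"
      using int1 by auto
    show "integrable M (\<lambda>p. LINT x|lborel. norm (case (p, x) of (p, x) \<Rightarrow> k p * (g (x - s p) * \<phi> x)))"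
    proof (rule Bochner_Integration.integrable_bound)
      show "integrable M (\<lambda>p. k p * (B * (LINT x|lborel. \<bar>\<phi> x\<bar>)))" using k by auto
      show "AE p in M. norm (LINT x|lborel. norm (case (p, x) of (p, x) \<Rightarrow> k p * (g (x - s p) * \<phi> x)))
         \<le> norm (k p * (B * (LINT x|lborel. \<bar>\<phi> x\<bar>)))"
        using B bd by (intro AE_I2) (simp add: abs_mult[of "k _"] mult_left_mono)
    qed measurable
  qed
  have I2: "integrable (M \<Otimes>\<^sub>M lborel) (\<lambda>(p, y). k p * (g y * \<phi> (y + s p)))"
  proof (rule P.Fubini_integrable)
    show "(\<lambda>(p, y). k p * (g y * \<phi> (y + s p))) \<in> borel_measurable (M \<Otimes>\<^sub>M lborel)" by measurable
    have i2: "integrable lborel (\<lambda>y. g y * \<phi> (y + c))" for c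
      using integrable_lborel_translate[OF int1[of c], of c] by simp
    show "AE p in M. integrable lborel (\<lambda>x. case (p, x) of (p, y) \<Rightarrow> k p * (g y * \<phi> (y + s p)))"
      using i2 by auto
    have b2: "(LINT y|lborel. \<bar>g y * \<phi> (y + c)\<bar>) \<le> B * (LINT x|lborel. \<bar>\<phi> x\<bar>)" for c
    proof -
      have "(LINT x|lborel. \<bar>g x * \<phi> (x + c)\<bar>) = (LINT x|lborel. \<bar>g (x - c) * \<phi> x\<bar>)"
        using integral_lborel_translate[of "\<lambda>x. \<bar>g (x - c) * \<phi> x\<bar>" c] by simp
      then show ?thesis using bd by simp
    qed
    show "integrable M (\<lambda>p. LINT x|lborel. norm (case (p, x) of (p, y) \<Rightarrow> k p * (g y * \<phi> (y + s p))))"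
    proof (rule Bochner_Integration.integrable_bound)
      show "integrable M (\<lambda>p. k p * (B * (LINT x|lborel. \<bar>\<phi> x\<bar>)))" using k by auto
      show "AE p in M. norm (LINT x|lborel. norm (case (p, x) of (p, y) \<Rightarrow> k p * (g y * \<phi> (y + s p))))
         \<le> norm (k p * (B * (LINT x|lborel. \<bar>\<phi> x\<bar>)))"
        using B b2 by (intro AE_I2) (simp add: abs_mult[of "k _"] mult_left_mono)
    qed measurable
  qed
  have "(LINT x|lborel. (LINT p|M. k p * g (x - s p)) * \<phi> x) = (LINT x|lborel. (LINT p|M. k p * (g (x - s p) * \<phi> x)))"
    by (simp add: mult.assoc flip: integral_mult_left_zero)
  also have "\<dots> = (LINT p|M. (LINT x|lborel. k p * (g (x - s p) * \<phi> x)))"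
    by (rule P.Fubini_integral[OF I])
  also have "\<dots> = (LINT p|M. (LINT y|lborel. k p * (g y * \<phi> (y + s p))))"
  proof (rule Bochner_Integration.integral_cong[OF refl])
    fix p
    show "(LINT x|lborel. k p * (g (x - s p) * \<phi> x)) = (LINT y|lborel. k p * (g y * \<phi> (y + s p)))"
      using integral_lborel_translate[of "\<lambda>x. g (x - s p) * \<phi> x" "s p"] by simp
  qed
  also have "\<dots> = (LINT y|lborel. (LINT p|M. k p * (g y * \<phi> (y + s p))))"
    by (rule P.Fubini_integral[OF I2, symmetric])
  also have "\<dots> = (LINT y|lborel. g y * (LINT p|M. k p * \<phi> (y + s p)))"
    by (simp add: mult.left_commute)
  finally show ?eq .
  show ?int using P.integrable_snd[OF I2] by (simp add: mult.left_commute)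
qed

section \<open>Mollifiers\<close>

lemma integral_pos_of_continuous:
  fixes \<phi> :: "real^'n::finite \<Rightarrow> real"
  assumes c: "continuous_on UNIV \<phi>" "bsupp \<phi>" and nn: "\<And>x. \<phi> x \<ge> 0" and pos: "\<phi> 0 > 0"
  shows "(LINT x|lborel. \<phi> x) > 0"
proof -
  have "isCont \<phi> 0" using c(1) by (simp add: continuous_on_eq_continuous_at)
  then obtain r where r: "r > 0" "\<And>y. dist y 0 < r \<Longrightarrow> dist (\<phi> y) (\<phi> 0) < \<phi> 0 / 2"
    using pos unfolding continuous_at_eps_delta by (meson half_gt_zero)
  have "0 < \<phi> 0 / 2 * measure lborel (ball (0::real^'n) r)"
    using r(1) pos content_ball_pos[of r "0::real^'n"] by simp
  also have "\<dots> = (LINT x|lborel. \<phi> 0 / 2 * indicator (ball (0::real^'n) r) x)" by simp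
  also have "\<dots> \<le> (LINT x|lborel. \<phi> x)"
  proof (rule integral_mono)
    show "integrable lborel (\<lambda>x. \<phi> 0 / 2 * indicator (ball (0::real^'n) r) x)"
      by (intro integrable_mult_right integrable_real_indicator)
         (use emeasure_bounded_finite[OF bounded_ball, of "0::real^'n" r] in auto)
    show "integrable lborel \<phi>" by (rule integrable_bsupp[OF c])
    show "\<phi> 0 / 2 * indicator (ball (0::real^'n) r) x \<le> \<phi> x" for x
    proof (cases "x \<in> ball 0 r")
      case True
      then have "dist (\<phi> x) (\<phi> 0) < \<phi> 0 / 2" by (intro r) (simp add: dist_commute)
      then have "\<phi> 0 / 2 \<le> \<phi> x" unfolding dist_real_def by linarith
      then show ?thesis using True by simp
    qed (use nn in auto)
  qed
  finally show ?thesis .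
qed

text \<open>The powers of 1/t are included because differentiating exp(-1/t) produces them; the
  linear span of the family is closed under differentiation.\<close>

definition flat :: "nat \<Rightarrow> real \<Rightarrow> real" where
  "flat m t = (if t > 0 then inverse t ^ m * exp (- inverse t) else 0)"

lemma flat_has_derivative:
  "(flat m has_real_derivative (flat (m + 2) t - real m * flat (m + 1) t)) (at t)"
proof (cases t "0::real" rule: linorder_cases)
  case less
  have "(flat m has_real_derivative 0) (at t)"
    by (rule has_field_derivative_transform_within_open[where f="\<lambda>_. 0" and S="{..<0}"]) (use less in \<open>auto simp: flat_def\<close>)
  then show ?thesis using less by (simp add: flat_def)
next
  case greater
  have "((\<lambda>t. inverse t ^ m * exp (- inverse t)) has_real_derivative
      (inverse t ^ (m+2) * exp (- inverse t) - real m * (inverse t ^ (m+1) * exp (- inverse t)))) (at t)"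
    using greater
    by (cases m) (auto intro!: derivative_eq_intros simp: field_simps power2_eq_square,
        metis Suc_pred gr0I power_Suc)
  then have "(flat m has_real_derivative
      (inverse t ^ (m+2) * exp (- inverse t) - real m * (inverse t ^ (m+1) * exp (- inverse t)))) (at t)"
    by (rule has_field_derivative_transform_within_open[where S="{0<..}"]) (use greater in \<open>auto simp: flat_def\<close>)
  then show ?thesis using greater by (simp add: flat_def)
next
  case equal
  \<comment> \<open>With y = 1/h, the difference quotient from the right at 0 is
    \<open>y ^ Suc m / exp y\<close>.\<close>
  have L: "((\<lambda>y::real. y ^ Suc m / exp y) \<longlongrightarrow> 0) at_top" by (rule tendsto_power_div_exp_0)
  have "((\<lambda>h. (flat m (0 + h) - flat m 0) / h) \<longlongrightarrow> 0) (at_right 0)"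
  proof (rule Lim_transform_eventually)
    show "((\<lambda>h::real. inverse h ^ Suc m / exp (inverse h)) \<longlongrightarrow> 0) (at_right 0)"
      by (rule filterlim_compose[OF L filterlim_inverse_at_top_right])
    show "\<forall>\<^sub>F h in at_right 0. inverse h ^ Suc m / exp (inverse h) = (flat m (0 + h) - flat m 0) / h"
      unfolding eventually_at_right_field
      by (intro exI[of _ 1]) (auto simp: flat_def exp_minus field_simps)
  qed
  moreover have "((\<lambda>h. (flat m (0 + h) - flat m 0) / h) \<longlongrightarrow> 0) (at_left 0)"
  proof (rule Lim_transform_eventually)
    show "((\<lambda>h::real. 0::real) \<longlongrightarrow> 0) (at_left 0)" by simp
    show "\<forall>\<^sub>F h in at_left 0. 0 = (flat m (0 + h) - flat m 0) / h"
      unfolding eventually_at_left_field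
      by (intro exI[of _ "-1"]) (auto simp: flat_def)
  qed
  ultimately have "((\<lambda>h. (flat m (0 + h) - flat m 0) / h) \<longlongrightarrow> 0) (at 0)"
    by (simp add: filterlim_split_at)
  then show ?thesis using equal by (simp add: DERIV_def flat_def)
qed

text \<open>A class of functions closed under differentiation that contains bump functions.\<close>

inductive smooth1 :: "(real \<Rightarrow> real) \<Rightarrow> bool" where
  smooth1_const: "smooth1 (\<lambda>_. c)"
| smooth1_flat: "smooth1 (\<lambda>t. flat m (a + b * t))"
| smooth1_add: "smooth1 f \<Longrightarrow> smooth1 g \<Longrightarrow> smooth1 (\<lambda>t. f t + g t)"
| smooth1_mult: "smooth1 f \<Longrightarrow> smooth1 g \<Longrightarrow> smooth1 (\<lambda>t. f t * g t)"

lemma smooth1_derivative: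
  assumes "smooth1 f"
  shows "\<exists>f'. smooth1 f' \<and> (\<forall>t. (f has_real_derivative f' t) (at t))"
  using assms
proof induction
  case (smooth1_const c)
  show ?case by (rule exI[of _ "\<lambda>_. 0"]) (auto intro: smooth1.intros)
next
  case (smooth1_flat m a b)
  have d: "((\<lambda>t. flat m (a + b * t)) has_real_derivative
      b * (flat (m + 2) (a + b * t) + (- real m) * flat (m + 1) (a + b * t))) (at t)" for t
  proof -
    have "((\<lambda>t. a + b * t) has_real_derivative b) (at t)" by (auto intro!: derivative_eq_intros)
    from DERIV_chain2[OF flat_has_derivative this, of m] show ?thesis by (simp add: algebra_simps)
  qed
  have "smooth1 (\<lambda>t. b * (flat (m + 2) (a + b * t) + (- real m) * flat (m + 1) (a + b * t)))"
    by (intro smooth1.intros)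
  with d show ?case by blast
next
  case (smooth1_add f g)
  then obtain f' g' where "smooth1 f'" "smooth1 g'" "\<And>t. (f has_real_derivative f' t) (at t)" "\<And>t. (g has_real_derivative g' t) (at t)"
    by blast
  then show ?case by (intro exI[of _ "\<lambda>t. f' t + g' t"]) (auto intro!: smooth1.intros DERIV_add)
next
  case (smooth1_mult f g)
  then obtain f' g' where "smooth1 f'" "smooth1 g'" "\<And>t. (f has_real_derivative f' t) (at t)" "\<And>t. (g has_real_derivative g' t) (at t)"
    by blast
  then show ?case using smooth1_mult.hyps
    by (intro exI[of _ "\<lambda>t. f' t * g t + g' t * f t"]) (auto intro!: smooth1.intros DERIV_mult)
qed

lemma smooth1_deriv:
  assumes "smooth1 f"
  shows "smooth1 (deriv f)" "(f has_real_derivative deriv f t) (at t)" "continuous_on A f"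
proof -
  obtain f' where f': "smooth1 f'" "\<And>t. (f has_real_derivative f' t) (at t)"
    using smooth1_derivative[OF assms] by blast
  then have "f' = deriv f" using DERIV_imp_deriv[OF f'(2)] by (simp add: fun_eq_iff)
  then show "smooth1 (deriv f)" "(f has_real_derivative deriv f t) (at t)" using f' by auto
  show "continuous_on A f"
    using f'(2) by (meson DERIV_isCont continuous_at_imp_continuous_on)
qed

lemma prod_smooth1_partial:
  fixes F :: "'n::finite \<Rightarrow> real \<Rightarrow> real"
  assumes F: "\<And>j. smooth1 (F j)"
  shows "((\<lambda>t. c * (\<Prod>j\<in>UNIV. F j ((x + t *\<^sub>R axis i 1) $ j))) has_real_derivative
     c * (\<Prod>j\<in>UNIV. (F(i := deriv (F i))) j (x $ j))) (at 0)"
proof -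
  have split: "(\<Prod>j\<in>UNIV. H j) = H i * (\<Prod>j\<in>UNIV - {i}. H j)" for H :: "'n \<Rightarrow> real"
    by (rule prod.remove) auto
  have "((\<lambda>t. F i (x $ i + t)) has_real_derivative deriv (F i) (x $ i)) (at 0)"
    using DERIV_shift[of "F i" "deriv (F i) (x $ i)" 0 "x $ i"] smooth1_deriv(2)[OF F, of i "x $ i"]
    by (simp add: add.commute)
  then have "((\<lambda>t. c * (F i (x $ i + t) * (\<Prod>j\<in>UNIV - {i}. F j (x $ j)))) has_real_derivative
      c * (deriv (F i) (x $ i) * (\<Prod>j\<in>UNIV - {i}. F j (x $ j)))) (at 0)"
    by (intro DERIV_cmult DERIV_cmult_right)
  moreover have "(\<Prod>j\<in>UNIV. F j ((x + t *\<^sub>R axis i 1) $ j)) = F i (x $ i + t) * (\<Prod>j\<in>UNIV - {i}. F j (x $ j))" for t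
    by (subst split) (auto simp: axis_def intro!: prod.cong)
  moreover have "(\<Prod>j\<in>UNIV. (F(i := deriv (F i))) j (x $ j)) = deriv (F i) (x $ i) * (\<Prod>j\<in>UNIV - {i}. F j (x $ j))"
    by (subst split) (auto intro!: prod.cong)
  ultimately show ?thesis by simp
qed

text \<open>A partial derivative of a product of one-variable functions merely replaces one factor
  by its derivative, so all iterated partials keep this shape. This is why the mollifier is a
  product rather than a radial function.\<close>

lemma smooth_fun_prod:
  fixes F :: "'n::finite \<Rightarrow> real \<Rightarrow> real"
  assumes F: "\<And>j. smooth1 (F j)"
  shows "smooth_fun (\<lambda>x. c * (\<Prod>j\<in>UNIV. F j (x $ j)))"
proof -
  have "\<exists>F'. (\<forall>j. smooth1 (F' j)) \<and>
      iter_pderiv is (\<lambda>x. c * (\<Prod>j\<in>UNIV. F j (x $ j))) = (\<lambda>x. c * (\<Prod>j\<in>UNIV. F' j (x $ j)))" for "is"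
  proof (induction "is")
    case Nil then show ?case using F by auto
  next
    case (Cons i "is")
    then obtain F' where F': "\<And>j. smooth1 (F' j)"
      and eq: "iter_pderiv is (\<lambda>x. c * (\<Prod>j\<in>UNIV. F j (x $ j))) = (\<lambda>x. c * (\<Prod>j\<in>UNIV. F' j (x $ j)))"
      by blast
    have "pderiv_at i (\<lambda>x. c * (\<Prod>j\<in>UNIV. F' j (x $ j))) = (\<lambda>x. c * (\<Prod>j\<in>UNIV. (F'(i := deriv (F' i))) j (x $ j)))"
      unfolding pderiv_at_def by (intro ext DERIV_imp_deriv prod_smooth1_partial F')
    moreover have "\<forall>j. smooth1 ((F'(i := deriv (F' i))) j)"
      using F' smooth1_deriv(1) by auto
    ultimately show ?case unfolding iter_pderiv.simps eq by blast
  qed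
  then have *: "\<exists>F'. (\<forall>j. smooth1 (F' j)) \<and>
      iter_pderiv is (\<lambda>x. c * (\<Prod>j\<in>UNIV. F j (x $ j))) = (\<lambda>x. c * (\<Prod>j\<in>UNIV. F' j (x $ j)))" for "is" .
  show ?thesis
    unfolding smooth_fun_def
  proof (intro allI conjI)
    fix "is" :: "'n list"
    obtain F' where F': "\<And>j. smooth1 (F' j)"
      and eq: "iter_pderiv is (\<lambda>x. c * (\<Prod>j\<in>UNIV. F j (x $ j))) = (\<lambda>x. c * (\<Prod>j\<in>UNIV. F' j (x $ j)))"
      using *[of "is"] by blast
    show "continuous_on UNIV (iter_pderiv is (\<lambda>x. c * (\<Prod>j\<in>UNIV. F j (x $ j))))"
      unfolding eq
      by (intro continuous_intros continuous_on_compose2[OF smooth1_deriv(3)[OF F', where A=UNIV]]) auto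
    fix i x
    show "(\<lambda>t. iter_pderiv is (\<lambda>x. c * (\<Prod>j\<in>UNIV. F j (x $ j))) (x + t *\<^sub>R axis i 1)) differentiable at 0"
      unfolding eq using prod_smooth1_partial[of F', OF F', of c x i] by (meson real_differentiable_def)
  qed
qed

lemma smooth_fun_has_partials:
  assumes "smooth_fun \<phi>"
  shows "has_partials (iter_pderiv is \<phi>) (\<lambda>i. iter_pderiv (i # is) \<phi>)"
  unfolding has_partials_def
proof (intro conjI allI)
  show "continuous_on UNIV (iter_pderiv is \<phi>)" "continuous_on UNIV (iter_pderiv (i # is) \<phi>)" for i
    using assms unfolding smooth_fun_def by blast+
  fix i x
  have "(\<lambda>t. iter_pderiv is \<phi> (x + t *\<^sub>R axis i 1)) differentiable at 0"
    using assms unfolding smooth_fun_def by blast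
  then show "((\<lambda>t. iter_pderiv is \<phi> (x + t *\<^sub>R axis i 1)) has_real_derivative iter_pderiv (i # is) \<phi> x) (at 0)"
    unfolding iter_pderiv.simps pderiv_at_def
    by (metis DERIV_imp_deriv real_differentiable_def)
qed

lemma bsupp_iter_pderiv:
  assumes "smooth_fun \<phi>" "bsupp \<phi>"
  shows "bsupp (iter_pderiv is \<phi>)"
proof (induction "is")
  case (Cons i "is")
  then show ?case using bsupp_partial[OF smooth_fun_has_partials[OF assms(1)], of "is" i] by simp
qed (use assms in simp)

lemma mollifier_exists:
  fixes \<epsilon> :: real
  assumes "\<epsilon> > 0"
  obtains \<eta> :: "real^'n::finite \<Rightarrow> real"
  where "smooth_fun \<eta>" "\<And>x. \<eta> x \<ge> 0" "\<And>x. norm x \<ge> \<epsilon> \<Longrightarrow> \<eta> x = 0" "bsupp \<eta>" "(LINT x|lborel. \<eta> x) = 1"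
proof -
  \<comment> \<open>Each factor is supported where |t| is below 1/s = \<epsilon>/n, with n the
    dimension. Inside the support the sum of the absolute coordinates, hence the norm, is below
    \<epsilon>.\<close>
  define s where "s = real CARD('n) / \<epsilon>"
  have s: "s > 0" using assms by (simp add: s_def)
  define b where "b t = flat 0 (1 + s * t) * flat 0 (1 + (- s) * t)" for t
  have b: "smooth1 b" unfolding b_def by (intro smooth1.intros)
  have b0: "b t = 0" if "\<bar>t\<bar> \<ge> 1 / s" for t
  proof -
    have "1 \<le> s * \<bar>t\<bar>" using that s by (simp add: field_simps)
    then have "1 + s * t \<le> 0 \<or> 1 + (- s) * t \<le> 0" by (cases "t \<ge> 0") auto
    then show ?thesis by (auto simp: b_def flat_def)
  qed
  have bnn: "b t \<ge> 0" for t by (simp add: b_def flat_def)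
  define \<beta> where "\<beta> x = (\<Prod>j\<in>UNIV. b (x $ j))" for x :: "real^'n"
  have nn: "\<beta> x \<ge> 0" for x unfolding \<beta>_def using bnn by (intro prod_nonneg) auto
  have van: "\<beta> x = 0" if x: "norm x \<ge> \<epsilon>" for x
  proof -
    have "\<exists>j. \<bar>x $ j\<bar> \<ge> 1 / s"
    proof (rule ccontr)
      assume "\<not> (\<exists>j. \<bar>x $ j\<bar> \<ge> 1 / s)"
      then have "(\<Sum>j\<in>UNIV. \<bar>x $ j\<bar>) < (\<Sum>j\<in>(UNIV::'n set). 1 / s)"
        by (intro sum_strict_mono) (auto simp: not_le)
      also have "\<dots> = \<epsilon>" using assms by (simp add: s_def)
      finally show False using x norm_le_l1_cart[of x] by linarith
    qed
    then obtain j where "b (x $ j) = 0" using b0 by blast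
    then show ?thesis unfolding \<beta>_def by (intro prod_zero) auto
  qed
  have supp: "bsupp \<beta>" unfolding bsupp_def using van by (meson less_imp_le)
  have sm: "smooth_fun (\<lambda>x. c * \<beta> x)" for c
    unfolding \<beta>_def by (rule smooth_fun_prod) (rule b)
  have cont: "continuous_on UNIV \<beta>"
    using has_partials_continuous(1)[OF smooth_fun_has_partials[OF sm[of 1], of "[]"]] by simp
  have "\<beta> 0 > 0" unfolding \<beta>_def by (intro prod_pos) (auto simp: b_def flat_def)
  then have pos: "(LINT x|lborel. \<beta> x) > 0"
    using cont supp nn by (intro integral_pos_of_continuous)
  define c where "c = 1 / (LINT x|lborel. \<beta> x)"
  show ?thesis
  proof (rule that[of "\<lambda>x. c * \<beta> x"])
    show "bsupp (\<lambda>x. c * \<beta> x)" by (rule bsupp_mult(2)[OF supp])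
  qed (use sm[of c] pos nn van in \<open>auto simp: c_def\<close>)
qed

section \<open>The maximum principle for antiperiodic functions\<close>

text \<open>Were \<open>m\<close> positive, \<open>q'\<close>, which vanishes at the maximum, would
  be positive just to the right of 0, and the mean value theorem would push \<open>q\<close> above
  its maximum.\<close>

lemma second_derivative_nonpos_at_max:
  fixes q q' :: "real \<Rightarrow> real"
  assumes q: "\<And>t. (q has_real_derivative q' t) (at t)" and q': "(q' has_real_derivative m) (at 0)"
    and max: "r > 0" "\<And>t. \<bar>t\<bar> < r \<Longrightarrow> q t \<le> q 0"
  shows "m \<le> 0"
proof (rule ccontr)
  assume "\<not> m \<le> 0"
  have z: "q' 0 = 0"
    by (rule DERIV_local_max[OF q max(1)]) (use max(2) in auto)
  obtain e where e: "e > 0" "\<And>h. h > 0 \<Longrightarrow> h < e \<Longrightarrow> q' 0 < q' (0 + h)"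
    using DERIV_pos_inc_right[OF q'] \<open>\<not> m \<le> 0\<close> by auto
  define t where "t = min e r / 2"
  have t: "0 < t" "t < e" "t < r" using e(1) max(1) by (auto simp: t_def)
  have "\<exists>s. 0 < s \<and> s < t \<and> q t - q 0 = (t - 0) * q' s"
    by (rule MVT2) (use t q in auto)
  then obtain s where s: "0 < s" "s < t" "q t - q 0 = t * q' s" by auto
  have "q' s > 0" using e(2)[of s] s t z by simp
  then have "t * q' s > 0" using t by simp
  then have "q t > q 0" using s by linarith
  with max(2)[of t] t show False by simp
qed

definition antiper :: "'n::finite \<Rightarrow> real \<Rightarrow> (real^'n \<Rightarrow> real) \<Rightarrow> bool" where
  "antiper k d u \<longleftrightarrow> (\<forall>x. u (x + d *\<^sub>R axis k 1) = - u x)"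

text \<open>The hyperplane of reflection is taken through \<open>p\<close>, so at \<open>p\<close>
  the reflected sum is \<open>2 * v p\<close>, while the parabola equals
  \<open>d\<^sup>2 / 4\<close>; halving gives the constant 1/8. The Laplacian of the sum is at least
  -2\<gamma>, which is exactly the Laplacian of \<gamma> times the parabola.\<close>

lemma antiperiodic_maximum_principle:
  fixes v :: "real^'n::finite \<Rightarrow> real"
  assumes d: "d > 0" and c: "continuous_on UNIV v"
    and D: "\<And>i x. ((\<lambda>t. v (x + t *\<^sub>R axis i 1)) has_real_derivative D i x) (at 0)"
    and E: "\<And>i x. ((\<lambda>t. D i (x + t *\<^sub>R axis i 1)) has_real_derivative E i x) (at 0)"
    and S: "\<And>x. v x \<le> S" and ap: "antiper k d v" and lap: "\<And>x. - \<gamma> \<le> (\<Sum>i\<in>UNIV. E i x)"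
    and \<gamma>: "\<gamma> \<ge> 0"
  shows "v p \<le> d\<^sup>2 / 8 * \<gamma>"
proof -
  define N where "N = real CARD('n) + 1"
  define a where "a = p $ k"
  define \<sigma> where "\<sigma> x = x + (2 * (a - x $ k)) *\<^sub>R axis k (1::real)" for x :: "real^'n"
  have D': "((\<lambda>t. v (x + t *\<^sub>R axis i 1)) has_real_derivative D i (x + t *\<^sub>R axis i 1)) (at t)" for i x t
  proof -
    have "((\<lambda>s. v (x + (s + t) *\<^sub>R axis i 1)) has_real_derivative D i (x + t *\<^sub>R axis i 1)) (at 0)"
      using D[of "x + t *\<^sub>R axis i 1" i] by (simp add: algebra_simps)
    then show ?thesis using DERIV_shift[of "\<lambda>t. v (x + t *\<^sub>R axis i 1)" _ 0 t] by simp
  qed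
  have main: "2 * v p \<le> d\<^sup>2 / 4 * (\<gamma> + \<delta> * N)" if \<delta>: "\<delta> > 0" for \<delta>
  proof (rule ccontr)
    assume neg: "\<not> ?thesis"
    \<comment> \<open>The terms with \<open>\<delta>\<close> form a strictly superharmonic barrier, since \<open>N\<close> exceeds the dimension,
      and localise the maximum to a ball around \<open>p\<close>.\<close>
    define w where "w x = v x + v (\<sigma> x) - (\<gamma> + \<delta> * N) * (d\<^sup>2 / 4 - (x $ k - a)\<^sup>2) - \<delta> * (norm (x - p))\<^sup>2" for x
    \<comment> \<open>The sum of \<open>v\<close> and its reflection is at most
      \<open>2 * S\<close>; from radius \<open>B\<close> on, the term with \<open>\<delta>\<close>
      outweighs it, so \<open>w\<close> is not positive there.\<close>
    define B where "B = sqrt (2 * \<bar>S\<bar> / \<delta>) + 1"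
    have B: "B > 0" "\<delta> * B\<^sup>2 \<ge> 2 * S"
    proof -
      show "B > 0" using \<delta> by (simp add: B_def add_nonneg_pos)
      have "(sqrt (2 * \<bar>S\<bar> / \<delta>))\<^sup>2 \<le> B\<^sup>2" unfolding B_def using \<delta> by (intro power_mono) auto
      then have "2 * \<bar>S\<bar> / \<delta> \<le> B\<^sup>2" using \<delta> by simp
      then show "\<delta> * B\<^sup>2 \<ge> 2 * S" using \<delta> by (simp add: field_simps)
    qed
    define K where "K = {x. \<bar>x $ k - a\<bar> \<le> d / 2} \<inter> cball p B"
    have "compact K" unfolding K_def
      by (intro closed_Int_compact closed_Collect_le continuous_intros) auto
    moreover have "p \<in> K" using d B by (simp add: K_def a_def)
    moreover have "continuous_on K w"
      unfolding w_def \<sigma>_def by (intro continuous_intros continuous_on_compose2[OF c] continuous_on_subset[OF c]) auto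
    ultimately obtain x0 where x0: "x0 \<in> K" "\<And>y. y \<in> K \<Longrightarrow> w y \<le> w x0"
      using continuous_attains_sup[of K w] by blast
    have "\<sigma> p = p" by (simp add: \<sigma>_def a_def)
    then have "w p > 0" using neg by (simp add: w_def a_def mult.commute)
    then have wpos: "w x0 > 0" using x0 \<open>p \<in> K\<close> by force
    have nn: "\<gamma> + \<delta> * N \<ge> 0" using \<gamma> \<delta> by (simp add: N_def)
    \<comment> \<open>On the two faces, \<open>x0\<close> and \<open>\<sigma> x0\<close> differ by a
      shift of length \<open>d\<close> along axis \<open>k\<close>, so the values of
      \<open>v\<close> cancel by antiperiodicity. The parabola vanishes as well, which leaves
      \<open>w x0\<close> at most 0.\<close>
    have k0: "\<bar>x0 $ k - a\<bar> < d / 2"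
    proof (rule ccontr)
      assume "\<not> ?thesis"
      then have eq: "\<bar>x0 $ k - a\<bar> = d / 2" using x0(1) by (simp add: K_def)
      have "v x0 + v (\<sigma> x0) = 0"
      proof (cases "x0 $ k \<ge> a")
        case True
        then have "2 * (a - x0 $ k) = - d" using eq by simp
        then have "x0 = \<sigma> x0 + d *\<^sub>R axis k 1" by (simp add: \<sigma>_def)
        then show ?thesis using ap unfolding antiper_def by (metis add.left_inverse)
      next
        case False
        then have "2 * (a - x0 $ k) = d" using eq by simp
        then show ?thesis using ap unfolding antiper_def \<sigma>_def by simp
      qed
      moreover have "d\<^sup>2 / 4 - (x0 $ k - a)\<^sup>2 = 0"
      proof -
        have "(x0 $ k - a)\<^sup>2 = (d / 2)\<^sup>2" using eq by (metis power2_abs)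
        then show ?thesis by (simp add: power_divide)
      qed
      ultimately show False using wpos \<delta> by (simp add: w_def mult_less_0_iff)
    qed
    have n0: "norm (x0 - p) < B"
    proof (rule ccontr)
      assume "\<not> ?thesis"
      then have "(norm (x0 - p))\<^sup>2 \<ge> B\<^sup>2" using B by (intro power_mono) auto
      then have "\<delta> * B\<^sup>2 \<le> \<delta> * (norm (x0 - p))\<^sup>2" using \<delta> by simp
      moreover have "(\<gamma> + \<delta> * N) * (d\<^sup>2 / 4 - (x0 $ k - a)\<^sup>2) \<ge> 0"
      proof (rule mult_nonneg_nonneg[OF nn])
        have "\<bar>x0 $ k - a\<bar>\<^sup>2 \<le> (d / 2)\<^sup>2" using k0 by (intro power_mono) auto
        then show "0 \<le> d\<^sup>2 / 4 - (x0 $ k - a)\<^sup>2" by (simp add: power_divide)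
      qed
      ultimately have "w x0 \<le> 0" using B(2) S[of x0] S[of "\<sigma> x0"] by (simp add: w_def)
      then show False using wpos by simp
    qed
    define r where "r = min (d / 2 - \<bar>x0 $ k - a\<bar>) (B - norm (x0 - p))"
    have r: "r > 0" using k0 n0 by (simp add: r_def)
    have inK: "x0 + t *\<^sub>R axis i 1 \<in> K" if "\<bar>t\<bar> < r" for t i
    proof -
      have "\<bar>(x0 + t *\<^sub>R axis i 1) $ k - a\<bar> \<le> \<bar>x0 $ k - a\<bar> + \<bar>t\<bar>" by (auto simp: axis_def)
      moreover have "norm (x0 + t *\<^sub>R axis i 1 - p) \<le> norm (x0 - p) + \<bar>t\<bar>"
        using norm_triangle_ineq[of "x0 - p" "t *\<^sub>R axis i 1"] by (simp add: algebra_simps)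
      ultimately show ?thesis using that unfolding K_def r_def by (auto simp: dist_norm norm_minus_commute)
    qed
    have second: "E i x0 + E i (\<sigma> x0) + 2 * (\<gamma> + \<delta> * N) * of_bool (i = k) - 2 * \<delta> \<le> 0" for i
    proof -
      \<comment> \<open>The reflection reverses motion along axis \<open>k\<close>. The sign enters
        the second derivative twice and disappears.\<close>
      define s :: real where "s = (if i = k then -1 else 1)"
      have \<sigma>t: "\<sigma> (x0 + t *\<^sub>R axis i 1) = \<sigma> x0 + (s * t) *\<^sub>R axis i 1" for t
        by (auto simp: \<sigma>_def s_def axis_def vec_eq_iff)
      have norm_t: "(norm (x0 + t *\<^sub>R axis i 1 - p))\<^sup>2 = (norm (x0 - p))\<^sup>2 + 2 * t * (x0 - p) $ i + t\<^sup>2" for t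
      proof -
        have "x0 + t *\<^sub>R axis i 1 - p = (x0 - p) + t *\<^sub>R axis i 1" by simp
        then show ?thesis
          by (simp only: power2_norm_eq_inner)
             (simp add: inner_add_left inner_add_right inner_commute[of "axis i 1"] inner_axis power2_eq_square algebra_simps)
      qed
      define q' where "q' t = D i (x0 + t *\<^sub>R axis i 1) + s * D i (\<sigma> x0 + (s * t) *\<^sub>R axis i 1)
        + (\<gamma> + \<delta> * N) * (2 * of_bool (i = k) * (x0 $ k + of_bool (i = k) * t - a)) - \<delta> * (2 * (x0 - p) $ i + 2 * t)" for t
      have sE: "((\<lambda>t. H (x + (s * t) *\<^sub>R axis i 1)) has_real_derivative s * H') (at t)"
        if "((\<lambda>t. H (x + t *\<^sub>R axis i 1)) has_real_derivative H') (at (s * t))" for H :: "real^'n \<Rightarrow> real" and H' x t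
      proof -
        have "((\<lambda>t. s * t) has_real_derivative s) (at t)" by (auto intro!: derivative_eq_intros)
        from DERIV_chain2[OF that this] show ?thesis by (simp add: mult.commute)
      qed
      show ?thesis
      proof (rule second_derivative_nonpos_at_max[where q = "\<lambda>t. w (x0 + t *\<^sub>R axis i 1)" and q' = q' and r = r])
        show "((\<lambda>t. w (x0 + t *\<^sub>R axis i 1)) has_real_derivative q' t) (at t)" for t
        proof -
          have eq: "w (x0 + t *\<^sub>R axis i 1) = v (x0 + t *\<^sub>R axis i 1) + v (\<sigma> x0 + (s * t) *\<^sub>R axis i 1)
             - (\<gamma> + \<delta> * N) * (d\<^sup>2 / 4 - (x0 $ k + of_bool (i = k) * t - a)\<^sup>2)
             - \<delta> * ((norm (x0 - p))\<^sup>2 + 2 * t * (x0 - p) $ i + t\<^sup>2)" for t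
            unfolding w_def \<sigma>t norm_t by (auto simp: axis_def)
          have q1: "((\<lambda>t. (\<gamma> + \<delta> * N) * (d\<^sup>2 / 4 - (x0 $ k + of_bool (i = k) * t - a)\<^sup>2)) has_real_derivative
              - ((\<gamma> + \<delta> * N) * (2 * of_bool (i = k) * (x0 $ k + of_bool (i = k) * t - a)))) (at t)"
            by (auto intro!: derivative_eq_intros simp: algebra_simps)
          have q2: "((\<lambda>t. \<delta> * ((norm (x0 - p))\<^sup>2 + 2 * t * (x0 - p) $ i + t\<^sup>2)) has_real_derivative
              \<delta> * (2 * (x0 - p) $ i + 2 * t)) (at t)"
            by (auto intro!: derivative_eq_intros)
          from DERIV_diff[OF DERIV_diff[OF DERIV_add[OF D'[of x0 i t] sE[OF D'[of "\<sigma> x0" i "s * t"]]] q1] q2]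
          show ?thesis unfolding eq q'_def by simp
        qed
        have E0: "((\<lambda>t. D i (x + t *\<^sub>R axis i 1)) has_real_derivative E i x) (at (s * 0))" for x
          using E by simp
        have "(q' has_real_derivative (E i x0 + s * (s * E i (\<sigma> x0)) + (\<gamma> + \<delta> * N) * (2 * of_bool (i = k) * of_bool (i = k)) - \<delta> * 2)) (at 0)"
        proof -
          have q1: "((\<lambda>t. (\<gamma> + \<delta> * N) * (2 * of_bool (i = k) * (x0 $ k + of_bool (i = k) * t - a))) has_real_derivative
              (\<gamma> + \<delta> * N) * (2 * of_bool (i = k) * of_bool (i = k))) (at 0)"
            by (auto intro!: derivative_eq_intros)
          have q2: "((\<lambda>t. \<delta> * (2 * (x0 - p) $ i + 2 * t)) has_real_derivative \<delta> * 2) (at 0)"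
            by (auto intro!: derivative_eq_intros)
          from DERIV_diff[OF DERIV_add[OF DERIV_add[OF E[of i x0] DERIV_cmult[OF sE[OF E0[of "\<sigma> x0"]], of s]] q1] q2]
          show ?thesis unfolding q'_def[abs_def] .
        qed
        moreover have "E i x0 + s * (s * E i (\<sigma> x0)) + (\<gamma> + \<delta> * N) * (2 * of_bool (i = k) * of_bool (i = k)) - \<delta> * 2
            = E i x0 + E i (\<sigma> x0) + 2 * (\<gamma> + \<delta> * N) * of_bool (i = k) - 2 * \<delta>"
          by (auto simp: s_def)
        ultimately show "(q' has_real_derivative (E i x0 + E i (\<sigma> x0) + 2 * (\<gamma> + \<delta> * N) * of_bool (i = k) - 2 * \<delta>)) (at 0)"
          by simp
        show "r > 0" by (rule r)
        show "w (x0 + t *\<^sub>R axis i 1) \<le> w (x0 + 0 *\<^sub>R axis i 1)" if "\<bar>t\<bar> < r" for t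
          using x0(2)[OF inK[OF that]] by simp
      qed
    qed
    \<comment> \<open>The two Laplacians sum to at least -2\<gamma>. What remains on the left is
      then at least 2\<delta>(N - n), with n the dimension, which is 2\<delta> and positive.\<close>
    have "(\<Sum>i\<in>UNIV. E i x0 + E i (\<sigma> x0) + 2 * (\<gamma> + \<delta> * N) * of_bool (i = k) - 2 * \<delta>) \<le> 0"
      by (rule sum_nonpos) (rule second)
    moreover have "(\<Sum>i\<in>UNIV. 2 * (\<gamma> + \<delta> * N) * of_bool (i = k)) = 2 * (\<gamma> + \<delta> * N)"
      by (simp add: of_bool_def if_distrib cong: if_cong)
    ultimately have "(\<Sum>i\<in>UNIV. E i x0) + (\<Sum>i\<in>UNIV. E i (\<sigma> x0)) + 2 * (\<gamma> + \<delta> * N) - 2 * \<delta> * real CARD('n) \<le> 0"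
      by (simp add: sum.distrib sum_subtractf mult.commute[of "real CARD('n)"])
    moreover have "\<delta> * N = \<delta> * real CARD('n) + \<delta>" by (simp add: N_def algebra_simps)
    ultimately show False using lap[of x0] lap[of "\<sigma> x0"] \<delta> by argo
  qed
  have "2 * v p \<le> d\<^sup>2 / 4 * \<gamma>"
  proof (rule field_le_epsilon)
    fix e :: real assume "e > 0"
    define c where "c = d\<^sup>2 / 4 * N"
    have c: "c > 0" using d by (simp add: c_def N_def add_pos_nonneg)
    have "2 * v p \<le> d\<^sup>2 / 4 * (\<gamma> + (e / c) * N)" using c \<open>e > 0\<close> by (intro main) simp
    also have "\<dots> = d\<^sup>2 / 4 * \<gamma> + (e / c) * c" unfolding c_def by (simp add: algebra_simps)
    finally show "2 * v p \<le> d\<^sup>2 / 4 * \<gamma> + e" using c by simp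
  qed
  then show ?thesis by simp
qed

text \<open>Weak solutions of -\<Delta>u = g on the whole space, with \<open>G\<close> the gradient
  of \<open>u\<close>. Continuity of \<open>u\<close> and of \<open>G\<close> is part of the notion
  because it makes mollifications converge locally uniformly together with their gradients.\<close>

definition weak_sol :: "'n::finite \<Rightarrow> real \<Rightarrow> (real^'n \<Rightarrow> real) \<Rightarrow> (real^'n \<Rightarrow> real) \<Rightarrow> ('n \<Rightarrow> real^'n \<Rightarrow> real) \<Rightarrow> bool" where
  "weak_sol k d g u G \<longleftrightarrow> continuous_on UNIV u \<and> (\<forall>i. continuous_on UNIV (G i)) \<and>
     (\<exists>B. \<forall>x. \<bar>u x\<bar> \<le> B \<and> (\<forall>i. \<bar>G i x\<bar> \<le> B)) \<and> antiper k d u \<and>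
     (\<forall>\<phi> D. has_partials \<phi> D \<and> bsupp \<phi> \<longrightarrow>
        (\<forall>i. (LINT x|lborel. u x * D i x) = - (LINT x|lborel. G i x * \<phi> x)) \<and>
        (\<Sum>i\<in>UNIV. LINT x|lborel. G i x * D i x) = (LINT x|lborel. g x * \<phi> x))"

section \<open>The a priori bound for weak solutions, by mollification\<close>

lemma has_partials_reflect:
  assumes "has_partials \<phi> D"
  shows "has_partials (\<lambda>y. \<phi> (x - y)) (\<lambda>i y. - D i (x - y))"
  unfolding has_partials_def
proof (intro conjI allI)
  show "continuous_on UNIV (\<lambda>y. \<phi> (x - y))"
    by (rule continuous_on_compose2[OF has_partials_continuous(1)[OF assms, of UNIV]]) (auto intro!: continuous_intros)
  show "continuous_on UNIV (\<lambda>y. - D i (x - y))" for i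
    by (intro continuous_on_minus continuous_on_compose2[OF has_partials_continuous(2)[OF assms, of UNIV]]) (auto intro!: continuous_intros)
  fix i y
  have 1: "((\<lambda>t. \<phi> ((x - y) + t *\<^sub>R axis i 1)) has_real_derivative D i (x - y)) (at (- 0))"
    using assms unfolding has_partials_def by simp
  have "((\<lambda>t::real. - t) has_real_derivative -1) (at 0)" by (auto intro!: derivative_eq_intros)
  from DERIV_chain2[OF 1 this]
  show "((\<lambda>t. \<phi> (x - (y + t *\<^sub>R axis i 1))) has_real_derivative - D i (x - y)) (at 0)"
    by (simp add: algebra_simps)
qed

lemma conv_eq:
  assumes "\<psi> \<in> borel_measurable borel" "w \<in> borel_measurable borel"
  shows "conv \<psi> w x = (LINT z|lborel. \<psi> z * w (x - z))"
proof -
  have [measurable]: "\<psi> \<in> borel_measurable borel" "w \<in> borel_measurable borel" by fact+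
  have "(\<lambda>z. \<psi> z * w (x - z)) \<in> borel_measurable borel" by measurable
  from integral_lborel_reflect[OF this, of x] show ?thesis by (simp add: conv_def)
qed

lemma conv_continuous:
  assumes p: "has_partials \<psi> D" "bsupp \<psi>" and w: "w \<in> borel_measurable borel" "\<And>x. \<bar>w x\<bar> \<le> B"
  shows "continuous_on UNIV (conv \<psi> w)"
proof -
  obtain C where C: "C > 0" "\<And>w. (LINT z|lborel. \<bar>\<psi> (z + w) - \<psi> z\<bar>) \<le> C * norm w"
    using translation_L1_Lipschitz[OF p] by blast
  have B: "B \<ge> 0" using w(2)[of undefined] by linarith
  have "\<bar>conv \<psi> w x - conv \<psi> w y\<bar> \<le> B * C * norm (x - y)" for x y
    using dilated_average_Lipschitz[OF C(2) has_partials_continuous(1)[OF p(1)] p(2) w, of 1 x y]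
    by (simp add: conv_eq[OF has_partials_measurable(1)[OF p(1)] w(1)])
  then have "(B * C)-lipschitz_on UNIV (conv \<psi> w)"
    using B C by (intro lipschitz_onI) (auto simp: dist_norm)
  then show ?thesis by (rule lipschitz_on_continuous_on)
qed

lemma conv_bound:
  fixes \<psi> :: "real^'n::finite \<Rightarrow> real"
  assumes p: "continuous_on UNIV \<psi>" "bsupp \<psi>" and nn: "\<And>x. \<psi> x \<ge> 0" and one: "(LINT x|lborel. \<psi> x) = 1"
    and w: "w \<in> borel_measurable borel" "\<And>x. \<bar>w x\<bar> \<le> B"
  shows "\<bar>conv \<psi> w x\<bar> \<le> B"
proof -
  have "\<bar>conv \<psi> w x\<bar> \<le> B * (LINT y|lborel. \<bar>\<psi> (x - y)\<bar>)"
    unfolding conv_def by (rule integrable_mult_bounded(3)[OF integrable_reflect_bsupp[OF p]]) (use w in auto)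
  also have "(LINT y|lborel. \<bar>\<psi> (x - y)\<bar>) = (LINT y|lborel. \<psi> (x - y))" using nn by simp
  also have "\<dots> = 1" using one integral_lborel_reflect[OF borel_measurable_continuous_onI[OF p(1)]] by simp
  finally show ?thesis by simp
qed

lemma conv_approx:
  fixes \<psi> :: "real^'n::finite \<Rightarrow> real"
  assumes p: "continuous_on UNIV \<psi>" "bsupp \<psi>" and nn: "\<And>x. \<psi> x \<ge> 0" and one: "(LINT x|lborel. \<psi> x) = 1"
    and small: "\<And>x. norm x \<ge> \<epsilon> \<Longrightarrow> \<psi> x = 0"
    and w: "w \<in> borel_measurable borel" "\<And>x. \<bar>w x\<bar> \<le> B"
    and near: "\<And>y. norm (x - y) < \<epsilon> \<Longrightarrow> \<bar>w y - c\<bar> \<le> \<omega>" and \<omega>: "\<omega> \<ge> 0"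
  shows "\<bar>conv \<psi> w x - c\<bar> \<le> \<omega>"
proof -
  have I: "integrable lborel (\<lambda>y. \<psi> (x - y))" by (rule integrable_reflect_bsupp[OF p])
  have I1: "integrable lborel (\<lambda>y. \<psi> (x - y) * w y)" by (rule integrable_conv[OF p w])
  have one': "(LINT y|lborel. \<psi> (x - y)) = 1"
    using one integral_lborel_reflect[OF borel_measurable_continuous_onI[OF p(1)]] by simp
  have I2: "integrable lborel (\<lambda>y. \<psi> (x - y) * (w y - c))" using I I1 by (simp add: right_diff_distrib)
  have "conv \<psi> w x - c = (LINT y|lborel. \<psi> (x - y) * (w y - c))"
    using I I1 one' by (simp add: conv_def right_diff_distrib)
  also have "\<bar>\<dots>\<bar> \<le> (LINT y|lborel. \<bar>\<psi> (x - y) * (w y - c)\<bar>)" by (rule integral_abs_bound)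
  also have "\<dots> \<le> (LINT y|lborel. \<omega> * \<psi> (x - y))"
  proof (rule integral_mono)
    show "\<bar>\<psi> (x - y) * (w y - c)\<bar> \<le> \<omega> * \<psi> (x - y)" for y
      using near[of y] small[of "x - y"] nn[of "x - y"] \<omega>
      by (cases "norm (x - y) < \<epsilon>") (auto simp: abs_mult mult.commute[of \<omega>] mult_left_mono)
  qed (use I I2 in auto)
  also have "\<dots> = \<omega>" using one' by simp
  finally show ?thesis .
qed

text \<open>The maximum principle needs classical second derivatives, so it is applied to
  mollifications of \<open>u\<close> and of \<open>- u\<close>. Mollifying keeps antiperiodicity,
  turns the equation into a pointwise one, and does not increase the bound \<open>\<gamma>\<close>
  of the right-hand side.\<close>

lemma weak_sol_bound:
  fixes u :: "real^'n::finite \<Rightarrow> real"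
  assumes ws: "weak_sol k d g u G" and d: "d > 0"
    and g: "g \<in> borel_measurable borel" "\<And>x. \<bar>g x\<bar> \<le> \<gamma>"
  shows "\<bar>u p\<bar> \<le> d\<^sup>2 / 8 * \<gamma>"
proof -
  have cu: "continuous_on UNIV u" and ap: "antiper k d u"
    using ws unfolding weak_sol_def by auto
  obtain B where B: "\<And>x. \<bar>u x\<bar> \<le> B" using ws unfolding weak_sol_def by blast
  have um: "u \<in> borel_measurable borel" by (rule borel_measurable_continuous_onI[OF cu])
  have wd: "(LINT x|lborel. u x * D i x) = - (LINT x|lborel. G i x * \<phi> x)"
    and we: "(\<Sum>i\<in>UNIV. LINT x|lborel. G i x * D i x) = (LINT x|lborel. g x * \<phi> x)"
    if "has_partials \<phi> D" "bsupp \<phi>" for \<phi> D i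
    using ws that unfolding weak_sol_def by blast+
  have \<gamma>: "\<gamma> \<ge> 0" using g(2)[of undefined] by linarith
  have "\<bar>u p\<bar> \<le> d\<^sup>2 / 8 * \<gamma> + e" if e: "e > 0" for e
  proof -
    \<comment> \<open>The mollification radius may depend on \<open>p\<close> and \<open>e\<close>,
      because the bound from the maximum principle does not depend on the radius.\<close>
    have "isCont u p" using cu by (simp add: continuous_on_eq_continuous_at)
    then obtain \<epsilon> where \<epsilon>: "\<epsilon> > 0" "\<And>y. dist y p < \<epsilon> \<Longrightarrow> dist (u y) (u p) < e"
      using e unfolding continuous_at_eps_delta by blast
    obtain \<eta> :: "real^'n \<Rightarrow> real"
      where \<eta>: "smooth_fun \<eta>" "\<And>x. \<eta> x \<ge> 0" "\<And>x. norm x \<ge> \<epsilon> \<Longrightarrow> \<eta> x = 0" "bsupp \<eta>" "(LINT x|lborel. \<eta> x) = 1"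
      using mollifier_exists[OF \<epsilon>(1)] by blast
    define D where "D i = iter_pderiv [i] \<eta>" for i
    define E where "E i = iter_pderiv [i, i] \<eta>" for i
    have p0: "has_partials \<eta> D"
      using smooth_fun_has_partials[OF \<eta>(1), of "[]"] by (simp add: D_def[abs_def])
    have p1: "has_partials (D i) (\<lambda>j. iter_pderiv [j, i] \<eta>)" for i
      using smooth_fun_has_partials[OF \<eta>(1), of "[i]"] by (simp add: D_def)
    have s1: "bsupp (D i)" "bsupp (E i)" for i
      unfolding D_def E_def by (rule bsupp_iter_pderiv[OF \<eta>(1,4)])+
    have c0: "continuous_on UNIV \<eta>" by (rule has_partials_continuous[OF p0])
    define v where "v = conv \<eta> u"
    have vB: "\<bar>v x\<bar> \<le> B" for x
      unfolding v_def by (rule conv_bound[OF c0 \<eta>(4,2,5) um B])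
    have v0: "\<bar>v p - u p\<bar> \<le> e"
      unfolding v_def
      by (rule conv_approx[OF c0 \<eta>(4,2,5,3) um B]) (use \<epsilon>(2) e in \<open>auto simp: dist_norm norm_minus_commute less_imp_le\<close>)
    \<comment> \<open>Of the two derivatives on \<open>\<eta>\<close>, one is moved to
      \<open>u\<close> by the definition of \<open>G\<close>, and the other is absorbed by the
      equation tested with the reflected mollifier. Reflection changes the sign of each first
      derivative.\<close>
    have lapl: "(\<Sum>i\<in>UNIV. conv (E i) u x) = - conv \<eta> g x" for x
    proof -
      have "conv (E i) u x = (LINT y|lborel. G i y * D i (x - y))" for i
        using wd[OF has_partials_reflect[OF p1[of i], of x] bsupp_reflect[OF s1(1)[of i], of x], of i]
        by (simp add: conv_def E_def mult.commute)
      then have "(\<Sum>i\<in>UNIV. conv (E i) u x) = (\<Sum>i\<in>UNIV. LINT y|lborel. G i y * D i (x - y))" by simp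
      also have "\<dots> = - conv \<eta> g x"
        using we[OF has_partials_reflect[OF p0, of x] bsupp_reflect[OF \<eta>(4), of x]]
        by (simp add: conv_def mult.commute sum_negf)
      finally show ?thesis .
    qed
    have gb: "\<bar>conv \<eta> g x\<bar> \<le> \<gamma>" for x by (rule conv_bound[OF c0 \<eta>(4,2,5) g])
    have cv: "continuous_on UNIV v" unfolding v_def by (rule conv_continuous[OF p0 \<eta>(4) um B])
    have dv: "((\<lambda>t. v (x + t *\<^sub>R axis i 1)) has_real_derivative conv (D i) u x) (at 0)" for i x
      unfolding v_def by (rule conv_has_partial[OF p0 \<eta>(4) um B])
    have ddv: "((\<lambda>t. conv (D i) u (x + t *\<^sub>R axis i 1)) has_real_derivative conv (E i) u x) (at 0)" for i x
      unfolding E_def by (rule conv_has_partial[OF p1 s1(1) um B])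
    have apv: "antiper k d v"
      unfolding antiper_def
    proof
      fix x
      have [measurable]: "\<eta> \<in> borel_measurable borel" "u \<in> borel_measurable borel"
        using um has_partials_measurable[OF p0] by auto
      have "v (x + d *\<^sub>R axis k 1) = (LINT y|lborel. \<eta> (x + d *\<^sub>R axis k 1 - (y + d *\<^sub>R axis k 1)) * u (y + d *\<^sub>R axis k 1))"
        unfolding v_def conv_def by (rule integral_lborel_translate[symmetric]) measurable
      also have "\<dots> = - v x"
        using ap unfolding antiper_def by (simp add: v_def conv_def)
      finally show "v (x + d *\<^sub>R axis k 1) = - v x" .
    qed
    have "v p \<le> d\<^sup>2 / 8 * \<gamma>"
    proof (rule antiperiodic_maximum_principle[OF d cv dv ddv _ apv _ \<gamma>])
      show "v x \<le> B" for x using vB[of x] by linarith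
      show "- \<gamma> \<le> (\<Sum>i\<in>UNIV. conv (E i) u x)" for x using gb[of x] unfolding lapl by linarith
    qed
    moreover have "- v p \<le> d\<^sup>2 / 8 * \<gamma>"
    proof (rule antiperiodic_maximum_principle[OF d _ DERIV_minus[OF dv] DERIV_minus[OF ddv] _ _ _ \<gamma>])
      show "continuous_on UNIV (\<lambda>x. - v x)" by (intro continuous_on_minus cv)
      show "- v x \<le> B" for x using vB[of x] by linarith
      show "- \<gamma> \<le> (\<Sum>i\<in>UNIV. - conv (E i) u x)" for x
        using gb[of x] lapl[of x] by (simp add: sum_negf)
      show "antiper k d (\<lambda>x. - v x)" using apv by (simp add: antiper_def)
    qed
    ultimately show ?thesis using v0 by linarith
  qed
  then show ?thesis by (rule field_le_epsilon)
qed

section \<open>Solving the Poisson equation\<close>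

text \<open>Exponents start at 2, so that the one-sided derivatives at 0 agree and the derivative is
  continuous.\<close>

lemma max_power_has_derivative:
  "((\<lambda>t::real. max 0 t ^ Suc (Suc m)) has_real_derivative real (Suc (Suc m)) * max 0 t ^ Suc m) (at t)"
proof (cases t "0::real" rule: linorder_cases)
  case less
  have "((\<lambda>t::real. max 0 t ^ Suc (Suc m)) has_real_derivative 0) (at t)"
    by (rule has_field_derivative_transform_within_open[where f="\<lambda>_. 0" and S="{..<0}"]) (use less in auto)
  then show ?thesis using less by simp
next
  case greater
  have "((\<lambda>t::real. t ^ Suc (Suc m)) has_real_derivative real (Suc (Suc m)) * t ^ Suc m) (at t)"
    by (rule derivative_eq_intros refl)+ simp
  then have "((\<lambda>t::real. max 0 t ^ Suc (Suc m)) has_real_derivative real (Suc (Suc m)) * t ^ Suc m) (at t)"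
    by (rule has_field_derivative_transform_within_open[where S="{0<..}"]) (use greater in auto)
  then show ?thesis using greater by simp
next
  case equal
  have "((\<lambda>h::real. max 0 h * max 0 h ^ m) \<longlongrightarrow> max 0 0 * max 0 0 ^ m) (at 0)"
    by (intro tendsto_intros)
  then have "((\<lambda>h::real. max 0 h * max 0 h ^ m) \<longlongrightarrow> 0) (at 0)" by simp
  moreover have "\<forall>\<^sub>F h in at 0. max 0 h * max 0 h ^ m = (max 0 (0 + h) ^ Suc (Suc m) - max 0 0 ^ Suc (Suc m)) / (h::real)"
    unfolding eventually_at_filter by (rule always_eventually) (auto simp: max_def)
  ultimately have "((\<lambda>h::real. (max 0 (0 + h) ^ Suc (Suc m) - max 0 0 ^ Suc (Suc m)) / h) \<longlongrightarrow> 0) (at 0)"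
    by (rule Lim_transform_eventually)
  then show ?thesis using equal by (simp add: DERIV_def)
qed

lemma has_partials_ball_power:
  fixes c :: real
  shows "has_partials (\<lambda>z::real^'n::finite. c * max 0 (1 - (norm z)\<^sup>2) ^ Suc (Suc m))
     (\<lambda>i z. - z $ i * (2 * c * real (Suc (Suc m)) * max 0 (1 - (norm z)\<^sup>2) ^ Suc m))"
  unfolding has_partials_def
proof (intro conjI allI)
  show "continuous_on UNIV (\<lambda>z::real^'n. c * max 0 (1 - (norm z)\<^sup>2) ^ Suc (Suc m))"
    by (intro continuous_intros)
  show "continuous_on UNIV (\<lambda>z::real^'n. - z $ i * (2 * c * real (Suc (Suc m)) * max 0 (1 - (norm z)\<^sup>2) ^ Suc m))" for i
    by (intro continuous_intros)
  fix i and x :: "real^'n"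
  have eq: "1 - (norm (x + t *\<^sub>R axis i 1))\<^sup>2 = 1 - ((norm x)\<^sup>2 + 2 * t * x $ i + t\<^sup>2)" for t
    by (simp only: power2_norm_eq_inner)
       (simp add: inner_add_left inner_add_right inner_commute[of "axis i 1"] inner_axis power2_eq_square algebra_simps)
  have "((\<lambda>t. 1 - (norm (x + t *\<^sub>R axis i 1))\<^sup>2) has_real_derivative - 2 * x $ i) (at 0)"
    unfolding eq by (auto intro!: derivative_eq_intros)
  from DERIV_cmult[OF DERIV_chain2[OF max_power_has_derivative this, of m], of c]
  show "((\<lambda>t. c * max 0 (1 - (norm (x + t *\<^sub>R axis i 1))\<^sup>2) ^ Suc (Suc m)) has_real_derivative
      - x $ i * (2 * c * real (Suc (Suc m)) * max 0 (1 - (norm x)\<^sup>2) ^ Suc m)) (at 0)"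
    by (simp add: algebra_simps)
qed

text \<open>With q the positive part of 1 - |z|^2, the gradient of q^3 is -6 q^2 z. Thus a multiple
  of q^2, normalised to mass one, serves as \<open>\<rho>\<close>, and one sixth of the same
  multiple of q^3 serves as \<open>\<kappa>\<close>.\<close>

lemma kernel_exists:
  obtains \<rho> \<kappa> :: "real^'n::finite \<Rightarrow> real" and D\<rho>
  where "has_partials \<rho> D\<rho>" "has_partials \<kappa> (\<lambda>i z. - (z $ i * \<rho> z))" "bsupp \<rho>" "bsupp \<kappa>"
    "(LINT z|lborel. \<rho> z) = 1"
proof -
  define q where "q z = max 0 (1 - (norm z)\<^sup>2)" for z :: "real^'n"
  have supp: "bsupp (\<lambda>z. c * q z ^ Suc (Suc m))" for c m
    unfolding bsupp_def
  proof (intro exI[of _ 1] allI impI)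
    fix z :: "real^'n" assume "norm z > 1"
    then have "(norm z)\<^sup>2 \<ge> 1" by (simp add: one_le_power)
    then show "c * q z ^ Suc (Suc m) = 0" by (simp add: q_def)
  qed
  have hp: "has_partials (\<lambda>z. c * q z ^ Suc (Suc m)) (\<lambda>i z. - z $ i * (2 * c * real (Suc (Suc m)) * q z ^ Suc m))" for c m
    unfolding q_def by (rule has_partials_ball_power)
  have pos: "(LINT z|lborel. 1 * q z ^ Suc (Suc 0)) > 0"
    by (rule integral_pos_of_continuous[OF has_partials_continuous(1)[OF hp] supp]) (auto simp: q_def)
  define c where "c = 1 / (LINT z|lborel. 1 * q z ^ Suc (Suc 0))"
  show ?thesis
  proof (rule that[OF hp[of c 0] _ supp supp])
    have eq: "2 * (c / 6) * real (Suc (Suc 1)) * q z ^ Suc 1 = c * q z ^ Suc (Suc 0)" for z by simp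
    show "has_partials (\<lambda>z. c / 6 * q z ^ Suc (Suc 1)) (\<lambda>i z. - (z $ i * (c * q z ^ Suc (Suc 0))))"
      using hp[of "c / 6" 1] unfolding eq by simp
    show "(LINT z|lborel. c * q z ^ Suc (Suc 0)) = 1" using pos by (simp add: c_def)
  qed
qed

lemma has_partials_coordinate: "has_partials (\<lambda>z. z $ i) (\<lambda>j z. of_bool (j = i))"
  unfolding has_partials_def by (auto intro!: continuous_intros derivative_eq_intros simp: axis_def)

section \<open>Averages at a given scale and their antiperiodic fixed points\<close>

definition avg :: "(real^'n::finite \<Rightarrow> real) \<Rightarrow> real \<Rightarrow> (real^'n \<Rightarrow> real) \<Rightarrow> real^'n \<Rightarrow> real" where
  "avg \<psi> r h x = (LINT z|lborel. \<psi> z * h (x - r *\<^sub>R z))"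

lemma integrable_avg:
  fixes \<psi> h :: "real^'n::finite \<Rightarrow> real"
  assumes psi: "continuous_on UNIV \<psi>" "bsupp \<psi>" and h [measurable]: "h \<in> borel_measurable borel" and B: "\<And>x. \<bar>h x\<bar> \<le> B"
  shows "integrable lborel (\<lambda>z. \<psi> z * h (x - r *\<^sub>R z))" "\<bar>avg \<psi> r h x\<bar> \<le> B * (LINT z|lborel. \<bar>\<psi> z\<bar>)"
proof -
  have m: "(\<lambda>z. h (x - r *\<^sub>R z)) \<in> borel_measurable lborel" by measurable
  show "integrable lborel (\<lambda>z. \<psi> z * h (x - r *\<^sub>R z))"
    by (rule integrable_mult_bounded(1)[OF integrable_bsupp[OF psi] m]) (rule B)
  show "\<bar>avg \<psi> r h x\<bar> \<le> B * (LINT z|lborel. \<bar>\<psi> z\<bar>)"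
    unfolding avg_def by (rule integrable_mult_bounded(3)[OF integrable_bsupp[OF psi] m]) (rule B)
qed

lemma avg_antiper:
  assumes "antiper k d h"
  shows "antiper k d (avg \<psi> r h)"
proof -
  have "h (x + d *\<^sub>R axis k 1 - r *\<^sub>R z) = - h (x - r *\<^sub>R z)" for x z
  proof -
    have "x + d *\<^sub>R axis k 1 - r *\<^sub>R z = (x - r *\<^sub>R z) + d *\<^sub>R axis k 1" by simp
    then show ?thesis using assms unfolding antiper_def by metis
  qed
  then show ?thesis unfolding antiper_def avg_def by simp
qed

text \<open>As \<open>g\<close> may be discontinuous, the iteration runs on the correction w = h -
  g, which satisfies w = A(g + w). Averages are Lipschitz, so it takes place in the complete space
  of bounded continuous functions.\<close>

lemma antiper_fixpoint_exists:
  fixes \<rho> g :: "real^'n::finite \<Rightarrow> real"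
  assumes p: "has_partials \<rho> D" "bsupp \<rho>"
    and d: "d > 0" and g: "g \<in> borel_measurable borel" "\<And>x. \<bar>g x\<bar> \<le> \<gamma>" "antiper k d g"
  obtains R h B where "R > 0" "h \<in> borel_measurable borel" "\<And>x. \<bar>h x\<bar> \<le> B" "antiper k d h"
    "\<And>x. h x = g x + avg \<rho> R h x"
proof -
  obtain C where C: "C > 0" "\<And>w. (LINT z|lborel. \<bar>\<rho> (z + w) - \<rho> z\<bar>) \<le> C * norm w"
    using translation_L1_Lipschitz[OF p] by blast
  have c0: "continuous_on UNIV \<rho>" by (rule has_partials_continuous[OF p(1)])
  \<comment> \<open>At this scale the Lipschitz bound \<open>B * C / R\<close> over a shift of
    length \<open>d\<close> is exactly \<open>B\<close>.\<close>
  define R where "R = C * d"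
  have R: "R > 0" using C d by (simp add: R_def)
  have lip: "\<bar>avg \<rho> R h x - avg \<rho> R h y\<bar> \<le> B * C * norm (x - y) / R"
    if "h \<in> borel_measurable borel" "\<And>x. \<bar>h x\<bar> \<le> B" for h B x y
    unfolding avg_def by (rule dilated_average_Lipschitz[OF C(2) c0 p(2) that R])
  \<comment> \<open>The averages at distance \<open>d\<close> differ by at most \<open>B\<close>, and they are negatives of each other.\<close>
  have half: "\<bar>avg \<rho> R h x\<bar> \<le> B / 2"
    if h: "h \<in> borel_measurable borel" "\<And>x. \<bar>h x\<bar> \<le> B" "antiper k d h" for h B x
  proof -
    have "\<bar>avg \<rho> R h (x + d *\<^sub>R axis k 1) - avg \<rho> R h x\<bar> \<le> B * C * norm ((x + d *\<^sub>R axis k 1) - x) / R"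
      by (rule lip) (use h in auto)
    also have "\<dots> = B" using C d by (simp add: R_def)
    finally show ?thesis using avg_antiper[OF h(3), of \<rho> R] unfolding antiper_def by auto
  qed
  have cont: "continuous_on UNIV (avg \<rho> R h)"
    if h: "h \<in> borel_measurable borel" "\<And>x. \<bar>h x\<bar> \<le> B" for h B
  proof -
    have B: "B \<ge> 0" using h(2)[of undefined] by linarith
    have "(B * C / R)-lipschitz_on UNIV (avg \<rho> R h)"
      using B C R lip[OF h] by (intro lipschitz_onI) (auto simp: dist_norm)
    then show ?thesis by (rule lipschitz_on_continuous_on)
  qed
  \<comment> \<open>The contraction factor 1/2 comes from \<open>half\<close> and holds for
    antiperiodic functions only, so the iteration is confined to this closed subspace.\<close>
  define S where "S = {w :: (real^'n) \<Rightarrow>\<^sub>C real. antiper k d (apply_bcontfun w)}"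
  define \<Phi> where "\<Phi> w = Bcontfun (avg \<rho> R (\<lambda>x. g x + apply_bcontfun w x))" for w
  have wm: "apply_bcontfun w \<in> borel_measurable borel" for w :: "(real^'n) \<Rightarrow>\<^sub>C real"
    by (intro borel_measurable_continuous_onI) simp
  have wb: "\<bar>apply_bcontfun w x\<bar> \<le> norm w" for w :: "(real^'n) \<Rightarrow>\<^sub>C real" and x
    using norm_bounded[of w x] by simp
  have gw: "(\<lambda>x. g x + apply_bcontfun w x) \<in> borel_measurable borel" "\<bar>g x + apply_bcontfun w x\<bar> \<le> \<gamma> + norm w" for w :: "(real^'n) \<Rightarrow>\<^sub>C real" and x
    using g(1) wm[of w] g(2)[of x] wb[of w x] by auto
  have \<Phi>: "apply_bcontfun (\<Phi> w) = avg \<rho> R (\<lambda>x. g x + apply_bcontfun w x)" for w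
    unfolding \<Phi>_def
  proof (rule Bcontfun_inverse, rule bcontfun_normI)
    show "continuous_on UNIV (avg \<rho> R (\<lambda>x. g x + apply_bcontfun w x))" by (rule cont[OF gw])
    show "norm (avg \<rho> R (\<lambda>x. g x + apply_bcontfun w x) x) \<le> (\<gamma> + norm w) * (LINT z|lborel. \<bar>\<rho> z\<bar>)" for x
      using integrable_avg(2)[OF c0 p(2) gw] by simp
  qed
  have Iw: "integrable lborel (\<lambda>z. \<rho> z * (g (x - R *\<^sub>R z) + apply_bcontfun w (x - R *\<^sub>R z)))" for w x
    by (rule integrable_avg(1)[OF c0 p(2) gw])
  have "\<exists>!w\<in>S. \<Phi> w = w"
  proof (rule Banach_fix[where c="1/2"])
    have "closed S"
      unfolding closed_sequential_limits
    proof (intro allI impI, elim conjE)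
      fix f l assume f: "\<forall>n. f n \<in> S" and l: "f \<longlonglongrightarrow> l"
      have lim: "(\<lambda>n. apply_bcontfun (f n) x) \<longlonglongrightarrow> apply_bcontfun l x" for x
        using tendsto_uniform_limitI[OF tendsto_bcontfun_uniform_limit[OF l]] by simp
      show "l \<in> S" unfolding S_def antiper_def
      proof (rule CollectI, rule allI)
        fix x
        have "(\<lambda>n. apply_bcontfun (f n) (x + d *\<^sub>R axis k 1)) = (\<lambda>n. - apply_bcontfun (f n) x)"
          using f by (auto simp: S_def antiper_def)
        then show "apply_bcontfun l (x + d *\<^sub>R axis k 1) = - apply_bcontfun l x"
          using lim[of "x + d *\<^sub>R axis k 1"] tendsto_minus[OF lim[of x]] LIMSEQ_unique by metis
      qed
    qed
    then show "complete S" by (simp add: complete_eq_closed)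
    have "0 \<in> S" by (simp add: S_def antiper_def)
    then show "S \<noteq> {}" by blast
    show "\<Phi> ` S \<subseteq> S"
    proof
      fix y assume "y \<in> \<Phi> ` S"
      then obtain w where w: "w \<in> S" "y = \<Phi> w" by blast
      have "antiper k d (\<lambda>x. g x + apply_bcontfun w x)"
        using w(1) g(3) by (simp add: S_def antiper_def)
      then show "y \<in> S" unfolding w S_def by (simp add: \<Phi> avg_antiper)
    qed
    fix w1 w2 assume w: "w1 \<in> S" "w2 \<in> S"
    show "dist (\<Phi> w1) (\<Phi> w2) \<le> 1 / 2 * dist w1 w2"
    proof (rule dist_bound)
      fix x
      have "apply_bcontfun (\<Phi> w1) x - apply_bcontfun (\<Phi> w2) x = avg \<rho> R (\<lambda>x. apply_bcontfun w1 x - apply_bcontfun w2 x) x"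
        unfolding \<Phi> avg_def
        using Iw by (subst Bochner_Integration.integral_diff[symmetric]) (auto simp: algebra_simps)
      also have "\<bar>\<dots>\<bar> \<le> dist w1 w2 / 2"
      proof (rule half)
        show "(\<lambda>x. apply_bcontfun w1 x - apply_bcontfun w2 x) \<in> borel_measurable borel" using wm[of w1] wm[of w2] by simp
        show "\<bar>apply_bcontfun w1 x - apply_bcontfun w2 x\<bar> \<le> dist w1 w2" for x
          using dist_bounded[of w1 x w2] by (simp add: dist_norm)
        show "antiper k d (\<lambda>x. apply_bcontfun w1 x - apply_bcontfun w2 x)"
          using w by (simp add: S_def antiper_def)
      qed
      finally show "dist (apply_bcontfun (\<Phi> w1) x) (apply_bcontfun (\<Phi> w2) x) \<le> 1 / 2 * dist w1 w2"
        by (simp add: dist_norm)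
    qed
  qed auto
  then obtain w where w: "w \<in> S" "\<Phi> w = w" by blast
  show ?thesis
  proof (rule that[OF R gw(1)[of w] gw(2)])
    show "antiper k d (\<lambda>x. g x + apply_bcontfun w x)"
      using w(1) g(3) by (simp add: S_def antiper_def)
    show "g x + apply_bcontfun w x = g x + avg \<rho> R (\<lambda>x. g x + apply_bcontfun w x) x" for x
      using \<Phi>[of w] w(2) by simp
  qed
qed

section \<open>Potentials as integrals over scales and kernel variables\<close>

abbreviation prodM :: "(real \<times> (real^'n::finite)) measure" where
  "prodM \<equiv> lborel \<Otimes>\<^sub>M lborel"

text \<open>A single integral over the product, so that one use of
  \<open>integral_shift_average\<close> yields the adjoint. The weight \<open>a\<close> will be r on
  [0, R] for the solution and 1 on [0, R] for its gradient.\<close>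

definition pot :: "(real \<Rightarrow> real) \<Rightarrow> (real^'n::finite \<Rightarrow> real) \<Rightarrow> (real^'n \<Rightarrow> real) \<Rightarrow> real^'n \<Rightarrow> real" where
  "pot a \<psi> h x = (LINT p|prodM. (a (fst p) * \<psi> (snd p)) * h (x - fst p *\<^sub>R snd p))"

lemma integrable_prodM:
  fixes \<psi> :: "real^'n::finite \<Rightarrow> real"
  assumes a: "integrable lborel a" and psi: "integrable lborel \<psi>"
  shows "integrable prodM (\<lambda>p. a (fst p) * \<psi> (snd p))"
proof (rule lborel_pair.Fubini_integrable)
  have [measurable]: "a \<in> borel_measurable borel" "\<psi> \<in> borel_measurable borel"
    using a psi by (auto dest: borel_measurable_integrable)
  show "(\<lambda>p. a (fst p) * \<psi> (snd p)) \<in> borel_measurable prodM" by measurable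
  show "integrable lborel (\<lambda>r. LINT z|lborel. norm (a (fst (r, z)) * \<psi> (snd (r, z))))"
    using a by (simp add: abs_mult)
  show "AE r in lborel. integrable lborel (\<lambda>z. a (fst (r, z)) * \<psi> (snd (r, z)))"
    using psi by simp
qed

text \<open>The factor \<open>c\<close> is -1 for the potential itself and 1 for its adjoint, which
  acts on test functions.\<close>

lemma integrable_prodM_mult:
  fixes \<psi> :: "real^'n::finite \<Rightarrow> real"
  assumes a: "integrable lborel a" and psi: "integrable lborel \<psi>"
    and h [measurable]: "h \<in> borel_measurable borel" and B: "\<And>x. \<bar>h x\<bar> \<le> B"
  shows "integrable prodM (\<lambda>p. (a (fst p) * \<psi> (snd p)) * h (x + (c * fst p) *\<^sub>R snd p))"
    "(LINT p|prodM. (a (fst p) * \<psi> (snd p)) * h (x + (c * fst p) *\<^sub>R snd p)) =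
       (LINT r|lborel. a r * (LINT z|lborel. \<psi> z * h (x + (c * r) *\<^sub>R z)))"
    "(LINT p|prodM. (a (fst p) * \<psi> (snd p)) * h (x + (c * fst p) *\<^sub>R snd p)) =
       (LINT z|lborel. \<psi> z * (LINT r|lborel. a r * h (x + (c * r) *\<^sub>R z)))"
proof -
  have m: "(\<lambda>p::real \<times> (real^'n). h (x + (c * fst p) *\<^sub>R snd p)) \<in> borel_measurable prodM" by measurable
  show I: "integrable prodM (\<lambda>p. (a (fst p) * \<psi> (snd p)) * h (x + (c * fst p) *\<^sub>R snd p))"
    by (rule integrable_mult_bounded(1)[OF integrable_prodM[OF a psi] m]) (rule B)
  show "(LINT p|prodM. (a (fst p) * \<psi> (snd p)) * h (x + (c * fst p) *\<^sub>R snd p)) =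
       (LINT r|lborel. a r * (LINT z|lborel. \<psi> z * h (x + (c * r) *\<^sub>R z)))"
    using lborel_pair.integral_fst'[OF I] by (simp add: mult.assoc)
  have I': "integrable prodM (case_prod (\<lambda>r z. (a r * \<psi> z) * h (x + (c * r) *\<^sub>R z)))"
    using I by (simp add: case_prod_beta')
  show "(LINT p|prodM. (a (fst p) * \<psi> (snd p)) * h (x + (c * fst p) *\<^sub>R snd p)) =
       (LINT z|lborel. \<psi> z * (LINT r|lborel. a r * h (x + (c * r) *\<^sub>R z)))"
    using lborel_pair.integral_snd[OF I'] by (simp add: case_prod_beta' mult.assoc mult.left_commute[of "a _" "\<psi> _"])
qed

context
  fixes a :: "real \<Rightarrow> real" and \<psi> h :: "real^'n::finite \<Rightarrow> real" and D B
  assumes a: "integrable lborel a" "\<And>r. r < 0 \<Longrightarrow> a r = 0" and p: "has_partials \<psi> D" "bsupp \<psi>"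
    and h: "h \<in> borel_measurable borel" "\<And>x. \<bar>h x\<bar> \<le> B"
begin

lemma pot_eq: "pot a \<psi> h x = (LINT r|lborel. a r * avg \<psi> r h x)"
proof -
  have "integrable lborel \<psi>" by (rule integrable_bsupp[OF has_partials_continuous(1)[OF p(1)] p(2)])
  from integrable_prodM_mult(2)[OF a(1) this h, of x "-1"] show ?thesis
    by (simp add: pot_def avg_def)
qed

lemma pot_bound: "\<bar>pot a \<psi> h x\<bar> \<le> B * (LINT p|prodM. \<bar>a (fst p) * \<psi> (snd p)\<bar>)"
proof -
  have I: "integrable lborel \<psi>" by (rule integrable_bsupp[OF has_partials_continuous(1)[OF p(1)] p(2)])
  have [measurable]: "h \<in> borel_measurable borel" by (rule h)
  have m: "(\<lambda>p::real \<times> (real^'n). h (x - fst p *\<^sub>R snd p)) \<in> borel_measurable prodM" by measurable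
  show ?thesis unfolding pot_def
    by (rule integrable_mult_bounded(3)[OF integrable_prodM[OF a(1) I] m]) (rule h)
qed

lemma pot_antiper:
  assumes "antiper k d h"
  shows "antiper k d (pot a \<psi> h)"
  using avg_antiper[OF assms, of \<psi>] unfolding antiper_def by (simp add: pot_eq)

text \<open>The Lipschitz constant of the averages grows like 1/r, which is not integrable near 0
  against the weight 1. Continuity therefore comes from dominated convergence: the averages converge
  for each fixed positive r and are bounded uniformly in r.\<close>

lemma pot_continuous: "continuous_on UNIV (pot a \<psi> h)"
proof -
  have c: "continuous_on UNIV \<psi>" by (rule has_partials_continuous(1)[OF p(1)])
  obtain C where C: "C > 0" "\<And>w. (LINT z|lborel. \<bar>\<psi> (z + w) - \<psi> z\<bar>) \<le> C * norm w"
    using translation_L1_Lipschitz[OF p] by blast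
  have [measurable]: "h \<in> borel_measurable borel" "\<psi> \<in> borel_measurable borel" "a \<in> borel_measurable borel"
    using h p a has_partials_measurable[OF p(1)] by (auto dest: borel_measurable_integrable)
  have m: "(\<lambda>r. avg \<psi> r h x) \<in> borel_measurable lborel" for x
    unfolding avg_def by measurable
  have "(\<lambda>n. pot a \<psi> h (X n)) \<longlonglongrightarrow> pot a \<psi> h x" if X: "X \<longlonglongrightarrow> x" for X x
    unfolding pot_eq
  proof (rule integral_dominated_convergence)
    show "integrable lborel (\<lambda>r. \<bar>a r\<bar> * (B * (LINT z|lborel. \<bar>\<psi> z\<bar>)))" using a by auto
    show "AE r in lborel. norm (a r * avg \<psi> r h (X n)) \<le> \<bar>a r\<bar> * (B * (LINT z|lborel. \<bar>\<psi> z\<bar>))" for n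
      using integrable_avg(2)[OF c p(2) h] by (intro AE_I2) (auto simp: abs_mult intro!: mult_left_mono)
    \<comment> \<open>Negative scales are removed by \<open>a\<close>, and the scale 0, where the
      Lipschitz estimate fails, is a null set.\<close>
    show "AE r in lborel. (\<lambda>n. a r * avg \<psi> r h (X n)) \<longlonglongrightarrow> a r * avg \<psi> r h x"
      using AE_lborel_singleton[of 0]
    proof eventually_elim
      case (elim r)
      show ?case
      proof (cases "r < 0")
        case False
        then have r: "r > 0" using elim by simp
        have "(\<lambda>n. avg \<psi> r h (X n)) \<longlonglongrightarrow> avg \<psi> r h x"
        proof (rule LIM_zero_cancel, rule Lim_null_comparison)
          show "\<forall>\<^sub>F n in sequentially. norm (avg \<psi> r h (X n) - avg \<psi> r h x) \<le> B * C * norm (X n - x) / r"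
            unfolding avg_def using dilated_average_Lipschitz[OF C(2) c p(2) h r] by simp
          have "(\<lambda>n. B * C * norm (X n - x) / r) \<longlonglongrightarrow> B * C * norm (x - x) / r"
            by (intro tendsto_intros X) (use r in auto)
          then show "(\<lambda>n. B * C * norm (X n - x) / r) \<longlonglongrightarrow> 0" by simp
        qed
        then show ?thesis by (intro tendsto_mult tendsto_const)
      qed (use a in simp)
    qed
  qed (use m in measurable)
  then show ?thesis
    unfolding continuous_on_sequentially by (auto simp: comp_def)
qed

text \<open>Moves the kernel from \<open>h\<close> to \<open>\<phi>\<close>. In the applications
  \<open>\<phi>\<close> is a test function or one of its partials, where integration by parts and
  the fundamental theorem of calculus are available.\<close>

lemma pot_pairing:
  assumes "integrable lborel \<phi>"
  shows "(LINT x|lborel. pot a \<psi> h x * \<phi> x) = (LINT y|lborel. h y * (LINT p|prodM. (a (fst p) * \<psi> (snd p)) * \<phi> (y + fst p *\<^sub>R snd p)))"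
    "integrable lborel (\<lambda>y. h y * (LINT p|prodM. (a (fst p) * \<psi> (snd p)) * \<phi> (y + fst p *\<^sub>R snd p)))"
proof -
  have I: "integrable lborel \<psi>" by (rule integrable_bsupp[OF has_partials_continuous(1)[OF p(1)] p(2)])
  have s: "(\<lambda>p. fst p *\<^sub>R snd p) \<in> measurable (prodM :: (real \<times> (real^'n)) measure) borel" by measurable
  note * = lborel_pair.P.integral_shift_average[OF integrable_prodM[OF a(1) I] s h assms]
  show "(LINT x|lborel. pot a \<psi> h x * \<phi> x) = (LINT y|lborel. h y * (LINT p|prodM. (a (fst p) * \<psi> (snd p)) * \<phi> (y + fst p *\<^sub>R snd p)))"
    using *(1) by (simp add: pot_def)
  show "integrable lborel (\<lambda>y. h y * (LINT p|prodM. (a (fst p) * \<psi> (snd p)) * \<phi> (y + fst p *\<^sub>R snd p)))"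
    using *(2) .
qed

end

lemma has_partials_dilate:
  assumes "has_partials \<phi> D"
  shows "has_partials (\<lambda>z. \<phi> (y + r *\<^sub>R z)) (\<lambda>i z. r * D i (y + r *\<^sub>R z))"
  unfolding has_partials_def
proof (intro conjI allI)
  show "continuous_on UNIV (\<lambda>z. \<phi> (y + r *\<^sub>R z))"
    by (rule continuous_on_compose2[OF has_partials_continuous(1)[OF assms, of UNIV]]) (auto intro!: continuous_intros)
  show "continuous_on UNIV (\<lambda>z. r * D i (y + r *\<^sub>R z))" for i
    by (intro continuous_on_mult continuous_on_const continuous_on_compose2[OF has_partials_continuous(2)[OF assms, of UNIV]]) (auto intro!: continuous_intros)
  fix i z
  have 1: "((\<lambda>t. \<phi> ((y + r *\<^sub>R z) + t *\<^sub>R axis i 1)) has_real_derivative D i (y + r *\<^sub>R z)) (at (r * 0))"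
    using assms unfolding has_partials_def by simp
  have "((\<lambda>t::real. r * t) has_real_derivative r) (at 0)" by (auto intro!: derivative_eq_intros)
  from DERIV_chain2[OF 1 this]
  show "((\<lambda>t. \<phi> (y + r *\<^sub>R (z + t *\<^sub>R axis i 1))) has_real_derivative r * D i (y + r *\<^sub>R z)) (at 0)"
    by (simp add: algebra_simps)
qed

text \<open>Both weak identities are verified on the test side. The one for \<open>G\<close> is
  integration by parts in z; the equation is the fundamental theorem of calculus along the rays from
  y to y + Rz, averaged against \<open>\<rho>\<close>. The leftover average of \<open>h\<close> is
  removed by the fixed point equation.\<close>

lemma weak_sol_exists:
  fixes g :: "real^'n::finite \<Rightarrow> real"
  assumes d: "d > 0" and g: "g \<in> borel_measurable borel" "\<And>x. \<bar>g x\<bar> \<le> \<gamma>" "antiper k d g"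
  shows "\<exists>u G. weak_sol k d g u G"
proof -
  obtain \<rho> \<kappa> :: "real^'n \<Rightarrow> real" and D\<rho>
    where p\<rho>: "has_partials \<rho> D\<rho>" and p\<kappa>: "has_partials \<kappa> (\<lambda>i z. - (z $ i * \<rho> z))"
      and s\<rho>: "bsupp \<rho>" and s\<kappa>: "bsupp \<kappa>" and one: "(LINT z|lborel. \<rho> z) = 1"
    by (rule kernel_exists) (rule that)
  obtain R h B where R: "R > 0" and h: "h \<in> borel_measurable borel" "\<And>x. \<bar>h x\<bar> \<le> B"
    and ap: "antiper k d h" and fix_h: "\<And>x. h x = g x + avg \<rho> R h x"
    by (rule antiper_fixpoint_exists[OF p\<rho> s\<rho> d g]) (rule that)
  define a0 :: "real \<Rightarrow> real" where "a0 = indicator {0..R}"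
  define a1 :: "real \<Rightarrow> real" where "a1 r = a0 r * r" for r
  have a0: "integrable lborel a0" "\<And>r. r < 0 \<Longrightarrow> a0 r = 0"
    unfolding a0_def using R by (auto intro!: integrable_real_indicator)
  have a1: "integrable lborel a1" "\<And>r. r < 0 \<Longrightarrow> a1 r = 0"
  proof -
    show "integrable lborel a1"
    proof (rule Bochner_Integration.integrable_bound)
      show "integrable lborel (\<lambda>r. R * a0 r)" using a0 by simp
      show "AE r in lborel. norm (a1 r) \<le> norm (R * a0 r)" using R by (auto simp: a1_def a0_def indicator_def)
    qed (simp add: a1_def[abs_def] a0_def)
  qed (simp add: a1_def a0_def)
  define \<psi> where "\<psi> i z = z $ i * \<rho> z" for i z
  define D\<psi> where "D\<psi> i j z = of_bool (j = i) * \<rho> z + z $ i * D\<rho> j z" for i j z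
  have p\<psi>: "has_partials (\<psi> i) (D\<psi> i)" for i
    unfolding \<psi>_def[abs_def] D\<psi>_def[abs_def] by (rule has_partials_mult[OF has_partials_coordinate p\<rho>])
  have s\<psi>: "bsupp (\<psi> i)" for i unfolding \<psi>_def[abs_def] by (rule bsupp_mult(2)[OF s\<rho>])
  have I\<rho>: "integrable lborel \<rho>" by (rule integrable_bsupp[OF has_partials_continuous(1)[OF p\<rho>] s\<rho>])
  have I\<kappa>: "integrable lborel \<kappa>" by (rule integrable_bsupp[OF has_partials_continuous(1)[OF p\<kappa>] s\<kappa>])
  have I\<psi>: "integrable lborel (\<psi> i)" for i by (rule integrable_bsupp[OF has_partials_continuous(1)[OF p\<psi>] s\<psi>])
  \<comment> \<open>Differentiating h(x - rz) in x amounts to -1/r times differentiating in z. The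
    weight r of \<open>u\<close> thus cancels in the gradient, and the derivative falls on
    \<open>\<kappa>\<close>, whose partials are -z_i \<rho>; this is the origin of
    \<open>G\<close>.\<close>
  define u where "u = pot a1 \<kappa> h"
  define G where "G i x = - pot a0 (\<psi> i) h x" for i x
  have "weak_sol k d g u G"
    unfolding weak_sol_def
  proof (intro conjI allI impI, goal_cases)
    case 1 show ?case unfolding u_def by (rule pot_continuous[OF a1 p\<kappa> s\<kappa> h])
  next
    case (2 i) show ?case unfolding G_def by (intro continuous_on_minus pot_continuous[OF a0 p\<psi> s\<psi> h])
  next
    case 3
    define Bu where "Bu = B * (LINT p|prodM. \<bar>a1 (fst p) * \<kappa> (snd p)\<bar>)"
    define BG where "BG i = B * (LINT p|prodM. \<bar>a0 (fst p) * \<psi> i (snd p)\<bar>)" for i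
    have "\<bar>u x\<bar> \<le> Bu" for x unfolding u_def Bu_def by (rule pot_bound[OF a1 p\<kappa> s\<kappa> h])
    moreover have BG: "\<bar>G i x\<bar> \<le> BG i" for i x unfolding G_def BG_def using pot_bound[OF a0 p\<psi> s\<psi> h] by simp
    moreover have "BG i \<le> (\<Sum>i\<in>UNIV. \<bar>BG i\<bar>)" for i
      using member_le_sum[of i UNIV "\<lambda>i. \<bar>BG i\<bar>"] by auto
    moreover have "(\<Sum>i\<in>UNIV. \<bar>BG i\<bar>) \<ge> 0" by (rule sum_nonneg) simp
    ultimately have "\<bar>u x\<bar> \<le> \<bar>Bu\<bar> + (\<Sum>i\<in>UNIV. \<bar>BG i\<bar>)" "\<bar>G i x\<bar> \<le> \<bar>Bu\<bar> + (\<Sum>i\<in>UNIV. \<bar>BG i\<bar>)" for i x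
      by (meson abs_ge_self add_increasing2 order.trans, meson abs_ge_zero add_increasing order.trans)
    then show ?case by blast
  next
    case 4 show ?case unfolding u_def by (rule pot_antiper[OF a1 p\<kappa> s\<kappa> h ap])
  next
    case (5 \<phi> D i)
    then have p: "has_partials \<phi> D" and s: "bsupp \<phi>" by auto
    note c = has_partials_continuous[OF p]
    have I: "integrable lborel \<phi>" "integrable lborel (D i)"
      using c s bsupp_partial[OF p s] by (auto intro!: integrable_bsupp)
    obtain M where M: "\<And>x. \<bar>\<phi> x\<bar> \<le> M" using continuous_bsupp_bounded[OF c(1) s] by blast
    obtain M' where M': "\<And>x. \<bar>D i x\<bar> \<le> M'" using continuous_bsupp_bounded[OF c(2) bsupp_partial[OF p s]] by blast
    have "(LINT p|prodM. (a1 (fst p) * \<kappa> (snd p)) * D i (y + fst p *\<^sub>R snd p)) =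
          (LINT p|prodM. (a0 (fst p) * \<psi> i (snd p)) * \<phi> (y + fst p *\<^sub>R snd p))" for y
    proof -
      \<comment> \<open>The inner factor \<open>r\<close> is the chain rule factor of the dilation;
        it is what distinguishes the weights \<open>a1\<close> and \<open>a0\<close>.\<close>
      have "(LINT z|lborel. \<kappa> z * (r * D i (y + r *\<^sub>R z))) = (LINT z|lborel. \<psi> i z * \<phi> (y + r *\<^sub>R z))" for r
        using integration_by_parts[OF p\<kappa> has_partials_dilate[OF p, of y r] s\<kappa>, of i] by (simp add: \<psi>_def)
      then have "a1 r * (LINT z|lborel. \<kappa> z * D i (y + r *\<^sub>R z)) = a0 r * (LINT z|lborel. \<psi> i z * \<phi> (y + r *\<^sub>R z))" for r
        by (simp add: a1_def mult.left_commute[of "\<kappa> _"])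
      then show ?thesis
        using integrable_prodM_mult(2)[OF a1(1) I\<kappa> has_partials_measurable(2)[OF p] M', of y 1]
          integrable_prodM_mult(2)[OF a0(1) I\<psi> has_partials_measurable(1)[OF p] M, of i y 1] by simp
    qed
    then show ?case
      unfolding u_def G_def using pot_pairing(1)[OF a1 p\<kappa> s\<kappa> h I(2)] pot_pairing(1)[OF a0 p\<psi> s\<psi> h I(1)]
      by simp
  next
    case (6 \<phi> D)
    then have p: "has_partials \<phi> D" and s: "bsupp \<phi>" by auto
    note c = has_partials_continuous[OF p]
    have I: "integrable lborel \<phi>" "\<And>i. integrable lborel (D i)"
      using c s bsupp_partial[OF p s] by (auto intro!: integrable_bsupp)
    obtain M where M: "\<And>x. \<bar>\<phi> x\<bar> \<le> M" using continuous_bsupp_bounded[OF c(1) s] by blast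
    have "\<forall>i. \<exists>M. \<forall>x. \<bar>D i x\<bar> \<le> M"
    proof
      fix i show "\<exists>M. \<forall>x. \<bar>D i x\<bar> \<le> M"
        by (rule continuous_bsupp_bounded[OF c(2) bsupp_partial[OF p s]]) blast
    qed
    from choice[OF this] obtain M' where M': "\<And>i x. \<bar>D i x\<bar> \<le> M' i" by blast
    define W where "W i y = (LINT p|prodM. (a0 (fst p) * \<psi> i (snd p)) * D i (y + fst p *\<^sub>R snd p))" for i y
    have IW: "integrable lborel (\<lambda>y. h y * W i y)" for i
      unfolding W_def by (rule pot_pairing(2)[OF a0 p\<psi> s\<psi> h I(2)])
    \<comment> \<open>Weighted by \<open>z $ i\<close> and summed over \<open>i\<close>, the
      partials form the derivative of \<phi>(y + rz) in r, so the integral over r leaves only the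
      end points. The end point 0 yields \<open>\<phi> y\<close> because \<open>\<rho>\<close> has
      mass one.\<close>
    have sumW: "(\<Sum>i\<in>UNIV. W i y) = (LINT z|lborel. \<rho> z * \<phi> (y + R *\<^sub>R z)) - \<phi> y" for y
    proof -
      have W: "W i y = (LINT z|lborel. \<psi> i z * (LINT r|lborel. a0 r * D i (y + r *\<^sub>R z)))" for i
        using integrable_prodM_mult(3)[OF a0(1) I\<psi> has_partials_measurable(2)[OF p] M', of i i y 1] by (simp add: W_def)
      have Im: "integrable lborel (\<lambda>z. \<psi> i z * (LINT r|lborel. a0 r * D i (y + r *\<^sub>R z)))" for i
      proof -
        have "integrable prodM (case_prod (\<lambda>r z. (a0 r * \<psi> i z) * D i (y + r *\<^sub>R z)))"
          using integrable_prodM_mult(1)[OF a0(1) I\<psi> has_partials_measurable(2)[OF p] M', of i i y 1]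
          by (simp add: case_prod_beta')
        from lborel_pair.integrable_snd[OF this] show ?thesis
          by (simp add: mult.assoc mult.left_commute[of "a0 _" "\<psi> i _"])
      qed
      have IDr: "integrable lborel (\<lambda>r. a0 r * D i (y + r *\<^sub>R z))" for i z
      proof (rule integrable_mult_bounded(1)[OF a0(1)])
        have [measurable]: "D i \<in> borel_measurable borel" by (rule has_partials_measurable(2)[OF p])
        show "(\<lambda>r. D i (y + r *\<^sub>R z)) \<in> borel_measurable lborel" by measurable
      qed (rule M')
      have FTC: "(\<Sum>i\<in>UNIV. z $ i * (LINT r|lborel. a0 r * D i (y + r *\<^sub>R z))) = \<phi> (y + R *\<^sub>R z) - \<phi> y" for z
      proof -
        have "(\<Sum>i\<in>UNIV. z $ i * (LINT r|lborel. a0 r * D i (y + r *\<^sub>R z)))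
            = (LINT r|lborel. (\<Sum>i\<in>UNIV. z $ i * D i (y + r *\<^sub>R z)) * indicator {0..R} r)"
          using IDr by (subst sum_distrib_right) (simp add: a0_def mult.assoc mult.commute[of "D _ _"])
        also have "\<dots> = \<phi> (y + R *\<^sub>R z) - \<phi> (y + 0 *\<^sub>R z)"
        proof (rule integral_FTC_Icc_real)
          show "0 \<le> R" using R by simp
          show "((\<lambda>r. \<phi> (y + r *\<^sub>R z)) has_real_derivative (\<Sum>i\<in>UNIV. z $ i * D i (y + r *\<^sub>R z))) (at r)" for r
            by (rule has_partials_chain[OF p])
          have "continuous_on UNIV (\<lambda>r. \<Sum>i\<in>UNIV. z $ i * D i (y + r *\<^sub>R z))"
            by (intro continuous_on_sum continuous_on_mult continuous_on_const continuous_on_compose2[OF has_partials_continuous(2)[OF p, of UNIV]])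
               (auto intro!: continuous_intros)
          then show "isCont (\<lambda>r. \<Sum>i\<in>UNIV. z $ i * D i (y + r *\<^sub>R z)) r" for r
            by (simp add: continuous_on_eq_continuous_at)
        qed
        finally show ?thesis by simp
      qed
      have I1: "integrable lborel (\<lambda>z. \<rho> z * \<phi> (y + R *\<^sub>R z))"
      proof (rule integrable_mult_bounded(1)[OF I\<rho>])
        have [measurable]: "\<phi> \<in> borel_measurable borel" by (rule has_partials_measurable(1)[OF p])
        show "(\<lambda>z. \<phi> (y + R *\<^sub>R z)) \<in> borel_measurable lborel" by measurable
      qed (rule M)
      have "(\<Sum>i\<in>UNIV. W i y) = (LINT z|lborel. (\<Sum>i\<in>UNIV. \<psi> i z * (LINT r|lborel. a0 r * D i (y + r *\<^sub>R z))))"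
        unfolding W using Im by (simp add: Bochner_Integration.integral_sum)
      also have "\<dots> = (LINT z|lborel. \<rho> z * (\<phi> (y + R *\<^sub>R z) - \<phi> y))"
        unfolding FTC[symmetric] by (simp add: \<psi>_def sum_distrib_left mult_ac)
      also have "\<dots> = (LINT z|lborel. \<rho> z * \<phi> (y + R *\<^sub>R z)) - \<phi> y"
        using I1 I\<rho> one by (simp add: right_diff_distrib)
      finally show ?thesis .
    qed
    have s: "(\<lambda>z. R *\<^sub>R z) \<in> measurable (lborel :: (real^'n) measure) borel" by measurable
    note pair = lborel.integral_shift_average[OF I\<rho> s h I(1)]
    have gI: "integrable lborel (\<lambda>x. h x * \<phi> x)" "integrable lborel (\<lambda>x. g x * \<phi> x)"
      using integrable_mult_bounded(2)[OF I(1), of h B] integrable_mult_bounded(2)[OF I(1), of g \<gamma>] h g by auto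
    have "(\<Sum>i\<in>UNIV. LINT x|lborel. G i x * D i x) = - (\<Sum>i\<in>UNIV. LINT y|lborel. h y * W i y)"
      unfolding G_def W_def using pot_pairing(1)[OF a0 p\<psi> s\<psi> h I(2)] by (simp add: sum_negf)
    also have "\<dots> = - (LINT y|lborel. h y * (\<Sum>i\<in>UNIV. W i y))"
      using IW by (simp add: Bochner_Integration.integral_sum sum_distrib_left)
    also have "\<dots> = (LINT y|lborel. h y * \<phi> y) - (LINT y|lborel. h y * (LINT z|lborel. \<rho> z * \<phi> (y + R *\<^sub>R z)))"
      unfolding sumW using gI pair(2) by (simp add: right_diff_distrib)
    also have "\<dots> = (LINT y|lborel. h y * \<phi> y) - (LINT x|lborel. avg \<rho> R h x * \<phi> x)"
      using pair(1) by (simp add: avg_def)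
    \<comment> \<open>Here the choice of \<open>h\<close> enters: \<open>h\<close> minus its average
      is the prescribed \<open>g\<close>.\<close>
    also have "(\<lambda>x. avg \<rho> R h x * \<phi> x) = (\<lambda>x. h x * \<phi> x - g x * \<phi> x)"
      using fix_h by (simp add: fun_eq_iff algebra_simps)
    also have "(LINT y|lborel. h y * \<phi> y) - (LINT x|lborel. h x * \<phi> x - g x * \<phi> x) = (LINT x|lborel. g x * \<phi> x)"
      using gI by simp
    finally show ?case .
  qed
  then show ?thesis by blast
qed

section \<open>The nonlinear problem\<close>

text \<open>The floor is the index of the translate of the strip containing \<open>x\<close>, the
  summand 1/2 centring the strip at 0. Its parity gives the sign, and for positive \<open>d\<close>
  a separating hyperplane belongs to the translate above it.\<close>

definition antiper_ext :: "'n::finite \<Rightarrow> real \<Rightarrow> (real^'n \<Rightarrow> real) \<Rightarrow> real^'n \<Rightarrow> real" where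
  "antiper_ext k d g x = (if even \<lfloor>x $ k / d + 1 / 2\<rfloor> then 1 else - 1) *
     g (x - (of_int \<lfloor>x $ k / d + 1 / 2\<rfloor> * d) *\<^sub>R axis k 1)"

lemma antiper_ext_antiper:
  assumes "d > 0"
  shows "antiper k d (antiper_ext k d g)"
  unfolding antiper_def
proof
  fix x :: "real^'a"
  have "(x + d *\<^sub>R axis k 1) $ k / d + 1 / 2 = (x $ k / d + 1 / 2) + 1"
    using assms by (simp add: axis_def field_simps)
  then have fl: "\<lfloor>(x + d *\<^sub>R axis k 1) $ k / d + 1 / 2\<rfloor> = \<lfloor>x $ k / d + 1 / 2\<rfloor> + 1"
    using floor_add_int[of "x $ k / d + 1 / 2" 1] by (simp only: of_int_1)
  show "antiper_ext k d g (x + d *\<^sub>R axis k 1) = - antiper_ext k d g x"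
    unfolding antiper_ext_def fl by (simp add: algebra_simps)
qed

lemma antiper_ext_strip:
  assumes "x \<in> strip k d"
  shows "antiper_ext k d g x = g x"
proof -
  have d: "d > 0" "- d / 2 < x $ k" "x $ k < d / 2" using assms unfolding strip_def by auto
  have "\<lfloor>x $ k / d + 1 / 2\<rfloor> = 0"
    using d by (simp add: floor_eq_iff field_simps)
  then show ?thesis by (simp add: antiper_ext_def)
qed

lemma antiper_ext_measurable:
  assumes [measurable]: "g \<in> borel_measurable borel"
  shows "antiper_ext k d g \<in> borel_measurable borel"
  unfolding antiper_ext_def[abs_def] by measurable

lemma antiper_ext_bound:
  assumes "\<And>x. \<bar>g x\<bar> \<le> B"
  shows "\<bar>antiper_ext k d g x\<bar> \<le> B"
  using assms by (simp add: antiper_ext_def abs_mult)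

lemma antiper_ext_diff: "antiper_ext k d g x - antiper_ext k d h x = antiper_ext k d (\<lambda>x. g x - h x) x"
  by (simp add: antiper_ext_def)

lemma weak_sol_diff:
  fixes u1 u2 :: "real^'n::finite \<Rightarrow> real"
  assumes w1: "weak_sol k d g1 u1 G1" and w2: "weak_sol k d g2 u2 G2"
    and g1: "g1 \<in> borel_measurable borel" "\<And>x. \<bar>g1 x\<bar> \<le> B1" and g2: "g2 \<in> borel_measurable borel" "\<And>x. \<bar>g2 x\<bar> \<le> B2"
  shows "weak_sol k d (\<lambda>x. g1 x - g2 x) (\<lambda>x. u1 x - u2 x) (\<lambda>i x. G1 i x - G2 i x)"
proof -
  obtain C1 where C1: "\<And>x. \<bar>u1 x\<bar> \<le> C1" "\<And>i x. \<bar>G1 i x\<bar> \<le> C1" using w1 unfolding weak_sol_def by blast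
  obtain C2 where C2: "\<And>x. \<bar>u2 x\<bar> \<le> C2" "\<And>i x. \<bar>G2 i x\<bar> \<le> C2" using w2 unfolding weak_sol_def by blast
  have c: "continuous_on UNIV u1" "continuous_on UNIV u2" "\<And>i. continuous_on UNIV (G1 i)" "\<And>i. continuous_on UNIV (G2 i)"
    using w1 w2 unfolding weak_sol_def by auto
  have m: "u1 \<in> borel_measurable borel" "u2 \<in> borel_measurable borel" "\<And>i. G1 i \<in> borel_measurable borel" "\<And>i. G2 i \<in> borel_measurable borel"
    using c by (auto intro: borel_measurable_continuous_onI)
  show ?thesis
    unfolding weak_sol_def
  proof (intro conjI allI impI, goal_cases)
    case 1 show ?case by (intro continuous_on_diff c)
  next
    case (2 i) show ?case by (intro continuous_on_diff c)
  next
    case 3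
    show ?case
    proof (intro exI[of _ "C1 + C2"] allI conjI)
      show "\<bar>u1 x - u2 x\<bar> \<le> C1 + C2" for x using C1(1)[of x] C2(1)[of x] by linarith
      show "\<bar>G1 i x - G2 i x\<bar> \<le> C1 + C2" for i x using C1(2)[of i x] C2(2)[of i x] by linarith
    qed
  next
    case 4 show ?case using w1 w2 unfolding weak_sol_def antiper_def by simp
  next
    case (5 \<phi> D i)
    then have p: "has_partials \<phi> D" and s: "bsupp \<phi>" by auto
    have I: "integrable lborel \<phi>" "integrable lborel (D i)"
      using has_partials_continuous[OF p] s bsupp_partial[OF p s] by (auto intro!: integrable_bsupp)
    have "(LINT x|lborel. u1 x * D i x) = - (LINT x|lborel. G1 i x * \<phi> x)"
      "(LINT x|lborel. u2 x * D i x) = - (LINT x|lborel. G2 i x * \<phi> x)"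
      using w1 w2 p s unfolding weak_sol_def by blast+
    moreover have "integrable lborel (\<lambda>x. u1 x * D i x)" "integrable lborel (\<lambda>x. u2 x * D i x)"
      "integrable lborel (\<lambda>x. G1 i x * \<phi> x)" "integrable lborel (\<lambda>x. G2 i x * \<phi> x)"
      using integrable_mult_bounded(2)[OF I(2) _ C1(1)] integrable_mult_bounded(2)[OF I(2) _ C2(1)]
        integrable_mult_bounded(2)[OF I(1) _ C1(2)] integrable_mult_bounded(2)[OF I(1) _ C2(2)] m by simp_all
    ultimately show ?case by (simp add: left_diff_distrib)
  next
    case (6 \<phi> D)
    then have p: "has_partials \<phi> D" and s: "bsupp \<phi>" by auto
    have I: "integrable lborel \<phi>" "\<And>i. integrable lborel (D i)"
      using has_partials_continuous[OF p] s bsupp_partial[OF p s] by (auto intro!: integrable_bsupp)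
    have "(\<Sum>i\<in>UNIV. LINT x|lborel. G1 i x * D i x) = (LINT x|lborel. g1 x * \<phi> x)"
      "(\<Sum>i\<in>UNIV. LINT x|lborel. G2 i x * D i x) = (LINT x|lborel. g2 x * \<phi> x)"
      using w1 w2 p s unfolding weak_sol_def by blast+
    moreover have "integrable lborel (\<lambda>x. G1 i x * D i x)" "integrable lborel (\<lambda>x. G2 i x * D i x)" for i
      using integrable_mult_bounded(2)[OF I(2), of "G1 i" C1 i] integrable_mult_bounded(2)[OF I(2), of "G2 i" C2 i] m C1 C2 by auto
    moreover have "integrable lborel (\<lambda>x. g1 x * \<phi> x)" "integrable lborel (\<lambda>x. g2 x * \<phi> x)"
      using integrable_mult_bounded(2)[OF I(1), of g1 B1] integrable_mult_bounded(2)[OF I(1), of g2 B2] g1 g2 by auto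
    ultimately show ?case by (simp add: left_diff_distrib sum_subtractf)
  qed
qed

text \<open>The extension is applied to the complete right-hand side, because \<open>f\<close>
  composed with an antiperiodic function is in general not antiperiodic. The bound \<open>F\<close>
  of \<open>f\<close> makes the ball of radius \<open>R\<close> invariant, and the Lipschitz
  constant \<open>M\<close> makes the map contract with factor \<open>q\<close>.\<close>

lemma nonlinear_weak_sol_exists:
  fixes lam h :: "real^'n::finite \<Rightarrow> real" and f :: "real \<Rightarrow> real"
  assumes d: "d > 0"
    and lam: "lam \<in> borel_measurable borel" "\<And>x. 0 \<le> lam x" "\<And>x. lam x \<le> \<Lambda>"
    and h: "h \<in> borel_measurable borel" "\<And>x. 0 \<le> h x" "\<And>x. h x \<le> H"
    and f: "continuous_on UNIV f" "\<And>t. 0 \<le> f t"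
    and F: "\<And>t. \<bar>t\<bar> \<le> R \<Longrightarrow> f t \<le> F" "d\<^sup>2 / 8 * (\<Lambda> * F + H) \<le> R"
    and M: "\<And>s t. \<bar>s\<bar> \<le> R \<Longrightarrow> \<bar>t\<bar> \<le> R \<Longrightarrow> \<bar>f s - f t\<bar> \<le> M * \<bar>s - t\<bar>"
      "d\<^sup>2 / 8 * \<Lambda> * M \<le> q" "0 \<le> q" "q < 1" "0 \<le> R" "0 \<le> M"
  obtains u G where "weak_sol k d (antiper_ext k d (\<lambda>x. lam x * f (u x) + h x)) u G" "\<And>x. \<bar>u x\<bar> \<le> R"
proof -
  define g where "g w x = lam x * f (apply_bcontfun w x) + h x" for w :: "(real^'n) \<Rightarrow>\<^sub>C real" and x
  define S where "S = cball (0 :: (real^'n) \<Rightarrow>\<^sub>C real) R"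
  have \<Lambda>: "\<Lambda> \<ge> 0" using lam(2,3)[of undefined] by linarith
  have F0: "F \<ge> 0" using F(1)[of 0] f(2)[of 0] M(5) by simp
  have inS: "\<bar>apply_bcontfun w x\<bar> \<le> R" if "w \<in> S" for w x
    using that norm_bounded[of w x] by (simp add: S_def)
  have gm: "g w \<in> borel_measurable borel" for w
  proof -
    have [measurable]: "apply_bcontfun w \<in> borel_measurable borel" "f \<in> borel_measurable borel"
      using f(1) by (auto intro!: borel_measurable_continuous_onI)
    show ?thesis unfolding g_def using lam(1) h(1) by measurable
  qed
  have gB: "\<bar>g w x\<bar> \<le> \<Lambda> * F + H" if "w \<in> S" for w x
  proof -
    have "lam x * f (apply_bcontfun w x) \<le> \<Lambda> * F"
      using lam F(1)[OF inS[OF that]] f(2) \<Lambda> by (intro mult_mono) auto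
    then show ?thesis using lam(2)[of x] f(2)[of "apply_bcontfun w x"] h(2,3)[of x] by (simp add: g_def abs_le_iff)
  qed
  have "\<forall>w\<in>S. \<exists>u G. weak_sol k d (antiper_ext k d (g w)) u G"
    using weak_sol_exists[OF d antiper_ext_measurable[OF gm] antiper_ext_bound[OF gB] antiper_ext_antiper[OF d]] by blast
  \<comment> \<open>The solutions are picked arbitrarily. The a priori bound, applied to a solution
    and to the difference of two, gives invariance of the ball and contraction for any such
    choice.\<close>
  then obtain U where "\<forall>w\<in>S. \<exists>G. weak_sol k d (antiper_ext k d (g w)) (U w) G" by metis
  then obtain GG where UG: "\<And>w. w \<in> S \<Longrightarrow> weak_sol k d (antiper_ext k d (g w)) (U w) (GG w)" by metis
  have UR: "\<bar>U w x\<bar> \<le> R" if "w \<in> S" for w x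
    using weak_sol_bound[OF UG[OF that] d antiper_ext_measurable[OF gm] antiper_ext_bound[OF gB[OF that]], of x] F(2) by linarith
  define \<Phi> where "\<Phi> w = Bcontfun (U w)" for w
  have \<Phi>: "apply_bcontfun (\<Phi> w) = U w" if "w \<in> S" for w
    unfolding \<Phi>_def
  proof (rule Bcontfun_inverse, rule bcontfun_normI)
    show "continuous_on UNIV (U w)" using UG[OF that] unfolding weak_sol_def by blast
    show "norm (U w x) \<le> R" for x using UR[OF that] by simp
  qed
  have "\<exists>!w\<in>S. \<Phi> w = w"
  proof (rule Banach_fix[where c=q])
    show "complete S" by (simp add: S_def complete_eq_closed)
    show "S \<noteq> {}" using M(5) by (auto simp: S_def)
    show "\<Phi> ` S \<subseteq> S"
    proof
      fix y assume "y \<in> \<Phi> ` S"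
      then obtain w where w: "w \<in> S" "y = \<Phi> w" by blast
      have "norm (\<Phi> w) \<le> R" by (rule norm_bound) (use UR[OF w(1)] \<Phi>[OF w(1)] in simp)
      then show "y \<in> S" using w by (simp add: S_def)
    qed
    fix v w assume vw: "v \<in> S" "w \<in> S"
    show "dist (\<Phi> v) (\<Phi> w) \<le> q * dist v w"
    proof (rule dist_bound)
      fix x
      define \<delta> where "\<delta> = \<Lambda> * (M * dist v w)"
      have gd: "\<bar>g v x - g w x\<bar> \<le> \<delta>" for x
      proof -
        have "\<bar>f (apply_bcontfun v x) - f (apply_bcontfun w x)\<bar> \<le> M * \<bar>apply_bcontfun v x - apply_bcontfun w x\<bar>"
          by (rule M(1)[OF inS[OF vw(1)] inS[OF vw(2)]])
        also have "\<dots> \<le> M * dist v w"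
          using dist_bounded[of v x w] M(6) by (intro mult_left_mono) (auto simp: dist_norm)
        finally have "\<bar>lam x\<bar> * \<bar>f (apply_bcontfun v x) - f (apply_bcontfun w x)\<bar> \<le> \<Lambda> * (M * dist v w)"
          using lam \<Lambda> by (intro mult_mono) auto
        then show ?thesis by (simp add: g_def \<delta>_def abs_mult flip: right_diff_distrib)
      qed
      \<comment> \<open>By linearity the a priori bound doubles as a Lipschitz estimate for the
        solution map.\<close>
      have "weak_sol k d (\<lambda>x. antiper_ext k d (g v) x - antiper_ext k d (g w) x) (\<lambda>x. U v x - U w x) (\<lambda>i x. GG v i x - GG w i x)"
        by (rule weak_sol_diff[OF UG[OF vw(1)] UG[OF vw(2)] antiper_ext_measurable[OF gm] antiper_ext_bound[OF gB[OF vw(1)]] antiper_ext_measurable[OF gm] antiper_ext_bound[OF gB[OF vw(2)]]])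
      then have "\<bar>U v x - U w x\<bar> \<le> d\<^sup>2 / 8 * \<delta>"
      proof (rule weak_sol_bound[OF _ d])
        show "(\<lambda>x. antiper_ext k d (g v) x - antiper_ext k d (g w) x) \<in> borel_measurable borel"
          using antiper_ext_measurable[OF gm[of v]] antiper_ext_measurable[OF gm[of w]] by simp
        show "\<bar>antiper_ext k d (g v) x - antiper_ext k d (g w) x\<bar> \<le> \<delta>" for x
          unfolding antiper_ext_diff by (rule antiper_ext_bound[OF gd])
      qed
      also have "\<dots> = (d\<^sup>2 / 8 * \<Lambda> * M) * dist v w" by (simp add: \<delta>_def)
      also have "\<dots> \<le> q * dist v w" by (intro mult_right_mono M) simp
      finally show "dist (apply_bcontfun (\<Phi> v) x) (apply_bcontfun (\<Phi> w) x) \<le> q * dist v w"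
        by (simp add: \<Phi> vw dist_norm)
    qed
  qed (use M in auto)
  then obtain w where w: "w \<in> S" "\<Phi> w = w" by blast
  then have eq: "U w = apply_bcontfun w" using \<Phi> by metis
  have "g w = (\<lambda>x. lam x * f (U w x) + h x)" by (simp add: g_def fun_eq_iff eq)
  with UG[OF w(1)] have "weak_sol k d (antiper_ext k d (\<lambda>x. lam x * f (U w x) + h x)) (U w) (GG w)" by simp
  then show ?thesis using that UR[OF w(1)] by blast
qed

section \<open>Weak solutions in the strip\<close>

lemma borel_imp_lebesgue_on:
  fixes F :: "'a::euclidean_space \<Rightarrow> real"
  assumes "F \<in> borel_measurable borel"
  shows "F \<in> borel_measurable (lebesgue_on S)"
  using assms by (intro measurable_restrict_space1 measurable_completion) simp

lemma integral_lebesgue_on_eq: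
  fixes F :: "'a::euclidean_space \<Rightarrow> real"
  assumes S: "S \<in> sets borel" and F: "F \<in> borel_measurable borel" and 0: "\<And>x. x \<notin> S \<Longrightarrow> F x = 0"
  shows "integral\<^sup>L (lebesgue_on S) F = (LINT x|lborel. F x)"
proof -
  have "integral\<^sup>L (lebesgue_on S) F = integral\<^sup>L lebesgue (\<lambda>x. indicator S x *\<^sub>R F x)"
    using S by (intro integral_restrict_space) auto
  also have "(\<lambda>x. indicator S x *\<^sub>R F x) = F" using 0 by (auto simp: indicator_def fun_eq_iff)
  also have "integral\<^sup>L lebesgue F = (LINT x|lborel. F x)" using F by (intro integral_completion) simp
  finally show ?thesis .
qed

lemma memL2_bounded:
  assumes U: "open U" "bounded U" and F: "F \<in> borel_measurable borel" "\<And>x. \<bar>F x\<bar> \<le> B"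
  shows "memL2 U F"
  unfolding memL2_def
proof
  show "F \<in> borel_measurable (lebesgue_on U)" by (rule borel_imp_lebesgue_on[OF F(1)])
  have iU: "integrable lborel (indicator U :: _ \<Rightarrow> real)"
    by (rule integrable_real_indicator) (use U emeasure_bounded_finite[OF U(2)] in auto)
  have "integrable lborel (\<lambda>x. indicator U x * (F x)\<^sup>2)"
  proof (rule integrable_mult_bounded(1)[OF iU])
    show "(\<lambda>x. (F x)\<^sup>2) \<in> borel_measurable lborel" using F(1) by simp
    have "(F x)\<^sup>2 \<le> B\<^sup>2" for x using power_mono[OF F(2)[of x], of 2] by simp
    then show "\<bar>(F x)\<^sup>2\<bar> \<le> B\<^sup>2" for x by simp
  qed
  then have "integrable lebesgue (\<lambda>x. indicator U x *\<^sub>R (F x)\<^sup>2)"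
    using F(1) U by (subst integrable_completion) auto
  then show "integrable (lebesgue_on U) (\<lambda>x. (F x)\<^sup>2)"
    using U by (subst integrable_restrict_space) auto
qed

section \<open>Test functions and Sobolev membership on bounded open sets\<close>

lemma test_funD:
  fixes \<phi> :: "real^'n::finite \<Rightarrow> real"
  assumes "test_fun U \<phi>"
  shows "has_partials \<phi> (\<lambda>i. pderiv_at i \<phi>)" "bsupp \<phi>" "\<And>x. x \<notin> U \<Longrightarrow> \<phi> x = 0" "\<And>i x. x \<notin> U \<Longrightarrow> pderiv_at i \<phi> x = 0"
proof -
  have sm: "smooth_fun \<phi>" and cp: "compact (tsupport \<phi>)" and sub: "tsupport \<phi> \<subseteq> U"
    using assms unfolding test_fun_def by auto
  show hp: "has_partials \<phi> (\<lambda>i. pderiv_at i \<phi>)"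
    using smooth_fun_has_partials[OF sm, of "[]"] by simp
  have van: "\<phi> x = 0" if "x \<notin> tsupport \<phi>" for x
    using that closure_subset[of "{x. \<phi> x \<noteq> 0}"] unfolding tsupport_def by blast
  obtain R where R: "\<And>x. x \<in> tsupport \<phi> \<Longrightarrow> norm x \<le> R"
    using compact_imp_bounded[OF cp] unfolding bounded_iff by blast
  show "bsupp \<phi>" unfolding bsupp_def
  proof (intro exI allI impI)
    fix x :: "real^'n" assume "norm x > R" then show "\<phi> x = 0" using R[of x] van[of x] by force
  qed
  show "\<phi> x = 0" if "x \<notin> U" for x using van sub that by blast
  fix i x assume "x \<notin> U"
  then have x: "x \<in> - tsupport \<phi>" using sub by blast
  have op: "open (- tsupport \<phi>)" unfolding tsupport_def by auto
  have "((\<lambda>t. \<phi> (x + t *\<^sub>R axis i 1)) has_real_derivative 0) (at 0)"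
  proof (rule has_field_derivative_transform_within_open[where f="\<lambda>_. 0"])
    show "open ((\<lambda>t. x + t *\<^sub>R axis i 1) -` (- tsupport \<phi>))"
      by (intro open_vimage op continuous_intros)
    show "\<And>t. t \<in> (\<lambda>t. x + t *\<^sub>R axis i 1) -` (- tsupport \<phi>) \<Longrightarrow> 0 = \<phi> (x + t *\<^sub>R axis i 1)" using van by simp
  qed (use x in auto)
  then show "pderiv_at i \<phi> x = 0" unfolding pderiv_at_def by (rule DERIV_imp_deriv)
qed

lemma sobolev12I:
  fixes u :: "real^'n::finite \<Rightarrow> real"
  assumes U: "open U" "bounded U"
    and c: "continuous_on UNIV u" "\<And>i. continuous_on UNIV (G i)"
    and b: "\<And>x. \<bar>u x\<bar> \<le> B" "\<And>i x. \<bar>G i x\<bar> \<le> C i"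
    and w: "\<And>\<phi> D i. has_partials \<phi> D \<Longrightarrow> bsupp \<phi> \<Longrightarrow> (LINT x|lborel. u x * D i x) = - (LINT x|lborel. G i x * \<phi> x)"
  shows "sobolev12 U u (\<lambda>x. \<chi> i. G i x)"
proof -
  have m: "u \<in> borel_measurable borel" "G i \<in> borel_measurable borel" for i
    using c by (auto intro: borel_measurable_continuous_onI)
  show ?thesis unfolding sobolev12_def
  proof (intro conjI allI impI)
    show "memL2 U u" by (rule memL2_bounded[OF U m(1) b(1)])
    show "memL2 U (\<lambda>x. (\<chi> i. G i x) $ i)" for i using memL2_bounded[OF U m(2) b(2)] by simp
    fix \<phi> i assume "test_fun U \<phi>"
    note t = test_funD[OF this]
    note tm = has_partials_measurable[OF t(1)]
    have "integral\<^sup>L (lebesgue_on U) (\<lambda>x. u x * pderiv_at i \<phi> x) = (LINT x|lborel. u x * pderiv_at i \<phi> x)"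
      using U m tm t(4) by (intro integral_lebesgue_on_eq) auto
    moreover have "integral\<^sup>L (lebesgue_on U) (\<lambda>x. (\<chi> i. G i x) $ i * \<phi> x) = (LINT x|lborel. G i x * \<phi> x)"
      using U m(2)[of i] tm(1) t(3) by (subst integral_lebesgue_on_eq) auto
    ultimately show "integral\<^sup>L (lebesgue_on U) (\<lambda>x. u x * pderiv_at i \<phi> x) = - integral\<^sup>L (lebesgue_on U) (\<lambda>x. (\<chi> i. G i x) $ i * \<phi> x)"
      using w[OF t(1,2), of i] by simp
  qed
qed

lemma smooth_fun_conv:
  fixes \<eta> :: "real^'n::finite \<Rightarrow> real"
  assumes \<eta>: "smooth_fun \<eta>" "bsupp \<eta>" and w: "w \<in> borel_measurable borel" "\<And>x. \<bar>w x\<bar> \<le> B"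
  shows "smooth_fun (conv \<eta> w)" "iter_pderiv is (conv \<eta> w) = conv (iter_pderiv is \<eta>) w"
proof -
  have d: "((\<lambda>t. conv (iter_pderiv is \<eta>) w (x + t *\<^sub>R axis i 1)) has_real_derivative conv (iter_pderiv (i # is) \<eta>) w x) (at 0)" for "is" i x
    by (rule conv_has_partial[OF smooth_fun_has_partials[OF \<eta>(1)] bsupp_iter_pderiv[OF \<eta>] w])
  have eq: "iter_pderiv is (conv \<eta> w) = conv (iter_pderiv is \<eta>) w" for "is"
  proof (induction "is")
    case (Cons i "is")
    have "pderiv_at i (conv (iter_pderiv is \<eta>) w) x = conv (iter_pderiv (i # is) \<eta>) w x" for x
      unfolding pderiv_at_def by (rule DERIV_imp_deriv[OF d])
    then show ?case unfolding iter_pderiv.simps(2) Cons by (simp add: fun_eq_iff)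
  qed simp
  then show "iter_pderiv is (conv \<eta> w) = conv (iter_pderiv is \<eta>) w" .
  show "smooth_fun (conv \<eta> w)"
    unfolding smooth_fun_def eq
  proof (intro allI conjI)
    show "continuous_on UNIV (conv (iter_pderiv is \<eta>) w)" for "is"
      by (rule conv_continuous[OF smooth_fun_has_partials[OF \<eta>(1)] bsupp_iter_pderiv[OF \<eta>] w])
    show "(\<lambda>t. conv (iter_pderiv is \<eta>) w (x + t *\<^sub>R axis i 1)) differentiable at 0" for "is" i x
      using d[of "is" x i] by (meson real_differentiable_def)
  qed
qed

text \<open>\<open>U\<close> and \<open>V\<close> are unrelated, because an approximant is also
  examined on bounded open sets that are not contained in its own domain.\<close>

lemma test_fun_sobolev12:
  fixes \<phi> :: "real^'n::finite \<Rightarrow> real"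
  assumes t: "test_fun V \<phi>" and U: "open U" "bounded U"
  shows "sobolev12 U \<phi> (grad \<phi>)"
proof -
  note T = test_funD[OF t]
  note c = has_partials_continuous[OF T(1)]
  obtain B where B: "\<And>x. \<bar>\<phi> x\<bar> \<le> B" using continuous_bsupp_bounded[OF c(1) T(2)] by blast
  have "\<forall>i. \<exists>C. \<forall>x. \<bar>pderiv_at i \<phi> x\<bar> \<le> C"
  proof
    fix i show "\<exists>C. \<forall>x. \<bar>pderiv_at i \<phi> x\<bar> \<le> C"
      by (rule continuous_bsupp_bounded[OF c(2) bsupp_partial[OF T(1,2)]]) blast
  qed
  from choice[OF this] obtain C where C: "\<And>i x. \<bar>pderiv_at i \<phi> x\<bar> \<le> C i" by blast
  have "grad \<phi> = (\<lambda>x. \<chi> i. pderiv_at i \<phi> x)" by (simp add: grad_def fun_eq_iff)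
  moreover have "sobolev12 U \<phi> (\<lambda>x. \<chi> i. pderiv_at i \<phi> x)"
  proof (rule sobolev12I[OF U c(1) c(2) B C])
    fix \<psi> :: "real^'n \<Rightarrow> real" and D i assume "has_partials \<psi> D" "bsupp \<psi>"
    then show "(LINT x|lborel. \<phi> x * D i x) = - (LINT x|lborel. pderiv_at i \<phi> x * \<psi> x)"
      using integration_by_parts[OF T(1) _ T(2)] by blast
  qed
  ultimately show ?thesis by simp
qed

lemma test_fun_sobolev12_0:
  fixes \<phi> :: "real^'n::finite \<Rightarrow> real"
  assumes t: "test_fun U \<phi>" and U: "open U" "bounded U"
  shows "sobolev12_0 U \<phi> (grad \<phi>)"
  unfolding sobolev12_0_def
proof (intro conjI exI[of _ "\<lambda>_. \<phi>"])
  show "(\<lambda>k::nat. w12_dist2 U \<phi> (grad \<phi>) \<phi> (grad \<phi>)) \<longlonglongrightarrow> 0" by (simp add: w12_dist2_def)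
qed (use test_fun_sobolev12[OF t U] t in auto)

lemma integral_square_le:
  assumes U: "open U" "bounded U" and F: "\<And>x. x \<in> U \<Longrightarrow> \<bar>F x\<bar> \<le> \<delta>"
  shows "integral\<^sup>L (lebesgue_on U) (\<lambda>x. (F x)\<^sup>2) \<le> \<delta>\<^sup>2 * measure lebesgue U"
proof -
  have fm: "U \<in> lmeasurable" using U by (intro lmeasurable_open)
  have "integral\<^sup>L (lebesgue_on U) (\<lambda>x. (F x)\<^sup>2) \<le> integral\<^sup>L (lebesgue_on U) (\<lambda>x. \<delta>\<^sup>2)"
  proof (rule integral_mono')
    interpret finite_measure "lebesgue_on U" by (rule finite_measure_lebesgue_on[OF fm])
    show "integrable (lebesgue_on U) (\<lambda>x. \<delta>\<^sup>2)" by simp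
    show "(F x)\<^sup>2 \<le> \<delta>\<^sup>2" if "x \<in> space (lebesgue_on U)" for x
      using power_mono[OF F[of x], of 2] that by simp
  qed simp
  also have "\<dots> = \<delta>\<^sup>2 * measure lebesgue U"
    using fm by (simp add: measure_restrict_space)
  finally show ?thesis .
qed

lemma w12_dist2_tendsto_0:
  fixes u :: "real^'n::finite \<Rightarrow> real"
  assumes U: "open U" "bounded U"
    and ev: "\<And>\<delta>. \<delta> > 0 \<Longrightarrow> \<forall>\<^sub>F j in sequentially. \<forall>x\<in>U. \<bar>us j x - u x\<bar> \<le> \<delta> \<and> (\<forall>i. \<bar>Gs j x $ i - G x $ i\<bar> \<le> \<delta>)"
  shows "(\<lambda>j. w12_dist2 U (us j) (Gs j) u G) \<longlonglongrightarrow> 0"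
proof (rule tendstoI)
  fix e :: real assume e: "e > 0"
  \<comment> \<open>One integral for the function and \<open>real CARD('n)\<close> for the gradient,
    each at most \<delta>^2 times the measure of \<open>U\<close>; the summand 1 keeps
    \<open>V\<close> positive.\<close>
  define V where "V = (1 + real CARD('n)) * measure lebesgue U + 1"
  have V: "V > 0" unfolding V_def by (simp add: add_nonneg_pos)
  define \<delta> where "\<delta> = sqrt (e / (2 * V))"
  have \<delta>: "\<delta> > 0" "\<delta>\<^sup>2 * V < e" using e V by (auto simp: \<delta>_def)
  show "\<forall>\<^sub>F j in sequentially. dist (w12_dist2 U (us j) (Gs j) u G) 0 < e"
    using ev[OF \<delta>(1)]
  proof eventually_elim
    case (elim j)
    have "w12_dist2 U (us j) (Gs j) u G \<le> \<delta>\<^sup>2 * measure lebesgue U + (\<Sum>i\<in>(UNIV::'n set). \<delta>\<^sup>2 * measure lebesgue U)"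
      unfolding w12_dist2_def by (intro add_mono sum_mono integral_square_le U) (use elim in auto)
    also have "\<dots> \<le> \<delta>\<^sup>2 * V" by (simp add: V_def algebra_simps)
    also have "\<dots> < e" by (rule \<delta>)
    finally have "w12_dist2 U (us j) (Gs j) u G < e" .
    moreover have "w12_dist2 U (us j) (Gs j) u G \<ge> 0"
      unfolding w12_dist2_def by (intro add_nonneg_nonneg sum_nonneg integral_nonneg_AE) auto
    ultimately show ?case by (simp add: dist_norm)
  qed
qed

section \<open>Essential suprema and Borel representatives\<close>

lemma open_strip: "open (strip k d)"
  unfolding strip_def by (intro open_Collect_conj open_Collect_less continuous_intros)

text \<open>The infimum is itself an essential bound, because the exceptional null sets of the
  bounds exceeding it by 1/(n+1) have a null union.\<close>

lemma linf_norm_props: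
  assumes "memLinf S g"
  shows "0 \<le> linf_norm S g" "AE x in lebesgue_on S. \<bar>g x\<bar> \<le> linf_norm S g"
proof -
  define X where "X = {C. 0 \<le> C \<and> (AE x in lebesgue_on S. \<bar>g x\<bar> \<le> C)}"
  obtain C where C: "AE x in lebesgue_on S. \<bar>g x\<bar> \<le> C" using assms unfolding memLinf_def by blast
  have "AE x in lebesgue_on S. \<bar>g x\<bar> \<le> \<bar>C\<bar>" using C by eventually_elim auto
  then have "\<bar>C\<bar> \<in> X" by (simp add: X_def)
  then have ne: "X \<noteq> {}" by blast
  show "0 \<le> linf_norm S g" unfolding linf_norm_def X_def[symmetric] by (rule cInf_greatest[OF ne]) (simp add: X_def)
  have "AE x in lebesgue_on S. \<bar>g x\<bar> \<le> linf_norm S g + 1 / real (Suc n)" for n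
  proof -
    obtain c where c: "c \<in> X" "c < linf_norm S g + 1 / real (Suc n)"
      using cInf_lessD[OF ne, of "linf_norm S g + 1 / real (Suc n)"] unfolding linf_norm_def X_def[symmetric] by auto
    then have "AE x in lebesgue_on S. \<bar>g x\<bar> \<le> c" by (simp add: X_def)
    then show ?thesis by (rule AE_mp) (use c(2) in auto)
  qed
  then have "AE x in lebesgue_on S. \<forall>n. \<bar>g x\<bar> \<le> linf_norm S g + 1 / real (Suc n)"
    by (simp add: AE_all_countable)
  then show "AE x in lebesgue_on S. \<bar>g x\<bar> \<le> linf_norm S g"
  proof eventually_elim
    case (elim x)
    have "(\<lambda>n. linf_norm S g + 1 / real (Suc n)) \<longlonglongrightarrow> linf_norm S g + 0"
      by (intro tendsto_add tendsto_const LIMSEQ_inverse_real_of_nat[unfolded inverse_eq_divide])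
    then show ?case using elim by (intro LIMSEQ_le_const[of _ "linf_norm S g"]) auto
  qed
qed

text \<open>The whole-space results use Borel functions bounded at every point, whereas the data are
  Lebesgue measurable and bounded almost everywhere on \<open>S\<close>. A Borel representative
  clipped to the interval from 0 to the norm bridges the gap.\<close>

lemma Linf_borel_representative:
  fixes g :: "real^'n::finite \<Rightarrow> real"
  assumes S: "open S" and g: "memLinf S g" and nn: "AE x in lebesgue_on S. 0 \<le> g x"
  obtains g' where "g' \<in> borel_measurable borel" "\<And>x. 0 \<le> g' x" "\<And>x. g' x \<le> linf_norm S g"
    "AE x in lebesgue_on S. g x = g' x"
proof -
  have Sm: "S \<in> sets lebesgue" using S by auto
  have "(\<lambda>x. if x \<in> S then g x else 0) \<in> borel_measurable lebesgue"
    using g Sm unfolding memLinf_def by (intro borel_measurable_if_I) auto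
  then obtain g1 where g1: "g1 \<in> borel_measurable lborel" "AE x in lborel. (if x \<in> S then g x else 0) = g1 x"
    using completion_ex_borel_measurable_real by blast
  define g' where "g' x = min (linf_norm S g) (max 0 (g1 x))" for x
  have "AE x in lebesgue. (if x \<in> S then g x else 0) = g1 x" using g1(2) by (rule AE_completion)
  then have "AE x in lebesgue_on S. g x = g1 x"
    using Sm by (subst AE_restrict_space_iff) auto
  then have "AE x in lebesgue_on S. g x = g' x"
    using nn linf_norm_props(2)[OF g] by eventually_elim (auto simp: g'_def)
  moreover have "g' \<in> borel_measurable borel" unfolding g'_def[abs_def] using g1(1) by simp
  ultimately show ?thesis
    using that[of g'] linf_norm_props(1)[OF g] by (auto simp: g'_def)
qed

text \<open>Cutting off at depth 2\<epsilon> and mollifying with radius \<epsilon> keeps the support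
  at depth \<epsilon>. At depth 3\<epsilon> the mollifier does not see the cutoff, so there the
  function and its gradient are plain averages of \<open>u\<close> and \<open>G\<close>.\<close>

lemma interior_approximation:
  fixes u :: "real^'n::finite \<Rightarrow> real" and G :: "'n \<Rightarrow> real^'n \<Rightarrow> real"
  assumes c: "continuous_on UNIV u" "\<And>i. continuous_on UNIV (G i)"
    and b: "\<And>x. \<bar>u x\<bar> \<le> B" "\<And>i x. \<bar>G i x\<bar> \<le> B"
    and w: "\<And>\<phi> D i. has_partials \<phi> D \<Longrightarrow> bsupp \<phi> \<Longrightarrow> (LINT x|lborel. u x * D i x) = - (LINT x|lborel. G i x * \<phi> x)"
    and \<epsilon>: "\<epsilon> > 0"
  obtains \<phi> where "test_fun (strip k d \<inter> ball 0 r) \<phi>"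
    "\<And>x \<delta>. \<bar>x $ k\<bar> + 3 * \<epsilon> \<le> d / 2 \<Longrightarrow> norm x + 3 * \<epsilon> \<le> r \<Longrightarrow> \<delta> \<ge> 0 \<Longrightarrow>
       (\<And>y. norm (x - y) < \<epsilon> \<Longrightarrow> \<bar>u y - u x\<bar> \<le> \<delta> \<and> (\<forall>i. \<bar>G i y - G i x\<bar> \<le> \<delta>)) \<Longrightarrow>
       \<bar>\<phi> x - u x\<bar> \<le> \<delta> \<and> (\<forall>i. \<bar>grad \<phi> x $ i - G i x\<bar> \<le> \<delta>)"
proof -
  obtain \<eta> :: "real^'n \<Rightarrow> real"
    where \<eta>: "smooth_fun \<eta>" "\<And>x. \<eta> x \<ge> 0" "\<And>x. norm x \<ge> \<epsilon> \<Longrightarrow> \<eta> x = 0" "bsupp \<eta>" "(LINT x|lborel. \<eta> x) = 1"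
    using mollifier_exists[OF \<epsilon>] by blast
  define D where "D i = iter_pderiv [i] \<eta>" for i
  have p: "has_partials \<eta> D"
    using smooth_fun_has_partials[OF \<eta>(1), of "[]"] by (simp add: D_def[abs_def])
  have c\<eta>: "continuous_on UNIV \<eta>" by (rule has_partials_continuous(1)[OF p])
  have m: "u \<in> borel_measurable borel" "G i \<in> borel_measurable borel" for i
    using c by (auto intro: borel_measurable_continuous_onI)
  \<comment> \<open>Points of depth at least \<open>e\<close>, measured both from the faces of the
    strip and from the sphere of radius \<open>r\<close>.\<close>
  define K where "K e = {x :: real^'n. \<bar>x $ k\<bar> \<le> d / 2 - e \<and> norm x \<le> r - e}" for e
  have K_closed: "closed (K e)" for e
    unfolding K_def by (intro closed_Collect_conj closed_Collect_le continuous_intros)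
  define v where "v x = indicator (K (2 * \<epsilon>)) x * u x" for x
  have vm: "v \<in> borel_measurable borel" unfolding v_def using m(1) K_closed by (intro borel_measurable_times borel_measurable_indicator) auto
  have B: "B \<ge> 0" using b(1)[of undefined] by linarith
  have vb: "\<bar>v x\<bar> \<le> B" for x using b(1)[of x] B by (auto simp: v_def indicator_def)
  define \<phi> where "\<phi> = conv \<eta> v"
  have sub: "{x. \<phi> x \<noteq> 0} \<subseteq> K \<epsilon>"
  proof
    fix x assume "x \<in> {x. \<phi> x \<noteq> 0}"
    then have nz: "\<phi> x \<noteq> 0" by simp
    show "x \<in> K \<epsilon>"
    proof (rule ccontr)
      assume x: "x \<notin> K \<epsilon>"
      have "\<eta> (x - y) * v y = 0" for y
      proof (cases "y \<in> K (2 * \<epsilon>)")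
        case True
        have "norm (x - y) \<ge> \<epsilon>"
        proof (cases "\<bar>x $ k\<bar> \<le> d / 2 - \<epsilon>")
          case True
          then have "norm x > r - \<epsilon>" using x by (simp add: K_def)
          then show ?thesis using \<open>y \<in> K (2 * \<epsilon>)\<close> norm_triangle_ineq2[of x y] by (simp add: K_def)
        next
          case False
          moreover have "\<bar>y $ k\<bar> \<le> d / 2 - 2 * \<epsilon>" using \<open>y \<in> K (2 * \<epsilon>)\<close> by (simp add: K_def)
          moreover have "\<bar>x $ k - y $ k\<bar> \<le> norm (x - y)" using component_le_norm_cart[of "x - y" k] by simp
          ultimately show ?thesis by linarith
        qed
        then show ?thesis using \<eta>(3) by simp
      qed (simp add: v_def)
      then have "\<phi> x = 0" by (simp only: \<phi>_def conv_def) simp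
      with nz show False by simp
    qed
  qed
  have ts: "tsupport \<phi> \<subseteq> K \<epsilon>"
    unfolding tsupport_def by (rule closure_minimal[OF sub K_closed])
  have "bounded (K \<epsilon>)" unfolding bounded_iff K_def by auto
  then have "bounded (tsupport \<phi>)" using ts bounded_subset by blast
  then have cp: "compact (tsupport \<phi>)" by (simp add: compact_eq_bounded_closed tsupport_def)
  have KU: "K \<epsilon> \<subseteq> strip k d \<inter> ball 0 r"
    using \<epsilon> by (auto simp: K_def strip_def)
  have tf: "test_fun (strip k d \<inter> ball 0 r) \<phi>"
    unfolding test_fun_def using smooth_fun_conv(1)[OF \<eta>(1,4) vm vb] cp order.trans[OF ts KU] by (simp add: \<phi>_def)
  have grad: "grad \<phi> x $ i = conv (D i) v x" for x i
    using smooth_fun_conv(2)[OF \<eta>(1,4) vm vb, of "[i]"] by (simp add: grad_def \<phi>_def D_def)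
  show ?thesis
  proof (rule that[OF tf])
    fix x \<delta> assume x: "\<bar>x $ k\<bar> + 3 * \<epsilon> \<le> d / 2" "norm x + 3 * \<epsilon> \<le> r" and \<delta>: "\<delta> \<ge> 0"
      and near: "\<And>y. norm (x - y) < \<epsilon> \<Longrightarrow> \<bar>u y - u x\<bar> \<le> \<delta> \<and> (\<forall>i. \<bar>G i y - G i x\<bar> \<le> \<delta>)"
    have inK: "y \<in> K (2 * \<epsilon>)" if "norm (x - y) \<le> \<epsilon>" for y
      using that x component_le_norm_cart[of "x - y" k] norm_triangle_ineq2[of y x] by (auto simp: K_def norm_minus_commute)
    \<comment> \<open>The open condition on \<open>z\<close> allows differentiating the zero
      function; the sphere of radius \<open>\<epsilon>\<close> is covered by \<open>inK\<close>,
      which is stated for the closed ball.\<close>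
    have D0: "D i z = 0" if "norm z > \<epsilon>" for i z
    proof -
      have "((\<lambda>t. \<eta> (z + t *\<^sub>R axis i 1)) has_real_derivative 0) (at 0)"
      proof (rule has_field_derivative_transform_within_open[where f="\<lambda>_. 0"])
        show "open {t. norm (z + t *\<^sub>R axis i 1) > \<epsilon>}"
          by (intro open_Collect_less continuous_intros)
      qed (use that \<eta>(3) in auto)
      moreover have "((\<lambda>t. \<eta> (z + t *\<^sub>R axis i 1)) has_real_derivative D i z) (at 0)"
        using p unfolding has_partials_def by blast
      ultimately show ?thesis using DERIV_unique by blast
    qed
    have "\<eta> (x - y) * v y = \<eta> (x - y) * u y" for y
      using inK[of y] \<eta>(3)[of "x - y"] by (cases "norm (x - y) \<le> \<epsilon>") (auto simp: v_def)
    then have 1: "\<phi> x = conv \<eta> u x" by (simp only: \<phi>_def conv_def)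
    have "D i (x - y) * v y = D i (x - y) * u y" for i y
      using inK[of y] D0[of "x - y" i] by (cases "norm (x - y) \<le> \<epsilon>") (auto simp: v_def)
    then have "grad \<phi> x $ i = conv (D i) u x" for i unfolding grad by (simp only: conv_def)
    \<comment> \<open>The weak derivative identity is tested with the reflected mollifier; it
      becomes applicable once the cutoff has been replaced by \<open>u\<close>.\<close>
    also have "conv (D i) u x = conv \<eta> (G i) x" for i
      using w[OF has_partials_reflect[OF p, of x] bsupp_reflect[OF \<eta>(4), of x], of i]
      by (simp add: conv_def mult.commute)
    finally have 2: "grad \<phi> x $ i = conv \<eta> (G i) x" for i .
    show "\<bar>\<phi> x - u x\<bar> \<le> \<delta> \<and> (\<forall>i. \<bar>grad \<phi> x $ i - G i x\<bar> \<le> \<delta>)"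
    proof (intro conjI allI)
      show "\<bar>\<phi> x - u x\<bar> \<le> \<delta>" unfolding 1
        by (rule conv_approx[OF c\<eta> \<eta>(4,2,5,3) m(1) b(1)]) (use near \<delta> in auto)
      show "\<bar>grad \<phi> x $ i - G i x\<bar> \<le> \<delta>" for i unfolding 2
        by (rule conv_approx[OF c\<eta> \<eta>(4,2,5,3) m(2) b(2)]) (use near \<delta> in auto)
    qed
  qed
qed

text \<open>The approximants are the truncated mollifications at radius 1/(j+1) on the part of the
  strip inside the ball of radius j+1. A bounded \<open>U\<close> with closure in the strip has
  positive depth, so it eventually lies in the region where they are close to \<open>u\<close>,
  uniformly and with gradients.\<close>

lemma weak_sol_imp_weak_solution:
  fixes u :: "real^'n::finite \<Rightarrow> real"
  assumes ws: "weak_sol k d g u G" and g: "g \<in> borel_measurable borel"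
    and rhs: "(\<lambda>x. lam x * f (u x) + h x) \<in> borel_measurable (lebesgue_on (strip k d))"
    and eq: "AE x in lebesgue_on (strip k d). lam x * f (u x) + h x = g x"
  shows "weak_solution (strip k d) lam f h u"
proof -
  have c: "continuous_on UNIV u" "\<And>i. continuous_on UNIV (G i)"
    and wd: "\<And>\<phi> D i. has_partials \<phi> D \<Longrightarrow> bsupp \<phi> \<Longrightarrow> (LINT x|lborel. u x * D i x) = - (LINT x|lborel. G i x * \<phi> x)"
    and we: "\<And>\<phi> D. has_partials \<phi> D \<Longrightarrow> bsupp \<phi> \<Longrightarrow> (\<Sum>i\<in>UNIV. LINT x|lborel. G i x * D i x) = (LINT x|lborel. g x * \<phi> x)"
    using ws unfolding weak_sol_def by auto
  obtain B where b: "\<And>x. \<bar>u x\<bar> \<le> B" "\<And>i x. \<bar>G i x\<bar> \<le> B" using ws unfolding weak_sol_def by blast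
  have Gm: "G i \<in> borel_measurable borel" for i using c by (auto intro: borel_measurable_continuous_onI)
  define V where "V = (\<lambda>x. \<chi> i. G i x)"
  define \<Omega> where "\<Omega> j = strip k d \<inter> ball 0 (real j + 1)" for j
  define \<epsilon> where "\<epsilon> j = 1 / real (Suc j)" for j
  have \<epsilon>0: "\<epsilon> j > 0" for j by (simp add: \<epsilon>_def)
  have "\<forall>j. \<exists>\<phi>. test_fun (\<Omega> j) \<phi> \<and> (\<forall>x \<delta>. \<bar>x $ k\<bar> + 3 * \<epsilon> j \<le> d / 2 \<longrightarrow> norm x + 3 * \<epsilon> j \<le> real j + 1 \<longrightarrow> \<delta> \<ge> 0 \<longrightarrow>
       (\<forall>y. norm (x - y) < \<epsilon> j \<longrightarrow> \<bar>u y - u x\<bar> \<le> \<delta> \<and> (\<forall>i. \<bar>G i y - G i x\<bar> \<le> \<delta>)) \<longrightarrow>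
       \<bar>\<phi> x - u x\<bar> \<le> \<delta> \<and> (\<forall>i. \<bar>grad \<phi> x $ i - G i x\<bar> \<le> \<delta>))"
  proof
    fix j
    show "\<exists>\<phi>. test_fun (\<Omega> j) \<phi> \<and> (\<forall>x \<delta>. \<bar>x $ k\<bar> + 3 * \<epsilon> j \<le> d / 2 \<longrightarrow> norm x + 3 * \<epsilon> j \<le> real j + 1 \<longrightarrow> \<delta> \<ge> 0 \<longrightarrow>
       (\<forall>y. norm (x - y) < \<epsilon> j \<longrightarrow> \<bar>u y - u x\<bar> \<le> \<delta> \<and> (\<forall>i. \<bar>G i y - G i x\<bar> \<le> \<delta>)) \<longrightarrow>
       \<bar>\<phi> x - u x\<bar> \<le> \<delta> \<and> (\<forall>i. \<bar>grad \<phi> x $ i - G i x\<bar> \<le> \<delta>))"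
      by (rule interior_approximation[where u = u and G = G and B = B and \<epsilon> = "\<epsilon> j" and k = k and d = d and r = "real j + 1"])
         (use c b wd \<epsilon>0 in \<open>auto simp: \<Omega>_def\<close>)
  qed
  from choice[OF this] obtain us where us: "\<And>j. test_fun (\<Omega> j) (us j)"
    and appr: "\<And>j x \<delta>. \<bar>x $ k\<bar> + 3 * \<epsilon> j \<le> d / 2 \<Longrightarrow> norm x + 3 * \<epsilon> j \<le> real j + 1 \<Longrightarrow> \<delta> \<ge> 0 \<Longrightarrow>
       (\<And>y. norm (x - y) < \<epsilon> j \<Longrightarrow> \<bar>u y - u x\<bar> \<le> \<delta> \<and> (\<forall>i. \<bar>G i y - G i x\<bar> \<le> \<delta>)) \<Longrightarrow>
       \<bar>us j x - u x\<bar> \<le> \<delta> \<and> (\<forall>i. \<bar>grad (us j) x $ i - G i x\<bar> \<le> \<delta>)"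
    by blast
  have \<Omega>o: "open (\<Omega> j)" "bounded (\<Omega> j)" for j
    unfolding \<Omega>_def using open_strip by (auto intro: bounded_subset[OF bounded_ball])
  show ?thesis
    unfolding weak_solution_def
  proof (rule exI[of _ \<Omega>], rule exI[of _ us], rule exI[of _ "\<lambda>j. grad (us j)"], rule exI[of _ V], intro conjI allI impI, goal_cases)
    case (1 j) show ?case by (rule \<Omega>o)
  next
    case (2 j) show ?case by (rule \<Omega>o)
  next
    case (3 j) show ?case by (auto simp: \<Omega>_def)
  next
    case (4 j) show ?case by (auto simp: \<Omega>_def)
  next
    case 5
    have "x \<in> (\<Union>j. \<Omega> j)" if "x \<in> strip k d" for x
    proof -
      obtain n :: nat where "norm x < real n" using reals_Archimedean2 by blast
      then have "x \<in> \<Omega> n" using that by (simp add: \<Omega>_def)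
      then show ?thesis by blast
    qed
    then show ?case by (auto simp: \<Omega>_def)
  next
    case (6 j) show ?case by (rule test_fun_sobolev12_0[OF us \<Omega>o])
  next
    case (7 U)
    then show ?case unfolding V_def by (intro sobolev12I[where B = B and C = "\<lambda>_. B"]) (use c b wd in auto)
  next
    case (8 U)
    then show ?case using test_fun_sobolev12[OF us] by (intro always_eventually allI) auto
  next
    case (9 U)
    then have U: "open U" "bounded U" "closure U \<subseteq> strip k d" by auto
    show ?case
    proof (rule w12_dist2_tendsto_0[OF U(1,2)])
      fix \<delta> :: real assume \<delta>: "\<delta> > 0"
      have cU: "compact (closure U)" using U(2) by (simp add: compact_eq_bounded_closed bounded_closure)
      obtain N where N: "\<And>x. x \<in> U \<Longrightarrow> norm x \<le> N" using U(2) unfolding bounded_iff by blast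
      \<comment> \<open>The distance to the faces is positive because |x_k| attains its maximum over
        the compact closure of \<open>U\<close>, at a point of the strip.\<close>
      obtain e where e: "e > 0" "\<And>x. x \<in> U \<Longrightarrow> \<bar>x $ k\<bar> + e \<le> d / 2"
      proof (cases "U = {}")
        case True then show ?thesis using that[of 1] by simp
      next
        case False
        then have ne: "closure U \<noteq> {}" by simp
        have "continuous_on (closure U) (\<lambda>x. \<bar>x $ k\<bar>)" by (intro continuous_intros)
        from continuous_attains_sup[OF cU ne this]
        obtain x0 where x0: "x0 \<in> closure U" "\<And>y. y \<in> closure U \<Longrightarrow> \<bar>y $ k\<bar> \<le> \<bar>x0 $ k\<bar>"
          by blast
        have "\<bar>x0 $ k\<bar> < d / 2" using x0(1) U(3) by (auto simp: strip_def abs_less_iff)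
        moreover have "\<bar>y $ k\<bar> \<le> \<bar>x0 $ k\<bar>" if "y \<in> U" for y using x0(2) closure_subset that by blast
        ultimately show ?thesis using that[of "d / 2 - \<bar>x0 $ k\<bar>"] by auto
      qed
      have uc: "uniformly_continuous_on (cball 0 (N + 1)) u"
        by (intro compact_uniformly_continuous continuous_on_subset[OF c(1)]) auto
      have uG: "uniformly_continuous_on (cball 0 (N + 1)) V"
        unfolding V_def by (intro compact_uniformly_continuous continuous_on_subset[OF continuous_on_vec_lambda[OF c(2)]]) auto
      obtain s1 where s1: "s1 > 0" "\<And>x y. x \<in> cball 0 (N + 1) \<Longrightarrow> y \<in> cball 0 (N + 1) \<Longrightarrow> dist y x < s1 \<Longrightarrow> dist (u y) (u x) < \<delta>"
        using uc \<delta> unfolding uniformly_continuous_on_def by metis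
      obtain s2 where s2: "s2 > 0" "\<And>x y. x \<in> cball 0 (N + 1) \<Longrightarrow> y \<in> cball 0 (N + 1) \<Longrightarrow> dist y x < s2 \<Longrightarrow> dist (V y) (V x) < \<delta>"
        using uG \<delta> unfolding uniformly_continuous_on_def by metis
      \<comment> \<open>Below e/3, since depth 3\<epsilon> is required; below 1, so that points
        \<epsilon>-close to \<open>U\<close> remain in the ball of radius \<open>N + 1\<close>;
        below \<open>s1\<close> and \<open>s2\<close> for uniform continuity. The later condition j
        \<ge> N + 3 gives enough depth inside the ball.\<close>
      have "(\<lambda>j. \<epsilon> j) \<longlonglongrightarrow> 0" unfolding \<epsilon>_def by (rule LIMSEQ_inverse_real_of_nat[unfolded inverse_eq_divide])
      then have "\<forall>\<^sub>F j in sequentially. \<epsilon> j < min (min s1 s2) (min 1 (e / 3))"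
        using s1 s2 e by (intro order_tendstoD) auto
      moreover have "\<forall>\<^sub>F j in sequentially. real j \<ge> N + 3"
        using filterlim_real_sequentially by (simp add: filterlim_at_top)
      ultimately show "\<forall>\<^sub>F j in sequentially. \<forall>x\<in>U. \<bar>us j x - u x\<bar> \<le> \<delta> \<and> (\<forall>i. \<bar>grad (us j) x $ i - V x $ i\<bar> \<le> \<delta>)"
      proof eventually_elim
        case (elim j)
        show ?case
        proof
          fix x assume x: "x \<in> U"
          have "\<bar>us j x - u x\<bar> \<le> \<delta> \<and> (\<forall>i. \<bar>grad (us j) x $ i - G i x\<bar> \<le> \<delta>)"
          proof (rule appr)
            show "\<bar>x $ k\<bar> + 3 * \<epsilon> j \<le> d / 2" using e(2)[OF x] elim by linarith
            show "norm x + 3 * \<epsilon> j \<le> real j + 1" using N[OF x] elim by linarith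
            show "\<delta> \<ge> 0" using \<delta> by simp
            fix y assume y: "norm (x - y) < \<epsilon> j"
            have "norm y \<le> N + 1" using y N[OF x] elim norm_triangle_ineq2[of y x] by (simp add: norm_minus_commute)
            then have mem: "x \<in> cball 0 (N + 1)" "y \<in> cball 0 (N + 1)" using N[OF x] by auto
            have dy: "dist y x < s1" "dist y x < s2" using y elim by (auto simp: dist_norm norm_minus_commute)
            have "\<bar>u y - u x\<bar> \<le> \<delta>" using s1(2)[OF mem dy(1)] by (simp add: dist_norm)
            moreover have "\<bar>G i y - G i x\<bar> \<le> \<delta>" for i
              using s2(2)[OF mem dy(2)] component_le_norm_cart[of "V y - V x" i] by (simp add: dist_norm V_def)
            ultimately show "\<bar>u y - u x\<bar> \<le> \<delta> \<and> (\<forall>i. \<bar>G i y - G i x\<bar> \<le> \<delta>)" by blast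
          qed
          then show "\<bar>us j x - u x\<bar> \<le> \<delta> \<and> (\<forall>i. \<bar>grad (us j) x $ i - V x $ i\<bar> \<le> \<delta>)" by (simp add: V_def)
        qed
      qed
    qed
  next
    case (10 \<phi>)
    note T = test_funD[OF 10]
    note Tm = has_partials_measurable[OF T(1)]
    have S: "strip k d \<in> sets borel" by (rule borel_open[OF open_strip])
    have inner: "V x \<bullet> grad \<phi> x = (\<Sum>i\<in>UNIV. G i x * pderiv_at i \<phi> x)" for x
      by (simp add: V_def grad_def inner_vec_def)
    have I: "integrable lborel (\<lambda>x. G i x * pderiv_at i \<phi> x)" for i
      using integrable_mult_bounded(2)[OF integrable_bsupp[OF has_partials_continuous(2)[OF T(1)] bsupp_partial[OF T(1,2)]], of "G i" B i] Gm b(2) by simp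
    have "integral\<^sup>L (lebesgue_on (strip k d)) (\<lambda>x. V x \<bullet> grad \<phi> x) = (LINT x|lborel. (\<Sum>i\<in>UNIV. G i x * pderiv_at i \<phi> x))"
      unfolding inner using S Gm Tm T(4) by (intro integral_lebesgue_on_eq) auto
    also have "\<dots> = (\<Sum>i\<in>UNIV. LINT x|lborel. G i x * pderiv_at i \<phi> x)"
      using I by (simp add: Bochner_Integration.integral_sum)
    also have "\<dots> = (LINT x|lborel. g x * \<phi> x)" by (rule we[OF T(1,2)])
    also have "\<dots> = integral\<^sup>L (lebesgue_on (strip k d)) (\<lambda>x. g x * \<phi> x)"
      using S g Tm T(3) by (intro integral_lebesgue_on_eq[symmetric]) auto
    also have "\<dots> = integral\<^sup>L (lebesgue_on (strip k d)) (\<lambda>x. (lam x * f (u x) + h x) * \<phi> x)"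
    proof (rule integral_cong_AE)
      show "(\<lambda>x. g x * \<phi> x) \<in> borel_measurable (lebesgue_on (strip k d))"
        using g Tm by (intro borel_imp_lebesgue_on) auto
      show "(\<lambda>x. (lam x * f (u x) + h x) * \<phi> x) \<in> borel_measurable (lebesgue_on (strip k d))"
        using rhs borel_imp_lebesgue_on[OF Tm(1)] by (intro borel_measurable_times) auto
      show "AE x in lebesgue_on (strip k d). g x * \<phi> x = (lam x * f (u x) + h x) * \<phi> x"
        using eq by eventually_elim simp
    qed
    finally show ?case .
  qed
qed

theorem theorem4p3:
  fixes k :: "'n::finite" and d \<theta> :: real
    and f :: "real \<Rightarrow> real" and lam h :: "real^'n \<Rightarrow> real"
  assumes d_pos: "d > 0"
    and f_diff: "\<forall>x. f differentiable (at x)"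
    and f_nonneg: "\<forall>x. 0 \<le> f x"
    and f_mono: "mono f"
    and f'_bdd: "\<forall>K. compact K \<longrightarrow> bounded (deriv f ` K)"
    and lam_Linf: "memLinf (strip k d) lam"
    and h_Linf: "memLinf (strip k d) h"
    and lam_nonneg: "AE x in lebesgue_on (strip k d). 0 \<le> lam x"
    and h_nonneg: "AE x in lebesgue_on (strip k d). 0 \<le> h x"
    and theta: "0 < \<theta>" "\<theta> < 1"
    and smallness:
      "(d\<^sup>2 / 8) * linf_norm (strip k d) lam *
         Sup (deriv f ` {-((d\<^sup>2 / 8) * linf_norm (strip k d) h
                + (1 / \<theta>) * linf_norm (strip k d) lam * (d\<^sup>2 / 8)
                  * Sup (f ` {-((d\<^sup>2 / 8) * linf_norm (strip k d) h) .. (d\<^sup>2 / 8) * linf_norm (strip k d) h}))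
            .. (d\<^sup>2 / 8) * linf_norm (strip k d) h
                + (1 / \<theta>) * linf_norm (strip k d) lam * (d\<^sup>2 / 8)
                  * Sup (f ` {-((d\<^sup>2 / 8) * linf_norm (strip k d) h) .. (d\<^sup>2 / 8) * linf_norm (strip k d) h})})
       \<le> 1 - \<theta>"
  shows "\<exists>u. weak_solution (strip k d) lam f h u \<and> memLinf (strip k d) u \<and>
           linf_norm (strip k d) u \<le> (d\<^sup>2 / 8) * linf_norm (strip k d) h
              + (1 / \<theta>) * (d\<^sup>2 / 8) * linf_norm (strip k d) lam
                * Sup (f ` {-((d\<^sup>2 / 8) * linf_norm (strip k d) h) .. (d\<^sup>2 / 8) * linf_norm (strip k d) h})"
proof -
  define S where "S = strip k d"
  define c where "c = d\<^sup>2 / 8"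
  define \<Lambda> where "\<Lambda> = linf_norm S lam"
  define H where "H = linf_norm S h"
  define L where "L = Sup (f ` {- (c * H)..c * H})"
  \<comment> \<open>The asserted bound itself is the radius of the ball in which the iteration takes
    place.\<close>
  define R where "R = c * H + 1 / \<theta> * \<Lambda> * c * L"
  define M where "M = Sup (deriv f ` {- R..R})"
  have So: "open S" unfolding S_def by (rule open_strip)
  have lam_L: "memLinf S lam" and h_L: "memLinf S h" using lam_Linf h_Linf by (auto simp: S_def)
  have c0: "c > 0" using d_pos by (simp add: c_def)
  have \<Lambda>0: "\<Lambda> \<ge> 0" and H0: "H \<ge> 0"
    unfolding \<Lambda>_def H_def using linf_norm_props(1)[OF lam_L] linf_norm_props(1)[OF h_L] by auto
  have small: "c * \<Lambda> * M \<le> 1 - \<theta>"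
    using smallness unfolding M_def R_def L_def \<Lambda>_def H_def c_def S_def .
  have df: "(f has_real_derivative deriv f x) (at x)" for x
    using f_diff by (metis DERIV_imp_deriv real_differentiable_def)
  have cf: "continuous_on UNIV f"
    using df by (meson DERIV_isCont continuous_at_imp_continuous_on)
  have fL: "f (c * H) \<le> L"
    unfolding L_def
  proof (rule cSup_upper)
    show "f (c * H) \<in> f ` {- (c * H)..c * H}" using c0 H0 by auto
    show "bdd_above (f ` {- (c * H)..c * H})"
      by (intro bounded_imp_bdd_above compact_imp_bounded compact_continuous_image continuous_on_subset[OF cf]) auto
  qed
  have L0: "L \<ge> 0" using fL f_nonneg order.trans by blast
  have R0: "c * H \<le> R" "R \<ge> 0"
    using c0 H0 \<Lambda>0 L0 theta by (auto simp: R_def)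
  have dM: "deriv f x \<le> M" if "\<bar>x\<bar> \<le> R" for x
    unfolding M_def
  proof (rule cSup_upper)
    show "deriv f x \<in> deriv f ` {- R..R}" using that by (intro imageI) auto
    show "bdd_above (deriv f ` {- R..R})" using f'_bdd by (intro bounded_imp_bdd_above) auto
  qed
  \<comment> \<open>Monotonicity makes the derivative nonnegative, so the one-sided bound
    \<open>M\<close> becomes a Lipschitz constant.\<close>
  have d0: "deriv f x \<ge> 0" for x
    using mono_on_imp_deriv_nonneg[of UNIV f "deriv f x" x] f_mono df by simp
  have M0: "M \<ge> 0" using dM[of 0] d0[of 0] R0 by simp
  have lip: "\<bar>f s - f t\<bar> \<le> M * \<bar>s - t\<bar>" if "\<bar>s\<bar> \<le> R" "\<bar>t\<bar> \<le> R" for s t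
  proof -
    have "norm (f s - f t) \<le> M * norm (s - t)"
    proof (rule field_differentiable_bound[where S="{- R..R}" and f'="deriv f"])
      show "norm (deriv f x) \<le> M" if "x \<in> {- R..R}" for x using dM[of x] d0[of x] that by (simp add: abs_le_iff)
    qed (use that df in \<open>auto intro: has_field_derivative_at_within\<close>)
    then show ?thesis by simp
  qed
  \<comment> \<open>Bounds \<open>f\<close> on the large interval: the maximum there is
    \<open>f R\<close>, and passing from \<open>c * H\<close> to \<open>R\<close> increases
    \<open>f\<close> by at most \<open>M\<close> times the distance.\<close>
  define F where "F = L + M * (R - c * H)"
  have fF: "f t \<le> F" if "\<bar>t\<bar> \<le> R" for t
  proof -
    have "f t \<le> f R" using f_mono that by (auto simp: mono_def)
    moreover have "\<bar>f R - f (c * H)\<bar> \<le> M * \<bar>R - c * H\<bar>" by (rule lip) (use R0 c0 H0 in auto)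
    ultimately show ?thesis using fL R0 by (simp add: F_def)
  qed
  have FR: "c * (\<Lambda> * F + H) \<le> R"
  proof -
    \<comment> \<open>\<open>X\<close> is the excess of the radius over \<open>c * H\<close>. The
      part of the right-hand side from \<open>L\<close> contributes \<theta>X, and the growth of
      \<open>f\<close> contributes at most (1 - \<theta>)X by the smallness assumption; the two add
      up to \<open>X\<close>, which explains the factor 1/\<theta>.\<close>
    define X where "X = \<Lambda> * c * L / \<theta>"
    have X0: "X \<ge> 0" using \<Lambda>0 c0 L0 theta by (simp add: X_def)
    have RX: "R = c * H + X" by (simp add: R_def X_def)
    have X\<theta>: "c * \<Lambda> * L = \<theta> * X" using theta by (simp add: X_def)
    have "c * (\<Lambda> * F + H) = c * H + c * \<Lambda> * L + (c * \<Lambda> * M) * X"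
      by (simp add: F_def RX algebra_simps)
    also have "\<dots> \<le> c * H + \<theta> * X + (1 - \<theta>) * X"
      unfolding X\<theta> by (intro add_left_mono mult_right_mono small X0)
    also have "\<dots> = R" by (simp add: RX algebra_simps)
    finally show ?thesis .
  qed
  obtain lam' where lam': "lam' \<in> borel_measurable borel" "\<And>x. 0 \<le> lam' x" "\<And>x. lam' x \<le> \<Lambda>" "AE x in lebesgue_on S. lam x = lam' x"
    unfolding \<Lambda>_def using Linf_borel_representative[OF So lam_L] lam_nonneg unfolding S_def by blast
  obtain h' where h': "h' \<in> borel_measurable borel" "\<And>x. 0 \<le> h' x" "\<And>x. h' x \<le> H" "AE x in lebesgue_on S. h x = h' x"
    unfolding H_def using Linf_borel_representative[OF So h_L] h_nonneg unfolding S_def by blast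
  \<comment> \<open>The contraction constant is 1 - \<theta>, so the smallness assumption serves
    both the invariance of the ball and the contraction.\<close>
  obtain u G where ws: "weak_sol k d (antiper_ext k d (\<lambda>x. lam' x * f (u x) + h' x)) u G" and uR: "\<And>x. \<bar>u x\<bar> \<le> R"
  proof (rule nonlinear_weak_sol_exists[OF d_pos lam'(1-3) h'(1-3) cf _ fF _ lip])
    show "d\<^sup>2 / 8 * (\<Lambda> * F + H) \<le> R" using FR by (simp add: c_def)
    show "d\<^sup>2 / 8 * \<Lambda> * M \<le> 1 - \<theta>" using small by (simp add: c_def)
  qed (use f_nonneg theta R0 M0 in auto)
  have um: "u \<in> borel_measurable borel"
    using ws unfolding weak_sol_def by (auto intro: borel_measurable_continuous_onI)
  have fm: "f \<in> borel_measurable borel" by (rule borel_measurable_continuous_onI[OF cf])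
  have fum: "(\<lambda>x. f (u x)) \<in> borel_measurable borel" by (rule measurable_compose[OF um fm])
  have "weak_solution (strip k d) lam f h u"
  proof (rule weak_sol_imp_weak_solution[OF ws])
    show "antiper_ext k d (\<lambda>x. lam' x * f (u x) + h' x) \<in> borel_measurable borel"
      using lam'(1) h'(1) fum by (intro antiper_ext_measurable) auto
    show "(\<lambda>x. lam x * f (u x) + h x) \<in> borel_measurable (lebesgue_on (strip k d))"
      using lam_L h_L borel_imp_lebesgue_on[OF fum] unfolding memLinf_def S_def by (intro borel_measurable_add borel_measurable_times) auto
    have "AE x in lebesgue_on S. x \<in> S" by (rule AE_I2) simp
    with lam'(4) h'(4) show "AE x in lebesgue_on (strip k d). lam x * f (u x) + h x = antiper_ext k d (\<lambda>x. lam' x * f (u x) + h' x) x"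
      unfolding S_def by eventually_elim (simp add: antiper_ext_strip)
  qed
  moreover have "memLinf (strip k d) u"
    unfolding memLinf_def using borel_imp_lebesgue_on[OF um] uR by auto
  moreover have "linf_norm (strip k d) u \<le> R"
    unfolding linf_norm_def
  proof (rule cInf_lower)
    show "R \<in> {C. 0 \<le> C \<and> (AE x in lebesgue_on (strip k d). \<bar>u x\<bar> \<le> C)}" using uR R0 by simp
    show "bdd_below {C. 0 \<le> C \<and> (AE x in lebesgue_on (strip k d). \<bar>u x\<bar> \<le> C)}" by (rule bdd_belowI[of _ 0]) simp
  qed
  moreover have "R = (d\<^sup>2 / 8) * linf_norm (strip k d) h
              + (1 / \<theta>) * (d\<^sup>2 / 8) * linf_norm (strip k d) lam
                * Sup (f ` {-((d\<^sup>2 / 8) * linf_norm (strip k d) h) .. (d\<^sup>2 / 8) * linf_norm (strip k d) h})"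
    unfolding R_def L_def \<Lambda>_def H_def c_def S_def by simp
  ultimately show ?thesis by auto
qed

end
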